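(* Every $7$-dimensional splittable flat solvmanifold admits a coclosed $G_2$-structure, and admits a divergence-free $G_2$-structure.
   Context: A flat Lie group is a simply connected Lie group with a flat left-invariant metric; it has the form $G=\mathbb{R}^k\ltimes_\phi\mathbb{R}^m$, where $\mathbb{R}^m$ is the nilradical and $\mathbb{R}^k$ acts on $\mathbb{R}^m$ by (commuting) orthogonal transformations. A lattice (discrete cocompact subgroup) $\Gamma$ of $G$ is splittable if $\Gamma=\Gamma_1\ltimes_\phi\Gamma_2$ with $\Gamma_1\subset\mathbb{R}^k$, $\Gamma_2\subset\mathbb{R}^m$ lattices; then $\Gamma\backslash G$ is called a splittable flat solvmanifold. A $G_2$-structure on a $7$-manifold $M$ is a $3$-form $\varphi$ which at every point can be written in some basis $\{e^i\}$ of the cotangent space as $e^{123}+e^{145}+e^{167}+e^{246}-e^{257}-e^{347}-e^{356}$, where $e^{ijk}=e^i\wedge e^j\wedge e^k$. It induces a metric $g_\varphi$ and volume form via $g_\varphi(X,Y)\operatorname{vol}_\varphi=\frac16\iota_X\varphi\wedge\iota_Y\varphi\wedge\varphi$, and a Hodge star $\star_\varphi$. It is coclosed if $d\star_\varphi\varphi=0$. Let $\nabla$ be the Levi-Civita connection of $g_\varphi$. The full torsion tensor is the endomorphism $T_\varphi$ of $TM$ determined by $\nabla_X\varphi=\iota_{T_\varphi(X)}\star_\varphi\varphi$ for all $X$, viewed as a $(0,2)$-tensor by means of $g_\varphi$, $T_\varphi(X,Y)=g_\varphi(T_\varphi(X),Y)$. Its divergence is the vector field $\operatorname{div}T_\varphi$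 with $g_\varphi(\operatorname{div}T_\varphi,E_j)=\sum_{i=1}^7(\nabla_{E_i}T_\varphi)(E_i,E_j)$ for any local orthonormal frame $\{E_i\}$; $\varphi$ is divergence-free if $\operatorname{div}T_\varphi=0$. *)

theory Defs
  imports
    "HOL-Analysis.Analysis"
    "HOL-Algebra.Coset"
    "HOL-Algebra.Generated_Groups"
    "HOL-Combinatorics.Permutations"
begin

section \<open>Flat Lie groups and splittable lattices\<close>

type_synonym vec7 = "real ^ 7"

text \<open>Smoothness on an open set: all iterated directional derivatives exist and are continuous.\<close>

primrec ck_on :: "nat \<Rightarrow> vec7 set \<Rightarrow> (vec7 \<Rightarrow> 'b::real_normed_vector) \<Rightarrow> bool" where
  "ck_on 0 S f \<longleftrightarrow> continuous_on S f"
| "ck_on (Suc n) S f \<longleftrightarrow>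
     (\<forall>x\<in>S. f differentiable (at x)) \<and>
     (\<forall>v. ck_on n S (\<lambda>x. frechet_derivative f (at x) v))"

definition smooth_on :: "vec7 set \<Rightarrow> (vec7 \<Rightarrow> 'b::real_normed_vector) \<Rightarrow> bool" where
  "smooth_on S f \<longleftrightarrow> (\<forall>n. ck_on n S f)"

text \<open>
  The underlying manifold of the semidirect product of \<open>\<real>\<^sup>k\<close> and \<open>\<real>\<^sup>m\<close>, with \<open>k + m = 7\<close>, is
  \<open>\<real>\<^sup>7\<close>. The factor \<open>\<real>\<^sup>k\<close> consists of the vectors supported on a set \<open>K\<close> of \<open>k\<close> indices and
  \<open>\<real>\<^sup>m\<close> of those supported on the complement; the pair \<open>(s, v)\<close> is the vector \<open>s + v\<close>. The
  set \<open>K\<close> may be empty, in which case the group is abelian.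
\<close>

definition coord_space :: "7 set \<Rightarrow> vec7 set" where
  "coord_space K = {x. \<forall>i. i \<notin> K \<longrightarrow> x $ i = 0}"

definition coord_proj :: "7 set \<Rightarrow> vec7 \<Rightarrow> vec7" where
  "coord_proj K x = (\<chi> i. if i \<in> K then x $ i else 0)"

text \<open>
  An orthogonal transformation \<open>\<phi> s\<close> of \<open>\<real>\<^sup>m\<close> is represented by the orthogonal transformation
  \<open>\<rho> s\<close> of \<open>\<real>\<^sup>7\<close> extending it by the identity on \<open>\<real>\<^sup>k\<close>. The product
  \<open>(s, v) (t, w) = (s + t, v + \<phi> s w)\<close> is then \<open>x + \<rho> s y\<close> for \<open>x = s + v\<close> and \<open>y = t + w\<close>,
  because \<open>\<rho> s (t + w) = t + \<phi> s w\<close>.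
\<close>

definition semidirect :: "7 set \<Rightarrow> (vec7 \<Rightarrow> vec7 \<Rightarrow> vec7) \<Rightarrow> vec7 monoid" where
  "semidirect K \<rho> =
     \<lparr>carrier = UNIV, monoid.mult = (\<lambda>x y. x + \<rho> (coord_proj K x) y), one = 0\<rparr>"

definition orthogonal_action :: "7 set \<Rightarrow> (vec7 \<Rightarrow> vec7 \<Rightarrow> vec7) \<Rightarrow> bool" where
  "orthogonal_action K \<rho> \<longleftrightarrow>
     (\<forall>s\<in>coord_space K. orthogonal_transformation (\<rho> s) \<and> (\<forall>t\<in>coord_space K. \<rho> s t = t)) \<and>
     (\<rho> 0 = id) \<and>
     (\<forall>s\<in>coord_space K. \<forall>t\<in>coord_space K. \<rho> (s + t) = \<rho> s \<circ> \<rho> t) \<and>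
     (\<forall>v. smooth_on UNIV (\<lambda>x. \<rho> (coord_proj K x) v))"

primrec lower_central :: "('a, 'b) monoid_scheme \<Rightarrow> 'a set \<Rightarrow> nat \<Rightarrow> 'a set" where
  "lower_central G N 0 = N"
| "lower_central G N (Suc n) =
     generate G {x \<otimes>\<^bsub>G\<^esub> y \<otimes>\<^bsub>G\<^esub> inv\<^bsub>G\<^esub> x \<otimes>\<^bsub>G\<^esub> inv\<^bsub>G\<^esub> y | x y. x \<in> N \<and> y \<in> lower_central G N n}"

definition nilpotent_subgroup :: "'a set \<Rightarrow> ('a, 'b) monoid_scheme \<Rightarrow> bool" where
  "nilpotent_subgroup N G \<longleftrightarrow> subgroup N G \<and> (\<exists>n. lower_central G N n = {\<one>\<^bsub>G\<^esub>})"

text \<open>The nilradical is the largest connected nilpotent normal closed subgroup.\<close>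

definition is_nilradical :: "('a::topological_space) set \<Rightarrow> ('a, 'b) monoid_scheme \<Rightarrow> bool" where
  "is_nilradical N G \<longleftrightarrow>
     (closed N \<and> connected N \<and> N \<lhd> G \<and> nilpotent_subgroup N G) \<and>
     (\<forall>N'. closed N' \<and> connected N' \<and> N' \<lhd> G \<and> nilpotent_subgroup N' G \<longrightarrow> N' \<subseteq> N)"

definition flat_lie_group :: "7 set \<Rightarrow> (vec7 \<Rightarrow> vec7 \<Rightarrow> vec7) \<Rightarrow> bool" where
  "flat_lie_group K \<rho> \<longleftrightarrow>
     orthogonal_action K \<rho> \<and> is_nilradical (coord_space (- K)) (semidirect K \<rho>)"

text \<open>The set of right cosets \<open>\<Gamma> x\<close> with the quotient topology.\<close>

definition coset_topology :: "('a::topological_space, 'b) monoid_scheme \<Rightarrow> 'a set \<Rightarrow> 'a set topology" where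
  "coset_topology G \<Gamma> = topology (\<lambda>U. U \<subseteq> rcosets\<^bsub>G\<^esub> \<Gamma> \<and>
     openin (top_of_set (carrier G)) {x \<in> carrier G. \<Gamma> #>\<^bsub>G\<^esub> x \<in> U})"

definition is_lattice :: "'a set \<Rightarrow> ('a::topological_space, 'b) monoid_scheme \<Rightarrow> bool" where
  "is_lattice \<Gamma> G \<longleftrightarrow> subgroup \<Gamma> G \<and> discrete \<Gamma> \<and> compact_space (coset_topology G \<Gamma>)"

definition splittable_lattice :: "vec7 set \<Rightarrow> 7 set \<Rightarrow> (vec7 \<Rightarrow> vec7 \<Rightarrow> vec7) \<Rightarrow> bool" where
  "splittable_lattice \<Gamma> K \<rho> \<longleftrightarrow> is_lattice \<Gamma> (semidirect K \<rho>) \<and>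
     (\<exists>\<Gamma>1 \<Gamma>2.
        is_lattice \<Gamma>1 ((semidirect K \<rho>)\<lparr>carrier := coord_space K\<rparr>) \<and>
        is_lattice \<Gamma>2 ((semidirect K \<rho>)\<lparr>carrier := coord_space (- K)\<rparr>) \<and>
        \<Gamma> = {a + b | a b. a \<in> \<Gamma>1 \<and> b \<in> \<Gamma>2})"


section \<open>Tensor fields on a manifold given by an atlas\<close>

text \<open>A chart is a domain together with a coordinate map.\<close>

type_synonym 'p chart = "'p set \<times> ('p \<Rightarrow> vec7)"

text \<open>
  The charts of \<open>\<Gamma>\<setminus>G\<close> are the local inverses of the projection \<open>x \<mapsto> \<Gamma> x\<close>, which is a
  covering map when \<open>\<Gamma>\<close> is discrete.
\<close>

definition quotient_atlas :: "vec7 monoid \<Rightarrow> vec7 set \<Rightarrow> vec7 set chart set" where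
  "quotient_atlas G \<Gamma> =
     {((\<lambda>x. \<Gamma> #>\<^bsub>G\<^esub> x) ` V, inv_into V (\<lambda>x. \<Gamma> #>\<^bsub>G\<^esub> x)) | V.
        open V \<and> inj_on (\<lambda>x. \<Gamma> #>\<^bsub>G\<^esub> x) V}"

text \<open>
  A covariant \<open>p\<close>-tensor is a function of lists of \<open>p\<close> vectors, set to \<open>0\<close> on lists of any other
  length.
\<close>

type_synonym tensor = "vec7 list \<Rightarrow> real"

definition multilinear :: "nat \<Rightarrow> tensor \<Rightarrow> bool" where
  "multilinear p \<alpha> \<longleftrightarrow>
     (\<forall>vs. length vs \<noteq> p \<longrightarrow> \<alpha> vs = 0) \<and>
     (\<forall>vs i. length vs = p \<and> i < p \<longrightarrow> linear (\<lambda>X. \<alpha> (vs[i := X])))"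

definition alternating :: "nat \<Rightarrow> tensor \<Rightarrow> bool" where
  "alternating p \<alpha> \<longleftrightarrow> multilinear p \<alpha> \<and>
     (\<forall>vs i j. length vs = p \<and> i < j \<and> j < p \<and> vs ! i = vs ! j \<longrightarrow> \<alpha> vs = 0)"

text \<open>
  A tensor field is the family of its coordinate expressions, one for each chart, which transform
  into each other by pullback along the changes of coordinates.
\<close>

type_synonym 'p tensor_field = "'p chart \<Rightarrow> vec7 \<Rightarrow> tensor"

definition is_tensor_field :: "'p chart set \<Rightarrow> nat \<Rightarrow> 'p tensor_field \<Rightarrow> bool" where
  "is_tensor_field A p \<tau> \<longleftrightarrow>
     (\<forall>(U, \<kappa>)\<in>A.
        (\<forall>x\<in>\<kappa> ` U. multilinear p (\<tau> (U, \<kappa>) x)) \<and>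
        (\<forall>vs. length vs = p \<longrightarrow> smooth_on (\<kappa> ` U) (\<lambda>x. \<tau> (U, \<kappa>) x vs))) \<and>
     (\<forall>(U, \<kappa>)\<in>A. \<forall>(U', \<kappa>')\<in>A. \<forall>q\<in>U \<inter> U'. \<forall>vs. length vs = p \<longrightarrow>
        \<tau> (U, \<kappa>) (\<kappa> q) vs =
        \<tau> (U', \<kappa>') (\<kappa>' q) (map (frechet_derivative (\<kappa>' \<circ> inv_into U \<kappa>) (at (\<kappa> q))) vs))"

definition is_differential_form :: "'p chart set \<Rightarrow> nat \<Rightarrow> 'p tensor_field \<Rightarrow> bool" where
  "is_differential_form A p \<omega> \<longleftrightarrow> is_tensor_field A p \<omega> \<and>
     (\<forall>(U, \<kappa>)\<in>A. \<forall>x\<in>\<kappa> ` U. alternating p (\<omega> (U, \<kappa>) x))"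

text \<open>
  \<open>wedge p q \<alpha> \<beta>\<close> is the exterior product of a \<open>p\<close>-form and a \<open>q\<close>-form, normalised so that
  \<open>e\<^sup>1 \<and> \<dots> \<and> e\<^sup>p\<close> has the value \<open>1\<close> on the dual basis.
\<close>

definition wedge :: "nat \<Rightarrow> nat \<Rightarrow> tensor \<Rightarrow> tensor \<Rightarrow> tensor" where
  "wedge p q \<alpha> \<beta> vs = (if length vs = p + q then
     (\<Sum>\<sigma> | \<sigma> permutes {..<p + q}. of_int (sign \<sigma>) *
        \<alpha> (take p (permute_list \<sigma> vs)) * \<beta> (drop p (permute_list \<sigma> vs))) / (fact p * fact q)
     else 0)"

definition interior_prod :: "vec7 \<Rightarrow> tensor \<Rightarrow> tensor" where
  "interior_prod X \<alpha> = (\<lambda>vs. \<alpha> (X # vs))"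

text \<open>The exterior derivative, evaluated on constant vector fields in a chart.\<close>

definition ext_deriv :: "nat \<Rightarrow> (vec7 \<Rightarrow> tensor) \<Rightarrow> vec7 \<Rightarrow> tensor" where
  "ext_deriv p \<omega> x vs = (if length vs = Suc p then
     (\<Sum>i\<le>p. (- 1) ^ i *
        frechet_derivative (\<lambda>y. \<omega> y (take i vs @ drop (Suc i) vs)) (at x) (vs ! i))
     else 0)"


section \<open>Riemannian metrics\<close>

definition inner_product :: "tensor \<Rightarrow> bool" where
  "inner_product g \<longleftrightarrow> multilinear 2 g \<and> (\<forall>X Y. g [X, Y] = g [Y, X]) \<and> (\<forall>X. X \<noteq> 0 \<longrightarrow> g [X, X] > 0)"

definition orthonormal_frame :: "tensor \<Rightarrow> vec7 list \<Rightarrow> bool" where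
  "orthonormal_frame g E \<longleftrightarrow> length E = 7 \<and>
     (\<forall>i<7. \<forall>j<7. g [E ! i, E ! j] = (if i = j then 1 else 0))"

definition volume_form :: "tensor \<Rightarrow> tensor \<Rightarrow> bool" where
  "volume_form g \<nu> \<longleftrightarrow> alternating 7 \<nu> \<and> (\<forall>E. orthonormal_frame g E \<longrightarrow> \<bar>\<nu> E\<bar> = 1)"

text \<open>
  The Hodge star of a \<open>p\<close>-form \<open>\<alpha>\<close> for the metric \<open>g\<close> and the orientation of \<open>\<nu>\<close>: the linear
  map with \<open>\<star>(e\<^sup>1 \<and> \<dots> \<and> e\<^sup>p) = e\<^bsup>p+1\<^esup> \<and> \<dots> \<and> e\<^sup>7\<close> for every oriented orthonormal coframe.
  Comparing coefficients, \<open>(\<star>\<alpha>)(e\<^bsub>p+1\<^esub>, \<dots>, e\<^sub>7) = \<alpha>(e\<^sub>1, \<dots>, e\<^sub>p)\<close> for every oriented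
  orthonormal frame.
\<close>

definition hodge_star :: "tensor \<Rightarrow> tensor \<Rightarrow> nat \<Rightarrow> tensor \<Rightarrow> tensor" where
  "hodge_star g \<nu> p \<alpha> = (THE \<eta>. alternating (7 - p) \<eta> \<and>
     (\<forall>E. orthonormal_frame g E \<and> \<nu> E = 1 \<longrightarrow> \<eta> (drop p E) = \<alpha> (take p E)))"

text \<open>
  The Levi-Civita connection of \<open>g\<close> in a chart: \<open>levi_civita g x X Y\<close> is the value at \<open>x\<close> of
  \<open>\<nabla>\<^bsub>X\<^esub> Y\<close> for the constant vector fields \<open>X\<close> and \<open>Y\<close>. Torsion-freeness is symmetry, and the
  last condition says that the metric is parallel.
\<close>

definition levi_civita :: "(vec7 \<Rightarrow> tensor) \<Rightarrow> vec7 \<Rightarrow> vec7 \<Rightarrow> vec7 \<Rightarrow> vec7" where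
  "levi_civita g x = (THE C. bilinear C \<and> (\<forall>X Y. C X Y = C Y X) \<and>
     (\<forall>X Y Z. frechet_derivative (\<lambda>y. g y [Y, Z]) (at x) X = g x [C X Y, Z] + g x [Y, C X Z]))"

definition cov_deriv :: "(vec7 \<Rightarrow> tensor) \<Rightarrow> (vec7 \<Rightarrow> tensor) \<Rightarrow> vec7 \<Rightarrow> vec7 \<Rightarrow> tensor" where
  "cov_deriv g \<tau> x X vs =
     frechet_derivative (\<lambda>y. \<tau> y vs) (at x) X -
     (\<Sum>i<length vs. \<tau> x (vs[i := levi_civita g x X (vs ! i)]))"


section \<open>\<open>G\<^sub>2\<close>-structures\<close>

definition covector :: "(vec7 \<Rightarrow>\<^sub>L real) \<Rightarrow> tensor" where
  "covector a vs = (if length vs = 1 then blinfun_apply a (hd vs) else 0)"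

definition elementary3 :: "(nat \<Rightarrow> vec7 \<Rightarrow>\<^sub>L real) \<Rightarrow> nat \<Rightarrow> nat \<Rightarrow> nat \<Rightarrow> tensor" where
  "elementary3 e i j k = wedge 2 1 (wedge 1 1 (covector (e i)) (covector (e j))) (covector (e k))"

definition is_G2_form :: "tensor \<Rightarrow> bool" where
  "is_G2_form \<phi> \<longleftrightarrow> (\<exists>e :: nat \<Rightarrow> vec7 \<Rightarrow>\<^sub>L real.
     inj_on e {1..7} \<and> independent (e ` {1..7}) \<and> span (e ` {1..7}) = UNIV \<and>
     \<phi> = (\<lambda>vs. elementary3 e 1 2 3 vs + elementary3 e 1 4 5 vs + elementary3 e 1 6 7 vs
            + elementary3 e 2 4 6 vs - elementary3 e 2 5 7 vs
            - elementary3 e 3 4 7 vs - elementary3 e 3 5 6 vs))"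

definition G2_structure :: "'p chart set \<Rightarrow> 'p tensor_field \<Rightarrow> bool" where
  "G2_structure A \<phi> \<longleftrightarrow> is_differential_form A 3 \<phi> \<and>
     (\<forall>(U, \<kappa>)\<in>A. \<forall>x\<in>\<kappa> ` U. is_G2_form (\<phi> (U, \<kappa>) x))"

definition G2_induces :: "tensor \<Rightarrow> tensor \<Rightarrow> tensor \<Rightarrow> bool" where
  "G2_induces \<phi> g \<nu> \<longleftrightarrow> inner_product g \<and> volume_form g \<nu> \<and>
     (\<forall>X Y vs. length vs = 7 \<longrightarrow> g [X, Y] * \<nu> vs =
        1 / 6 * wedge 4 3 (wedge 2 2 (interior_prod X \<phi>) (interior_prod Y \<phi>)) \<phi> vs)"

definition G2_metric :: "tensor \<Rightarrow> tensor" where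
  "G2_metric \<phi> = (THE g. \<exists>\<nu>. G2_induces \<phi> g \<nu>)"

definition G2_volume :: "tensor \<Rightarrow> tensor" where
  "G2_volume \<phi> = (THE \<nu>. G2_induces \<phi> (G2_metric \<phi>) \<nu>)"

definition G2_star :: "tensor \<Rightarrow> tensor" where
  "G2_star \<phi> = hodge_star (G2_metric \<phi>) (G2_volume \<phi>) 3 \<phi>"

definition coclosed :: "'p chart set \<Rightarrow> 'p tensor_field \<Rightarrow> bool" where
  "coclosed A \<phi> \<longleftrightarrow> (\<forall>(U, \<kappa>)\<in>A. \<forall>x\<in>\<kappa> ` U. \<forall>vs.
     ext_deriv 4 (\<lambda>y. G2_star (\<phi> (U, \<kappa>) y)) x vs = 0)"

text \<open>In the following four definitions, \<open>\<phi>\<close> is the expression of a \<open>G\<^sub>2\<close>-structure in a chart.\<close>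

definition metric_field :: "(vec7 \<Rightarrow> tensor) \<Rightarrow> vec7 \<Rightarrow> tensor" where
  "metric_field \<phi> = (\<lambda>x. G2_metric (\<phi> x))"

definition full_torsion :: "(vec7 \<Rightarrow> tensor) \<Rightarrow> vec7 \<Rightarrow> vec7 \<Rightarrow> vec7" where
  "full_torsion \<phi> x X = (THE W. \<forall>vs. length vs = 3 \<longrightarrow>
     cov_deriv (metric_field \<phi>) \<phi> x X vs = interior_prod W (G2_star (\<phi> x)) vs)"

definition torsion_tensor :: "(vec7 \<Rightarrow> tensor) \<Rightarrow> vec7 \<Rightarrow> tensor" where
  "torsion_tensor \<phi> x vs = (if length vs = 2 then
     metric_field \<phi> x [full_torsion \<phi> x (vs ! 0), vs ! 1] else 0)"

definition div_torsion :: "(vec7 \<Rightarrow> tensor) \<Rightarrow> vec7 \<Rightarrow> vec7" where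
  "div_torsion \<phi> x = (THE D. \<forall>E. orthonormal_frame (metric_field \<phi> x) E \<longrightarrow>
     (\<forall>j<7. metric_field \<phi> x [D, E ! j] =
        (\<Sum>i<7. cov_deriv (metric_field \<phi>) (torsion_tensor \<phi>) x (E ! i) [E ! i, E ! j])))"

definition divergence_free :: "'p chart set \<Rightarrow> 'p tensor_field \<Rightarrow> bool" where
  "divergence_free A \<phi> \<longleftrightarrow> (\<forall>(U, \<kappa>)\<in>A. \<forall>x\<in>\<kappa> ` U. div_torsion (\<phi> (U, \<kappa>)) x = 0)"

end

theory Submission
  imports Defs "Jordan_Normal_Form.Determinant"
begin

text \<open>
  One form serves both claims. The commuting rotations \<open>\<rho> s\<close> have a common orthonormal frame in
  which \<open>e\<^sub>1\<close> is fixed and the planes \<open>(e\<^sub>2, e\<^sub>3)\<close>, \<open>(e\<^sub>4, e\<^sub>5)\<close>, \<open>(e\<^sub>6, e\<^sub>7)\<close> are rotated by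
  angles that are linear in \<open>s\<close>. The sum of the three angles is represented by a vector of the fixed
  factor \<open>\<real>\<^sup>k\<close>, so \<open>e\<^sub>1\<close> can be chosen proportional to it: the sum is \<open>c \<langle>e\<^sub>1, s\<rangle>\<close>. For the Kaehler
  form \<open>\<omega>\<close> and the holomorphic volume form \<open>\<Omega>\<close> on \<open>\<complex>\<^sup>3\<close> the left-invariant form that equals
  \<open>e\<^sup>1 \<and> \<omega> + Re \<Omega>\<close> at \<open>0\<close> is then \<open>e\<^sup>1 \<and> \<omega> + Re (exp (- i c x\<^sub>1) \<Omega>)\<close> in the flat coordinates. It
  induces the Euclidean metric. Its dual \<open>\<omega> \<and> \<omega> / 2 - e\<^sup>1 \<and> Im (exp (- i c x\<^sub>1) \<Omega>)\<close> depends only on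
  \<open>x\<^sub>1\<close>, through a multiple of \<open>e\<^sup>1\<close>, and so is closed; its torsion is the constant tensor
  \<open>- c e\<^sup>1 \<otimes> e\<^sup>1\<close>, which has no divergence.
\<close>

text \<open>The obstacle is that \<open>Omega\<close> with constant coefficients is preserved only
  up to the product of the three rotation phases, which need not be 1. The compensating phase makes
  the form vary from point to point, and this does no harm because it varies only along a direction
  whose covector already occurs in the term of the dual form that carries the phase. The total
  weight is known only after the rotation planes and their orientations have been chosen. Hence e_1
  is chosen after them, and the planes on which nothing moves are filled in last. That a fixed unit
  vector exists even for total weight 0 is a matter of parity: the moving planes span an even
  dimension and 7 is odd. A phase can be produced by rotating the single plane (e_2, e_3), so at
  every point the form is the standard one in some orthonormal frame. Metric, volume form and star
  are given by definite descriptions, and they are determined once, for an arbitrary frame. As the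
  metric is constant in the flat coordinates, covariant derivatives are partial derivatives.\<close>

hide_const (open) Determinants.det Matrix.orthogonal
no_notation Matrix.scalar_prod (infix "\<bullet>" 70)
no_notation Matrix.vec_index (infixl "$" 100)

section \<open>Decomposable forms\<close>

text \<open>The exterior product of the covectors that are metrically dual to the vectors \<open>as\<close>.\<close>

definition dform :: "vec7 list \<Rightarrow> tensor" where
  "dform as vs = (if length vs = length as
     then det (Matrix.mat (length as) (length as) (\<lambda>(i, j). as ! i \<bullet> vs ! j)) else 0)"

lemma dform_length: "length vs \<noteq> length as \<Longrightarrow> dform as vs = 0"
  by (simp add: dform_def)

lemma dform_Nil [simp]: "dform [] [] = 1"
  by (simp add: dform_def)

lemma dform_sum:
  assumes "length vs = p" "length as = p"
  shows "dform as vs =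
    (\<Sum>\<sigma> | \<sigma> permutes {..<p}. of_int (sign \<sigma>) * (\<Prod>i<p. as ! i \<bullet> vs ! \<sigma> i))"
proof -
  have "dform as vs = (\<Sum>\<sigma> | \<sigma> permutes {0..<p}. of_int (sign \<sigma>) *
     (\<Prod>i = 0..<p. Matrix.mat p p (\<lambda>(i, j). as ! i \<bullet> vs ! j) $$ (i, \<sigma> i)))"
    unfolding dform_def using assms by (simp add: det_def'[of _ p])
  also have "\<dots> = (\<Sum>\<sigma> | \<sigma> permutes {0..<p}. of_int (sign \<sigma>) * (\<Prod>i=0..<p. as ! i \<bullet> vs ! \<sigma> i))"
    by (intro sum.cong refl arg_cong2[of _ _ _ _ "(*)"] prod.cong) 
      (use permutes_in_image in fastforce)
  finally show ?thesis by (simp add: atLeast0LessThan)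
qed

text \<open>Laplace expansion along the first row. It drives the inductions on the list of
  covectors.\<close>

lemma dform_Cons:
  "length vs = Suc (length as) \<Longrightarrow> dform (a # as) vs =
    (\<Sum>j<length vs. (- 1) ^ j * (a \<bullet> vs ! j) * dform as (take j vs @ drop (Suc j) vs))"
proof -
  assume l: "length vs = Suc (length as)"
  define n where "n = length as"
  define M where "M = Matrix.mat (Suc n) (Suc n) (\<lambda>(i, j). (a # as) ! i \<bullet> vs ! j)"
  have M: "M \<in> carrier_mat (Suc n) (Suc n)" by (simp add: M_def)
  have "dform (a # as) vs = det M" by (simp add: dform_def l M_def n_def)
  also have "\<dots> = (\<Sum>j<Suc n. M $$ (0, j) * cofactor M 0 j)"
    using laplace_expansion_row[OF M, of 0] by simp
  also have "\<dots> = (\<Sum>j<length vs. (- 1) ^ j * (a \<bullet> vs ! j) * dform as (take j vs @ drop (Suc j) vs))"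
  proof (rule sum.cong)
    show "{..<Suc n} = {..<length vs}" by (simp add: l n_def)
  next
    fix j assume j: "j \<in> {..<length vs}"
    have "mat_delete M 0 j = Matrix.mat n n (\<lambda>(i, k). as ! i \<bullet> (take j vs @ drop (Suc j) vs) ! k)"
      using j l by (intro eq_matI) (auto simp: mat_delete_def M_def n_def nth_append)
    moreover have "M $$ (0, j) = a \<bullet> vs ! j" using j l by (auto simp: M_def n_def)
    moreover have "length (take j vs @ drop (Suc j) vs) = length as" using j l by auto
    ultimately show "M $$ (0, j) * cofactor M 0 j =
      (- 1) ^ j * (a \<bullet> vs ! j) * dform as (take j vs @ drop (Suc j) vs)"
      by (simp add: cofactor_def dform_def n_def)
  qed
  finally show ?thesis .
qed

text \<open>Transposition. It turns every fact about the covectors into one about the arguments and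
  back.\<close>

lemma dform_commute: "dform as vs = dform vs as"
proof (cases "length vs = length as")
  case True
  define n where "n = length as"
  have "transpose_mat (Matrix.mat n n (\<lambda>(i, j). as ! i \<bullet> vs ! j)) = Matrix.mat n n (\<lambda>(i, j). vs ! i \<bullet> as ! j)"
    by (intro eq_matI) (auto simp: inner_commute)
  then show ?thesis
    unfolding dform_def using True n_def det_transpose[of "Matrix.mat n n (\<lambda>(i, j). as ! i \<bullet> vs ! j)" n] by simp
qed (simp add: dform_def)

lemma dform_swap: "dform (a # b # as) vs = - dform (b # a # as) vs"
proof (cases "length vs = length as + 2")
  case True
  define n where "n = length as + 2"
  define M where "M = Matrix.mat n n (\<lambda>(i, j). (a # b # as) ! i \<bullet> vs ! j)"
  have "swaprows 0 1 M = Matrix.mat n n (\<lambda>(i, j). (b # a # as) ! i \<bullet> vs ! j)"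
    by (intro eq_matI) (auto simp: M_def n_def nth_Cons split: nat.splits)
  moreover have "det (swaprows 0 1 M) = - det M"
    by (rule det_swaprows[of _ n]) (auto simp: n_def M_def)
  ultimately show ?thesis using True by (simp add: dform_def M_def n_def)
qed (simp add: dform_def)

lemma dform_repeat: "dform (a # a # as) vs = 0"
  using dform_swap[of a a as vs] by simp

lemma dform_row_linear:
  "dform (xs @ (r *\<^sub>R a + s *\<^sub>R b) # ys) vs = r * dform (xs @ a # ys) vs + s * dform (xs @ b # ys) vs"
proof (induction xs arbitrary: vs)
  case Nil
  show ?case
  proof (cases "length vs = Suc (length ys)")
    case True
    then show ?thesis
      by (simp add: dform_Cons inner_add_left algebra_simps sum.distrib sum_distrib_left)
  qed (simp add: dform_def)
next
  case (Cons x xs)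
  show ?case
  proof (cases "length vs = length xs + length ys + 2")
    case True
    then show ?thesis
      by (simp add: dform_Cons Cons algebra_simps sum.distrib sum_distrib_left)
  qed (simp add: dform_def)
qed

lemma multilinear_dform: "length as = p \<Longrightarrow> multilinear p (dform as)"
proof -
  assume l: "length as = p"
  have "linear (\<lambda>X. dform as (vs[i := X]))" if "length vs = p" "i < p" for vs i
  proof (rule linearI)
    fix X Y r
    have *: "dform as (vs[i := r *\<^sub>R X + s *\<^sub>R Y]) = r * dform as (vs[i := X]) + s * dform as (vs[i := Y])" for X Y r s
      using dform_row_linear[of "take i vs" r X s Y "drop (Suc i) vs" as] that
      by (simp add: dform_commute[of as] upd_conv_take_nth_drop)
    show "dform as (vs[i := X + Y]) = dform as (vs[i := X]) + dform as (vs[i := Y])"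
      using *[of 1 X 1 Y] by simp
    show "dform as (vs[i := r *\<^sub>R X]) = r *\<^sub>R dform as (vs[i := X])"
      using *[of r X 0 X] by simp
  qed
  then show ?thesis using l by (simp add: multilinear_def dform_def)
qed

lemma alternating_dform: "length as = p \<Longrightarrow> alternating p (dform as)"
proof -
  assume l: "length as = p"
  have "dform as vs = 0" if "length vs = p" "i < j" "j < p" "vs ! i = vs ! j" for vs i j
  proof -
    have "det (Matrix.mat p p (\<lambda>(i, j). as ! i \<bullet> vs ! j)) = 0"
      using that by (intro det_identical_columns[of _ p i j]) auto
    then show ?thesis using that l by (simp add: dform_def)
  qed
  then show ?thesis using multilinear_dform[OF l] unfolding alternating_def by blast
qed

text \<open>The determinant is block triangular: the products of \<open>as\<close> with
  \<open>ws\<close> form its upper right block. In the expansion along the first row only the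
  columns of \<open>vs\<close> survive.\<close>

lemma dform_append_block:
  assumes "length vs = length as" "\<And>a w. a \<in> set as \<Longrightarrow> w \<in> set ws \<Longrightarrow> a \<bullet> w = 0"
  shows "dform (as @ bs) (vs @ ws) = dform as vs * dform bs ws"
  using assms
proof (induction as arbitrary: vs)
  case Nil
  then show ?case by simp
next
  case (Cons a as)
  show ?case
  proof (cases "length ws = length bs")
    case True
    have "dform (a # as @ bs) (vs @ ws) =
      (\<Sum>j<length (vs @ ws). (- 1) ^ j * (a \<bullet> (vs @ ws) ! j) * dform (as @ bs) (take j (vs @ ws) @ drop (Suc j) (vs @ ws)))"
      by (rule dform_Cons) (use Cons True in simp)
    also have "\<dots> = (\<Sum>j<length vs. (- 1) ^ j * (a \<bullet> vs ! j) * dform as (take j vs @ drop (Suc j) vs) * dform bs ws)"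
    proof (rule sum.mono_neutral_cong_right)
      show "\<forall>j\<in>{..<length (vs @ ws)} - {..<length vs}. (- 1) ^ j * (a \<bullet> (vs @ ws) ! j) *
        dform (as @ bs) (take j (vs @ ws) @ drop (Suc j) (vs @ ws)) = 0"
        using Cons.prems(2)[of a] by (auto simp: nth_append)
      fix j assume j: "j \<in> {..<length vs}"
      have "dform (as @ bs) ((take j vs @ drop (Suc j) vs) @ ws) = dform as (take j vs @ drop (Suc j) vs) * dform bs ws"
        by (rule Cons.IH) (use j Cons.prems in auto)
      then show "(- 1) ^ j * (a \<bullet> (vs @ ws) ! j) * dform (as @ bs) (take j (vs @ ws) @ drop (Suc j) (vs @ ws)) =
         (- 1) ^ j * (a \<bullet> vs ! j) * dform as (take j vs @ drop (Suc j) vs) * dform bs ws"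
        using j by (simp add: nth_append)
    qed auto
    also have "\<dots> = dform (a # as) vs * dform bs ws"
      using Cons.prems by (simp add: dform_Cons sum_distrib_right del: sum.lessThan_Suc)
    finally show ?thesis by simp
  qed (use Cons.prems in \<open>simp add: dform_def\<close>)
qed

text \<open>Let \<open>F\<close> be the Leibniz summand of the determinant of size p + q. Expanding
  both factors turns the term of \<sigma> in the wedge into the sum of F (\<sigma> \<circ> (\<tau>
  \<circ> sh \<tau>')) over permutations \<tau> of the first p and \<tau>' of the last q positions,
  where \<open>sh\<close> shifts by p. Summed over \<sigma>, each of the p! q! pairs contributes the
  whole determinant, and the normalisation of \<open>wedge\<close> divides this factor out.\<close>

lemma wedge_dform:
  assumes "length as = p" "length bs = q"
  shows "wedge p q (dform as) (dform bs) = dform (as @ bs)"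
proof
  fix vs
  show "wedge p q (dform as) (dform bs) vs = dform (as @ bs) vs"
  proof (cases "length vs = p + q")
    case len: True
    define S where "S = (\<lambda>n. {\<sigma>. \<sigma> permutes {..<n::nat}})"
    define sh where "sh = map_permutation {..<q} (\<lambda>j. p + j)"
    define F where "F = (\<lambda>\<sigma>. of_int (sign \<sigma>) * (\<Prod>i<p+q. (as @ bs) ! i \<bullet> vs ! \<sigma> i))"
    have shp: "sh \<tau> permutes {p..<p+q}" if "\<tau> \<in> S q" for \<tau>
      unfolding sh_def
    proof (rule map_permutation_permutes)
      show "bij_betw ((+) p) {..<q} {p..<p+q}"
        by (rule bij_betwI[where g = "\<lambda>x. x - p"]) auto
    qed (use that in \<open>simp add: S_def\<close>)
    have sh_app: "sh \<tau> (p + j) = p + \<tau> j" if "j < q" for \<tau> j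
      unfolding sh_def by (rule map_permutation_apply) (use that in auto)
    have sgn_sh: "sign (sh \<tau>) = sign \<tau>" if "\<tau> \<in> S q" for \<tau>
      unfolding sh_def by (rule sign_map_permutation) (use that in \<open>auto simp: S_def\<close>)
    have comp: "\<tau> \<circ> sh \<tau>' \<in> S (p + q)" if "\<tau> \<in> S p" "\<tau>' \<in> S q" for \<tau> \<tau>'
      unfolding S_def using that shp[OF that(2)]
      by (auto simp: S_def intro!: permutes_compose elim: permutes_subset)
    have term_eq: "of_int (sign \<sigma>) * dform as (take p (permute_list \<sigma> vs)) * dform bs (drop p (permute_list \<sigma> vs)) =
        (\<Sum>\<tau>\<in>S p. \<Sum>\<tau>'\<in>S q. F (\<sigma> \<circ> (\<tau> \<circ> sh \<tau>')))" if \<sigma>: "\<sigma> \<in> S (p + q)" for \<sigma>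
    proof -
      have nth: "permute_list \<sigma> vs ! i = vs ! \<sigma> i" if "i < p + q" for i
        using that \<sigma> len by (simp add: permute_list_nth S_def)
      have a: "dform as (take p (permute_list \<sigma> vs)) =
          (\<Sum>\<tau>\<in>S p. of_int (sign \<tau>) * (\<Prod>i<p. as ! i \<bullet> vs ! \<sigma> (\<tau> i)))"
      proof (subst dform_sum[of _ p])
        show "(\<Sum>\<tau> | \<tau> permutes {..<p}. of_int (sign \<tau>) * (\<Prod>i<p. as ! i \<bullet> take p (permute_list \<sigma> vs) ! \<tau> i)) =
          (\<Sum>\<tau>\<in>S p. of_int (sign \<tau>) * (\<Prod>i<p. as ! i \<bullet> vs ! \<sigma> (\<tau> i)))"
          unfolding S_def
        proof (intro sum.cong refl arg_cong2[of _ _ _ _ "(*)"] prod.cong)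
          fix \<tau> i assume "\<tau> \<in> {\<sigma>. \<sigma> permutes {..<p}}" "i \<in> {..<p}"
          then have "\<tau> i < p" using permutes_in_image[of \<tau> "{..<p}" i] by auto
          then show "as ! i \<bullet> take p (permute_list \<sigma> vs) ! \<tau> i = as ! i \<bullet> vs ! \<sigma> (\<tau> i)"
            by (simp add: nth)
        qed
      qed (use len assms in auto)
      have b: "dform bs (drop p (permute_list \<sigma> vs)) =
          (\<Sum>\<tau>\<in>S q. of_int (sign \<tau>) * (\<Prod>i<q. bs ! i \<bullet> vs ! \<sigma> (p + \<tau> i)))"
      proof (subst dform_sum[of _ q])
        show "(\<Sum>\<tau> | \<tau> permutes {..<q}. of_int (sign \<tau>) * (\<Prod>i<q. bs ! i \<bullet> drop p (permute_list \<sigma> vs) ! \<tau> i)) =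
          (\<Sum>\<tau>\<in>S q. of_int (sign \<tau>) * (\<Prod>i<q. bs ! i \<bullet> vs ! \<sigma> (p + \<tau> i)))"
          unfolding S_def
        proof (intro sum.cong refl arg_cong2[of _ _ _ _ "(*)"] prod.cong)
          fix \<tau> i assume "\<tau> \<in> {\<sigma>. \<sigma> permutes {..<q}}" "i \<in> {..<q}"
          then have "\<tau> i < q" using permutes_in_image[of \<tau> "{..<q}" i] by auto
          then show "bs ! i \<bullet> drop p (permute_list \<sigma> vs) ! \<tau> i = bs ! i \<bullet> vs ! \<sigma> (p + \<tau> i)"
            using len by (simp add: nth)
        qed
      qed (use len assms in auto)
      have c: "F (\<sigma> \<circ> (\<tau> \<circ> sh \<tau>')) = of_int (sign \<sigma>) *
          (of_int (sign \<tau>) * (\<Prod>i<p. as ! i \<bullet> vs ! \<sigma> (\<tau> i))) *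
          (of_int (sign \<tau>') * (\<Prod>i<q. bs ! i \<bullet> vs ! \<sigma> (p + \<tau>' i)))"
        if t: "\<tau> \<in> S p" "\<tau>' \<in> S q" for \<tau> \<tau>'
      proof -
        have perm: "permutation \<sigma>" "permutation \<tau>" "permutation (sh \<tau>')"
          using \<sigma> t shp[OF t(2)] by (auto simp: S_def intro: permutation_permutes[THEN iffD2])
        have s: "sign (\<sigma> \<circ> (\<tau> \<circ> sh \<tau>')) = sign \<sigma> * (sign \<tau> * sign \<tau>')"
          using perm by (simp add: sign_compose permutation_compose sgn_sh t)
        have "(\<Prod>i<p+q. (as @ bs) ! i \<bullet> vs ! (\<sigma> \<circ> (\<tau> \<circ> sh \<tau>')) i) =
          (\<Prod>i<p. (as @ bs) ! i \<bullet> vs ! (\<sigma> \<circ> (\<tau> \<circ> sh \<tau>')) i) *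
          (\<Prod>i<q. (as @ bs) ! (p + i) \<bullet> vs ! (\<sigma> \<circ> (\<tau> \<circ> sh \<tau>')) (p + i))"
        proof -
          have "{..<p+q} = {..<p} \<union> (+) p ` {..<q}"
            by (simp add: lessThan_atLeast0 add.commute ivl_disj_un)
          moreover have "{..<p} \<inter> (+) p ` {..<q} = {}" by auto
          ultimately show ?thesis
            by (simp only: prod.union_disjoint finite_lessThan finite_imageI)
              (simp add: prod.reindex)
        qed
        also have "(\<Prod>i<p. (as @ bs) ! i \<bullet> vs ! (\<sigma> \<circ> (\<tau> \<circ> sh \<tau>')) i) = (\<Prod>i<p. as ! i \<bullet> vs ! \<sigma> (\<tau> i))"
          using assms by (intro prod.cong) (auto simp: nth_append permutes_not_in[OF shp[OF t(2)]])
        also have "(\<Prod>i<q. (as @ bs) ! (p + i) \<bullet> vs ! (\<sigma> \<circ> (\<tau> \<circ> sh \<tau>')) (p + i)) = (\<Prod>i<q. bs ! i \<bullet> vs ! \<sigma> (p + \<tau>' i))"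
          using assms t(1) by (intro prod.cong) (auto simp: nth_append sh_app S_def permutes_not_in[of \<tau> "{..<p}"])
        finally show ?thesis unfolding F_def s by simp
      qed
      have "(\<Sum>\<tau>\<in>S p. \<Sum>\<tau>'\<in>S q. F (\<sigma> \<circ> (\<tau> \<circ> sh \<tau>'))) =
        (\<Sum>\<tau>\<in>S p. \<Sum>\<tau>'\<in>S q. of_int (sign \<sigma>) *
          (of_int (sign \<tau>) * (\<Prod>i<p. as ! i \<bullet> vs ! \<sigma> (\<tau> i))) *
          (of_int (sign \<tau>') * (\<Prod>i<q. bs ! i \<bullet> vs ! \<sigma> (p + \<tau>' i))))"
        by (intro sum.cong refl c)
      also have "\<dots> = of_int (sign \<sigma>) * dform as (take p (permute_list \<sigma> vs)) * dform bs (drop p (permute_list \<sigma> vs))"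
        unfolding a b by (simp add: sum_distrib_left sum_distrib_right mult.assoc) (rule sum.swap)
      finally show ?thesis by simp
    qed
    have re: "(\<Sum>\<sigma>\<in>S (p + q). F (\<sigma> \<circ> \<kappa>)) = (\<Sum>\<sigma>\<in>S (p + q). F \<sigma>)" if "\<kappa> \<in> S (p + q)" for \<kappa>
      using sum_permutations_compose_right[of \<kappa> "{..<p+q}" F] that by (simp add: S_def)
    have "(\<Sum>\<sigma>\<in>S (p + q). of_int (sign \<sigma>) * dform as (take p (permute_list \<sigma> vs)) * dform bs (drop p (permute_list \<sigma> vs)))
       = (\<Sum>\<sigma>\<in>S (p + q). \<Sum>\<tau>\<in>S p. \<Sum>\<tau>'\<in>S q. F (\<sigma> \<circ> (\<tau> \<circ> sh \<tau>')))"
      by (intro sum.cong refl term_eq)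
    also have "\<dots> = (\<Sum>\<tau>\<in>S p. \<Sum>\<sigma>\<in>S (p + q). \<Sum>\<tau>'\<in>S q. F (\<sigma> \<circ> (\<tau> \<circ> sh \<tau>')))"
      by (rule sum.swap)
    also have "\<dots> = (\<Sum>\<tau>\<in>S p. \<Sum>\<tau>'\<in>S q. \<Sum>\<sigma>\<in>S (p + q). F (\<sigma> \<circ> (\<tau> \<circ> sh \<tau>')))"
      by (intro sum.cong refl sum.swap)
    also have "\<dots> = (\<Sum>\<tau>\<in>S p. \<Sum>\<tau>'\<in>S q. \<Sum>\<sigma>\<in>S (p + q). F \<sigma>)"
      by (intro sum.cong refl re comp)
    also have "\<dots> = fact p * fact q * (\<Sum>\<sigma>\<in>S (p + q). F \<sigma>)"
      by (simp add: S_def card_permutations[OF refl] mult.assoc)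
    finally show ?thesis
      using len assms unfolding wedge_def dform_sum[of vs "p + q" "as @ bs", simplified] S_def F_def
      by (simp add: dform_sum[of vs "p + q"])
  qed (use assms in \<open>auto simp: wedge_def dform_def\<close>)
qed

lemma wedge_sum_list_left:
  "wedge p q (\<lambda>vs. \<Sum>x\<leftarrow>xs. c x * f x vs) \<beta> vs = (\<Sum>x\<leftarrow>xs. c x * wedge p q (f x) \<beta> vs)"
  by (induction xs) (auto simp: wedge_def algebra_simps sum.distrib sum_distrib_left add_divide_distrib sum_divide_distrib)

lemma wedge_sum_list_right:
  "wedge p q \<alpha> (\<lambda>vs. \<Sum>x\<leftarrow>xs. c x * f x vs) vs = (\<Sum>x\<leftarrow>xs. c x * wedge p q \<alpha> (f x) vs)"
  by (induction xs) (auto simp: wedge_def algebra_simps sum.distrib sum_distrib_left add_divide_distrib sum_divide_distrib)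

text \<open>A list of pairs of a coefficient and a list of indices encodes a form with respect to a frame.\<close>

definition frame_form :: "(nat \<Rightarrow> vec7) \<Rightarrow> (int \<times> nat list) list \<Rightarrow> tensor" where
  "frame_form e l vs = (\<Sum>x\<leftarrow>l. of_int (fst x) * dform (map e (snd x)) vs)"

definition wedge_list :: "(int \<times> nat list) list \<Rightarrow> (int \<times> nat list) list \<Rightarrow> (int \<times> nat list) list" where
  "wedge_list l m = concat (map (\<lambda>x. map (\<lambda>y. (fst x * fst y, snd x @ snd y)) m) l)"

definition homogeneous :: "nat \<Rightarrow> (int \<times> nat list) list \<Rightarrow> bool" where
  "homogeneous p l \<longleftrightarrow> (\<forall>x\<in>set l. length (snd x) = p)"

lemma wedge_frame_form:
  assumes "homogeneous p l" "homogeneous q m"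
  shows "wedge p q (frame_form e l) (frame_form e m) = frame_form e (wedge_list l m)"
proof
  fix vs
  have "wedge p q (frame_form e l) (frame_form e m) vs =
     (\<Sum>x\<leftarrow>l. \<Sum>y\<leftarrow>m. of_int (fst x) * (of_int (fst y) * wedge p q (dform (map e (snd x))) (dform (map e (snd y))) vs))"
    unfolding frame_form_def[abs_def] wedge_sum_list_left wedge_sum_list_right
    by (simp add: sum_list_const_mult)
  also have "\<dots> = (\<Sum>x\<leftarrow>l. \<Sum>y\<leftarrow>m. of_int (fst x * fst y) * dform (map e (snd x @ snd y)) vs)"
    using assms by (intro arg_cong[of _ _ sum_list] map_cong refl) (simp add: homogeneous_def wedge_dform)
  also have "\<dots> = frame_form e (wedge_list l m) vs"
    by (induction l) (auto simp: frame_form_def wedge_list_def comp_def)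
  finally show "wedge p q (frame_form e l) (frame_form e m) vs = frame_form e (wedge_list l m) vs" .
qed

text \<open>Parity of the number of inversions, and 0 for a repeated index. The recursion follows
  insertion sort and evaluates on concrete lists by simplification.\<close>

fun sort_sign :: "nat list \<Rightarrow> int" where
  "sort_sign [] = 1"
| "sort_sign (i # is) = (if i \<in> set is then 0
     else if even (length (filter (\<lambda>j. j < i) is)) then sort_sign is else - sort_sign is)"

lemma dform_Cons_cong:
  assumes "\<And>vs. dform as vs = k * dform bs vs" "length as = length bs"
  shows "dform (a # as) vs = k * dform (a # bs) vs"
proof (cases "length vs = Suc (length bs)")
  case True
  then show ?thesis
    by (simp add: dform_Cons assms sum_distrib_left algebra_simps del: sum.lessThan_Suc)
qed (simp add: dform_def assms)

text \<open>Insertion moves \<open>i\<close> past each smaller entry, with one sign change per swap;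
  meeting an equal entry produces two equal rows.\<close>

lemma dform_insort:
  "sorted js \<Longrightarrow> dform (map e (i # js)) vs =
    (if i \<in> set js then 0 else (- 1) ^ length (filter (\<lambda>j. j < i) js)) * dform (map e (insort i js)) vs"
proof (induction js arbitrary: vs)
  case Nil
  then show ?case by simp
next
  case (Cons j js)
  consider "i < j" | "i = j" | "j < i" by (rule linorder_cases)
  then show ?case
  proof cases
    case 1
    then have "filter (\<lambda>k. k < i) (j # js) = []" "i \<notin> set (j # js)"
      using Cons.prems by (auto simp: filter_empty_conv)
    then show ?thesis using 1 by (simp add: less_imp_le)
  next
    case 2
    then show ?thesis by (simp add: dform_repeat)
  next
    case 3
    let ?k = "(if i \<in> set js then 0 else (- 1) ^ length (filter (\<lambda>j. j < i) js)) :: real"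
    have "dform (e j # map e (i # js)) vs = ?k * dform (e j # map e (insort i js)) vs"
      by (rule dform_Cons_cong) (use Cons in auto)
    then show ?thesis using 3 dform_swap[of "e i" "e j" "map e js" vs] by auto
  qed
qed

lemma dform_sort: "dform (map e is) vs = of_int (sort_sign is) * dform (map e (sort is)) vs"
proof (induction "is" arbitrary: vs)
  case Nil
  then show ?case by simp
next
  case (Cons i js)
  have "length (filter (\<lambda>j. j < i) (sort js)) = length (filter (\<lambda>j. j < i) js)"
    by (metis mset_filter mset_sort size_mset)
  moreover have "dform (map e (i # js)) vs = of_int (sort_sign js) * dform (map e (i # sort js)) vs"
    using dform_Cons_cong[of "map e js" "of_int (sort_sign js)" "map e (sort js)" "e i" vs] Cons by simp
  ultimately show ?case
    using dform_insort[of "sort js" e i vs] by (auto simp: uminus_power_if)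
qed

section \<open>The standard form in an orthonormal frame\<close>

definition euclid :: tensor where
  "euclid vs = (if length vs = 2 then vs ! 0 \<bullet> vs ! 1 else 0)"

lemma euclid_pair [simp]: "euclid [X, Y] = X \<bullet> Y"
  by (simp add: euclid_def)

lemma inner_product_euclid: "inner_product euclid"
proof -
  have "linear (\<lambda>X. euclid (vs[i := X]))" if vs: "length vs = 2" and i: "i < 2" for vs i
  proof -
    obtain a b where "vs = [a, b]"
      using vs by (auto simp: numeral_2_eq_2 length_Suc_conv)
    moreover have "i = 0 \<or> i = 1" using i by auto
    ultimately show ?thesis
      by (auto intro!: linearI simp: inner_add_left inner_add_right)
  qed
  then show ?thesis
    by (auto simp: inner_product_def multilinear_def inner_commute euclid_def)
qed

lemma orthonormal_frame_euclid:
  "orthonormal_frame euclid E \<longleftrightarrow>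
    length E = 7 \<and> (\<forall>i<7. \<forall>j<7. E ! i \<bullet> E ! j = (if i = j then 1 else 0))"
  by (simp add: orthonormal_frame_def)

lemma orthonormal_frame_expand:
  assumes "orthonormal_frame euclid E"
  shows "(\<Sum>i<7. (E ! i \<bullet> x) *\<^sub>R E ! i) = x"
proof -
  have len: "length E = 7" and on: "\<And>i j. i < 7 \<Longrightarrow> j < 7 \<Longrightarrow> E ! i \<bullet> E ! j = (if i = j then 1 else 0)"
    using assms by (auto simp: orthonormal_frame_euclid)
  define B where "B = (!) E ` {..<7}"
  have inj: "inj_on ((!) E) {..<7}"
  proof (rule inj_onI)
    fix i j assume "i \<in> {..<7::nat}" "j \<in> {..<7::nat}" "E ! i = E ! j"
    then show "i = j" using on[of i j] on[of i i] by (auto split: if_splits)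
  qed
  have cardB: "card B = 7" unfolding B_def by (simp add: card_image inj)
  have "pairwise orthogonal B"
    unfolding B_def pairwise_def real_inner_class.orthogonal_def using on by auto
  moreover have "0 \<notin> B" unfolding B_def using on by force
  ultimately have "independent B" by (rule pairwise_orthogonal_independent)
  then have "span B = UNIV"
    using card_ge_dim_independent[of B UNIV] cardB by auto
  have "x = (\<Sum>b\<in>B. (b \<bullet> x) *\<^sub>R b)"
  proof (rule vector_eq_dot_span[of x B, symmetric, THEN sym])
    show "x \<in> span B" "(\<Sum>b\<in>B. (b \<bullet> x) *\<^sub>R b) \<in> span B" using \<open>span B = UNIV\<close> by auto
    fix y assume "y \<in> B"
    then obtain j where j: "j < 7" "y = E ! j" by (auto simp: B_def)
    have "y \<bullet> (\<Sum>b\<in>B. (b \<bullet> x) *\<^sub>R b) = (\<Sum>i<7. (E ! i \<bullet> x) * (E ! j \<bullet> E ! i))"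
      unfolding B_def by (simp add: sum.reindex[OF inj] inner_sum_right j)
    also have "\<dots> = (\<Sum>i<7. if i = j then E ! j \<bullet> x else 0)"
      using j on by (intro sum.cong) auto
    finally show "y \<bullet> x = y \<bullet> (\<Sum>b\<in>B. (b \<bullet> x) *\<^sub>R b)" using j by simp
  qed
  then show ?thesis unfolding B_def by (simp add: sum.reindex[OF inj])
qed

lemma orthonormal_frame_inner:
  assumes "orthonormal_frame euclid E"
  shows "x \<bullet> y = (\<Sum>i<7. (x \<bullet> E ! i) * (E ! i \<bullet> y))"
proof -
  have "x \<bullet> y = x \<bullet> (\<Sum>i<7. (E ! i \<bullet> y) *\<^sub>R E ! i)"
    using orthonormal_frame_expand[OF assms, of y] by simp
  then show ?thesis by (simp only: inner_sum_right inner_scaleR_right mult.commute)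
qed

lemma dform_orthonormal:
  assumes "\<And>i j. i < length E \<Longrightarrow> j < length E \<Longrightarrow> E ! i \<bullet> E ! j = (if i = j then 1 else 0)"
  shows "dform E E = 1"
proof -
  have "Matrix.mat (length E) (length E) (\<lambda>(i, j). E ! i \<bullet> E ! j) = 1\<^sub>m (length E)"
    using assms by (intro eq_matI) auto
  then show ?thesis by (simp add: dform_def)
qed

text \<open>Expanding every inner product in the frame \<open>E\<close> factors the matrix, and the
  determinant is multiplicative.\<close>

lemma dform_frame_change:
  assumes "orthonormal_frame euclid E" "length as = 7" "length vs = 7"
  shows "dform as vs = dform as E * dform E vs"
proof -
  have len: "length E = 7" using assms by (simp add: orthonormal_frame_def)
  have "Matrix.mat 7 7 (\<lambda>(i, j). as ! i \<bullet> vs ! j) =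
      Matrix.mat 7 7 (\<lambda>(i, j). as ! i \<bullet> E ! j) * Matrix.mat 7 7 (\<lambda>(i, j). E ! i \<bullet> vs ! j)"
    by (intro eq_matI)
      (simp_all add: scalar_prod_def orthonormal_frame_inner[OF assms(1), of "as ! _" "vs ! _"] atLeast0LessThan)
  then show ?thesis
    using assms len by (simp add: dform_def det_mult[of _ 7])
qed

lemma multilinear_frame_ext:
  assumes E: "orthonormal_frame euclid E"
    and \<alpha>: "multilinear p \<alpha>" and \<beta>: "multilinear p \<beta>"
    and eq: "\<And>vs. length vs = p \<Longrightarrow> set vs \<subseteq> set E \<Longrightarrow> \<alpha> vs = \<beta> vs"
  shows "\<alpha> = \<beta>"
proof
  fix vs
  \<comment> \<open>Here the first \<open>k\<close> arguments are arbitrary and the others are frame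
    vectors. The step to \<open>Suc k\<close> expands argument \<open>k\<close> in the frame and
    uses linearity in that slot.\<close>
  have "\<alpha> vs = \<beta> vs" if "length vs = p" "set (drop k vs) \<subseteq> set E" "k \<le> p" for k
    using that
  proof (induction k arbitrary: vs)
    case 0
    then show ?case using eq by simp
  next
    case (Suc k)
    have lin: "linear (\<lambda>X. \<alpha> (vs[k := X]))" "linear (\<lambda>X. \<beta> (vs[k := X]))"
      using \<alpha> \<beta> Suc.prems by (auto simp: multilinear_def)
    have x: "vs ! k = (\<Sum>i<7. (E ! i \<bullet> vs ! k) *\<^sub>R E ! i)"
      using orthonormal_frame_expand[OF E] by simp
    have step: "\<alpha> (vs[k := E ! i]) = \<beta> (vs[k := E ! i])" if "i < 7" for i
    proof (rule Suc.IH)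
      have "drop k (vs[k := E ! i]) = E ! i # drop (Suc k) vs"
        using Suc.prems by (simp add: Cons_nth_drop_Suc[symmetric])
      then show "set (drop k (vs[k := E ! i])) \<subseteq> set E"
        using Suc.prems that E by (simp add: orthonormal_frame_def)
    qed (use Suc.prems in auto)
    have "\<alpha> vs = \<alpha> (vs[k := \<Sum>i<7. (E ! i \<bullet> vs ! k) *\<^sub>R E ! i])"
      unfolding x[symmetric] by simp
    also have "\<dots> = (\<Sum>i<7. (E ! i \<bullet> vs ! k) * \<alpha> (vs[k := E ! i]))"
      by (simp only: linear_sum[OF lin(1)] linear_scale[OF lin(1)] real_scaleR_def)
    also have "\<dots> = (\<Sum>i<7. (E ! i \<bullet> vs ! k) * \<beta> (vs[k := E ! i]))"
      by (intro sum.cong refl) (simp add: step)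
    also have "\<dots> = \<beta> (vs[k := \<Sum>i<7. (E ! i \<bullet> vs ! k) *\<^sub>R E ! i])"
      by (simp only: linear_sum[OF lin(2)] linear_scale[OF lin(2)] real_scaleR_def)
    also have "\<dots> = \<beta> vs" unfolding x[symmetric] by simp
    finally show ?case .
  qed
  from this[of p] show "\<alpha> vs = \<beta> vs"
    using \<alpha> \<beta> by (cases "length vs = p") (auto simp: multilinear_def)
qed

lemma multilinear_frame_form: "homogeneous p l \<Longrightarrow> multilinear p (frame_form e l)"
proof (induction l)
  case Nil
  then show ?case by (auto simp: frame_form_def[abs_def] multilinear_def linear_zero)
next
  case (Cons x l)
  then have "multilinear p (dform (map e (snd x)))" "multilinear p (frame_form e l)"
    by (auto simp: homogeneous_def intro: multilinear_dform)
  moreover have "linear (\<lambda>X. c * f X)" if "linear f" for c and f :: "vec7 \<Rightarrow> real"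
    using linear_compose_scale_right[OF that, of c] by simp
  ultimately show ?case
    by (auto simp: frame_form_def[abs_def] multilinear_def intro!: linear_compose_add)
qed

lemma alternating_frame_form:
  assumes "homogeneous p l"
  shows "alternating p (frame_form e l)"
proof -
  have "frame_form e l vs = 0" if "length vs = p" "i < j" "j < p" "vs ! i = vs ! j" for vs i j
  proof -
    have "dform (map e (snd x)) vs = 0" if "x \<in> set l" for x
    proof -
      have "alternating p (dform (map e (snd x)))"
        using assms that by (intro alternating_dform) (auto simp: homogeneous_def)
      then show ?thesis
        using \<open>length vs = p\<close> \<open>i < j\<close> \<open>j < p\<close> \<open>vs ! i = vs ! j\<close>
        unfolding alternating_def by blast
    qed
    then show ?thesis by (simp add: frame_form_def sum_list_0 cong: map_cong)
  qed
  then show ?thesis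
    using multilinear_frame_form[OF assms] unfolding alternating_def by blast
qed

text \<open>Indices run from 1 to 7, so that index lists read like the usual notation for e^{123};
  the value of \<open>e\<close> at 0 is arbitrary.\<close>

definition frame :: "(nat \<Rightarrow> vec7) \<Rightarrow> bool" where
  "frame e \<longleftrightarrow> orthonormal_frame euclid (map e [1..<8])"

lemma frameI:
  assumes "\<And>i j. i \<in> {1..7} \<Longrightarrow> j \<in> {1..7} \<Longrightarrow> e i \<bullet> e j = (if i = j then 1 else 0)"
  shows "frame e"
  using assms by (auto simp: frame_def orthonormal_frame_euclid nth_append nth_upt simp del: upt_Suc)

lemma frame_inner:
  assumes "frame e" "i \<in> {1..7}" "j \<in> {1..7}"
  shows "e i \<bullet> e j = (if i = j then 1 else 0)"
proof -
  have "i - 1 < 7" "j - 1 < 7" using assms by auto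
  then have "map e [1..<8] ! (i - 1) \<bullet> map e [1..<8] ! (j - 1) = (if i - 1 = j - 1 then 1 else 0)"
    using assms(1) unfolding frame_def orthonormal_frame_euclid by blast
  then show ?thesis using assms(2,3) by (auto simp: nth_upt simp del: upt_Suc split: if_splits)
qed

lemma frame_sum: "(\<Sum>i<7. f (map e [1..<8] ! i)) = (\<Sum>i\<leftarrow>[1..<8]. f (e i))"
  by (simp add: eval_nat_numeral upt_rec add.assoc)

section \<open>The standard 3-form: its metric, volume form and Hodge dual\<close>

definition phi_list :: "(int \<times> nat list) list" where
  "phi_list = [(1, [1,2,3]), (1, [1,4,5]), (1, [1,6,7]), (1, [2,4,6]), (-1, [2,5,7]), (-1, [3,4,7]), (-1, [3,5,6])]"

text \<open>Entry by entry the complements of the index lists in \<open>phi_list\<close>. Each list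
  followed by its complement is an even permutation of 1, ..., 7, so the coefficients carry over
  unchanged.\<close>

definition psi_list :: "(int \<times> nat list) list" where
  "psi_list = [(1, [4,5,6,7]), (1, [2,3,6,7]), (1, [2,3,4,5]), (1, [1,3,5,7]), (-1, [1,3,4,6]), (-1, [1,2,5,6]), (-1, [1,2,4,7])]"

abbreviation "phi e \<equiv> frame_form e phi_list"
abbreviation "psi e \<equiv> frame_form e psi_list"
abbreviation "vol e \<equiv> dform (map e [1..<8])"

text \<open>Interior product of a monomial with the \<open>i\<close>-th vector of a frame: removing
  an index costs one sign for each index in front of it.\<close>

fun contract :: "nat \<Rightarrow> int \<times> nat list \<Rightarrow> (int \<times> nat list) list" where
  "contract i (c, []) = []"
| "contract i (c, j # I) = (if i = j then [(c, I)] else map (\<lambda>x. (- fst x, j # snd x)) (contract i (c, I)))"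

definition phi_contr :: "nat \<Rightarrow> (int \<times> nat list) list" where
  "phi_contr i = concat (map (contract i) phi_list)"

text \<open>After transposition \<open>X\<close> is the first row, and this is the Laplace expansion
  along it. The same holds for four covectors below.\<close>

lemma dform3_Cons:
  "dform [a, b, c] (X # vs) = (a \<bullet> X) * dform [b, c] vs - (b \<bullet> X) * dform [a, c] vs + (c \<bullet> X) * dform [a, b] vs"
proof (cases "length vs = 2")
  case True
  then have "dform (X # vs) [a, b, c] = (a \<bullet> X) * dform vs [b, c] - (b \<bullet> X) * dform vs [a, c] + (c \<bullet> X) * dform vs [a, b]"
    by (simp add: dform_Cons eval_nat_numeral inner_commute)
  then show ?thesis by (simp add: dform_commute[of vs] dform_commute[of "X # vs"])
qed (simp add: dform_def)

lemma dform4_Cons: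
  "dform [a, b, c, d] (X # vs) = (a \<bullet> X) * dform [b, c, d] vs - (b \<bullet> X) * dform [a, c, d] vs
     + (c \<bullet> X) * dform [a, b, d] vs - (d \<bullet> X) * dform [a, b, c] vs"
proof (cases "length vs = 3")
  case True
  then have "dform (X # vs) [a, b, c, d] = (a \<bullet> X) * dform vs [b, c, d] - (b \<bullet> X) * dform vs [a, c, d]
     + (c \<bullet> X) * dform vs [a, b, d] - (d \<bullet> X) * dform vs [a, b, c]"
    by (simp add: dform_Cons eval_nat_numeral inner_commute)
  then show ?thesis by (simp add: dform_commute[of vs] dform_commute[of "X # vs"])
qed (simp add: dform_def)

lemma upt_1_8: "[1..<8] = [1, 2, 3, 4, 5, 6, 7 :: nat]"
  by (simp add: eval_nat_numeral upt_rec)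

lemma interior_phi:
  "interior_prod X (phi e) = (\<lambda>vs. \<Sum>i\<leftarrow>[1..<8]. (e i \<bullet> X) * frame_form e (phi_contr i) vs)"
  unfolding upt_1_8
  by (rule ext) (simp add: interior_prod_def frame_form_def phi_contr_def phi_list_def dform3_Cons algebra_simps)

lemma homogeneous_phi: "homogeneous 3 phi_list" and homogeneous_psi: "homogeneous 4 psi_list"
  by (auto simp: homogeneous_def phi_list_def psi_list_def)

lemma homogeneous_wedge_list: "homogeneous p l \<Longrightarrow> homogeneous q m \<Longrightarrow> homogeneous (p + q) (wedge_list l m)"
  by (auto simp: homogeneous_def wedge_list_def)

lemma homogeneous_phi_contr: "homogeneous 2 (phi_contr i)"
  by (auto simp: homogeneous_def phi_contr_def phi_list_def)

definition top_coeff :: "(int \<times> nat list) list \<Rightarrow> int" where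
  "top_coeff l = (\<Sum>x\<leftarrow>l. fst x * sort_sign (snd x))"

text \<open>A monomial either repeats an index and vanishes or is a signed copy of the volume form,
  so a form of top degree is reduced to the integer \<open>top_coeff\<close>.\<close>

lemma frame_form_top:
  assumes "\<And>x. x \<in> set l \<Longrightarrow> sort_sign (snd x) = 0 \<or> sort (snd x) = [1..<8]"
  shows "frame_form e l vs = of_int (top_coeff l) * vol e vs"
  using assms
proof (induction l)
  case (Cons x l)
  have "dform (map e (snd x)) vs = of_int (sort_sign (snd x)) * vol e vs"
    using Cons.prems[of x] dform_sort[of e "snd x" vs] by auto
  then show ?case using Cons by (simp add: frame_form_def top_coeff_def algebra_simps)
qed (simp add: frame_form_def top_coeff_def)

lemma sort_sign_distinct: "sort_sign js \<noteq> 0 \<Longrightarrow> distinct js"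
  by (induction js) (auto split: if_splits)

lemma sort_eq_frame_indices:
  assumes "sort_sign is \<noteq> 0" "length is = 7" "set is \<subseteq> {1..7}"
  shows "sort is = [1..<8]"
proof -
  have "distinct is" using assms by (simp add: sort_sign_distinct)
  moreover from this have "set is = {1..7}"
    using assms by (intro card_subset_eq) (auto simp: distinct_card)
  ultimately have "sort is = sorted_list_of_set {1..7}"
    by (metis sorted_list_of_set_sort_remdups distinct_remdups_id)
  also have "{1..7} = set [1..<8]" by auto
  finally show ?thesis by (simp only: sorted_list_of_set_sort_remdups) simp
qed

definition indices_ok :: "(int \<times> nat list) list \<Rightarrow> bool" where
  "indices_ok l \<longleftrightarrow> (\<forall>x\<in>set l. set (snd x) \<subseteq> {1..7})"

lemma indices_ok_wedge_list: "indices_ok l \<Longrightarrow> indices_ok m \<Longrightarrow> indices_ok (wedge_list l m)"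
  by (auto simp: indices_ok_def wedge_list_def)

lemma indices_ok_phi: "indices_ok phi_list" and indices_ok_phi_contr: "indices_ok (phi_contr i)"
  by (auto simp: indices_ok_def phi_contr_def phi_list_def)

text \<open>The 7-form (i_a phi) \<and> (i_b phi) \<and> phi equals 6 \<delta>_ab vol, where i_a
  contracts with e_a. This is a finite computation: \<open>list_all\<close> splits it into 49 closed
  goals. The 6 cancels the factor 1 / 6 in \<open>G2_induces\<close>.\<close>

lemma top_coeff_phi_contr:
  "list_all (\<lambda>i. list_all (\<lambda>j.
     top_coeff (wedge_list (wedge_list (phi_contr i) (phi_contr j)) phi_list) = (if i = j then 6 else 0))
     [1,2,3,4,5,6,7]) [1,2,3,4,5,6,7]"
  by (simp only: list.pred_inject, intro conjI TrueI; simp add: wedge_list_def phi_list_def phi_contr_def top_coeff_def)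

text \<open>Changing the frame inside \<open>dform E E = 1\<close> gives the square of
  \<open>vol e E\<close>.\<close>

lemma vol_frame: "frame e \<Longrightarrow> orthonormal_frame euclid E \<Longrightarrow> \<bar>vol e E\<bar> = 1"
proof -
  assume e: "frame e" and E: "orthonormal_frame euclid E"
  have l: "length E = 7" using E by (simp add: orthonormal_frame_def)
  have "dform E E = dform E (map e [1..<8]) * vol e E"
    using e E l by (intro dform_frame_change) (auto simp: frame_def)
  moreover have "dform E E = 1"
    using E by (intro dform_orthonormal) (auto simp: orthonormal_frame_euclid)
  ultimately have "(vol e E)\<^sup>2 = 1" by (metis dform_commute power2_eq_square)
  then show ?thesis by (simp only: abs_square_eq_1)
qed

lemma G2_induces_phi:
  assumes e: "frame e"
  shows "G2_induces (phi e) euclid (vol e)"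
proof -
  have "wedge 4 3 (wedge 2 2 (interior_prod X (phi e)) (interior_prod Y (phi e))) (phi e) vs = 6 * (X \<bullet> Y) * vol e vs"
    for X Y vs
  proof -
    let ?l = "\<lambda>i j. wedge_list (wedge_list (phi_contr i) (phi_contr j)) phi_list"
    have w: "wedge 2 2 (frame_form e (phi_contr i)) (frame_form e (phi_contr j)) =
       frame_form e (wedge_list (phi_contr i) (phi_contr j))" for i j
      by (rule wedge_frame_form) (rule homogeneous_phi_contr)+
    have w': "wedge 4 3 (frame_form e (wedge_list (phi_contr i) (phi_contr j))) (phi e) = frame_form e (?l i j)" for i j
      using homogeneous_wedge_list[OF homogeneous_phi_contr homogeneous_phi_contr, of i j]
      by (intro wedge_frame_form homogeneous_phi) simp
    have "wedge 2 2 (interior_prod X (phi e)) (interior_prod Y (phi e)) =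
      (\<lambda>vs. \<Sum>i\<leftarrow>[1..<8]. (e i \<bullet> X) * (\<Sum>j\<leftarrow>[1..<8]. (e j \<bullet> Y) * frame_form e (wedge_list (phi_contr i) (phi_contr j)) vs))"
      unfolding interior_phi by (rule ext) (simp only: wedge_sum_list_left wedge_sum_list_right w)
    then have "wedge 4 3 (wedge 2 2 (interior_prod X (phi e)) (interior_prod Y (phi e))) (phi e) vs =
      (\<Sum>i\<leftarrow>[1..<8]. (e i \<bullet> X) * (\<Sum>j\<leftarrow>[1..<8]. (e j \<bullet> Y) * frame_form e (?l i j) vs))"
      by (simp only: wedge_sum_list_left w')
    also have "\<dots> = (\<Sum>i\<leftarrow>[1..<8]. (e i \<bullet> X) * (\<Sum>j\<leftarrow>[1..<8]. (e j \<bullet> Y) * ((if i = j then 6 else 0) * vol e vs)))"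
    proof -
      have "frame_form e (?l i j) vs = (if i = j then 6 else 0) * vol e vs"
        if "i \<in> set [1..<8]" "j \<in> set [1..<8]" for i j
      proof -
        have "homogeneous 7 (?l i j)"
          using homogeneous_wedge_list[OF homogeneous_wedge_list[OF homogeneous_phi_contr homogeneous_phi_contr]
              homogeneous_phi, of i j] by simp
        moreover have "indices_ok (?l i j)"
          by (intro indices_ok_wedge_list indices_ok_phi indices_ok_phi_contr)
        ultimately have "\<forall>x\<in>set (?l i j). sort_sign (snd x) = 0 \<or> sort (snd x) = [1..<8]"
          using sort_eq_frame_indices unfolding homogeneous_def indices_ok_def by blast
        moreover have "top_coeff (?l i j) = (if i = j then 6 else 0)"
          using top_coeff_phi_contr that unfolding upt_1_8 list_all_iff by blast
        ultimately show ?thesis using frame_form_top[of "?l i j" e vs] by auto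
      qed
      then show ?thesis by (intro arg_cong[of _ _ sum_list] map_cong refl arg_cong2[of _ _ _ _ "(*)"]) auto
    qed
    also have "\<dots> = 6 * (\<Sum>i\<leftarrow>[1..<8]. (X \<bullet> e i) * (e i \<bullet> Y)) * vol e vs"
      unfolding upt_1_8 by (simp add: inner_commute algebra_simps)
    also have "(\<Sum>i\<leftarrow>[1..<8]. (X \<bullet> e i) * (e i \<bullet> Y)) = X \<bullet> Y"
      using orthonormal_frame_inner[of "map e [1..<8]" X Y] e
        frame_sum[of "\<lambda>v. (X \<bullet> v) * (v \<bullet> Y)" e] by (simp add: frame_def)
    finally show ?thesis .
  qed
  moreover have "alternating 7 (vol e)" by (rule alternating_dform) simp
  ultimately show ?thesis
    using inner_product_euclid vol_frame[OF e] by (simp add: G2_induces_def volume_form_def)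
qed

lemma dform_scale_rows: "dform (map ((*\<^sub>R) r) as) vs = r ^ length as * dform as vs"
proof (induction as arbitrary: vs)
  case Nil
  then show ?case by (simp add: dform_def)
next
  case (Cons a as)
  show ?case
  proof (cases "length vs = Suc (length as)")
    case True
    then show ?thesis
      by (simp add: dform_Cons Cons.IH sum_distrib_left algebra_simps del: sum.lessThan_Suc)
  qed (simp add: dform_def)
qed

lemma vol_self: "frame e \<Longrightarrow> vol e (map e [1..<8]) = 1"
  unfolding frame_def orthonormal_frame_euclid by (intro dform_orthonormal) auto

lemma frame_nonzero: "frame e \<Longrightarrow> e 1 \<bullet> e 1 = 1" "frame e \<Longrightarrow> e 1 \<noteq> 0"
  using frame_inner[of e 1 1] by auto

lemma G2_induces_eq:
  assumes "G2_induces \<phi> g \<nu>" "G2_induces \<phi> g' \<nu>'" "length vs = 7"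
  shows "g [X, Y] * \<nu> vs = g' [X, Y] * \<nu>' vs"
  using assms unfolding G2_induces_def by metis

text \<open>For uniqueness, the defining identity fixes only the product of metric and volume, so
  another solution is g = euclid / n and \<nu> = n vol for a number n, positive because g is. The
  frame scaled by sqrt n is orthonormal for g, and \<nu> has the value n (sqrt n)^7 = (sqrt n)^9 on
  it. The normalisation of the volume makes this 1, hence n = 1.\<close>

lemma G2_metric_phi:
  assumes e: "frame e"
  shows "G2_metric (phi e) = euclid"
  unfolding G2_metric_def
proof (rule the_equality)
  show "\<exists>\<nu>. G2_induces (phi e) euclid \<nu>" using G2_induces_phi[OF e] by blast
next
  fix g assume "\<exists>\<nu>. G2_induces (phi e) g \<nu>"
  then obtain \<nu> where g: "G2_induces (phi e) g \<nu>" by blast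
  define E where "E = map e [1..<8]"
  define n where "n = \<nu> E"
  have E: "length E = 7" "vol e E = 1" using vol_self[OF e] by (auto simp: E_def)
  have eq: "g [X, Y] * \<nu> vs = (X \<bullet> Y) * vol e vs" if "length vs = 7" for X Y vs
    using G2_induces_eq[OF g G2_induces_phi[OF e] that, of X Y] by simp
  have gn: "g [X, Y] * n = X \<bullet> Y" for X Y using eq[of E X Y] E by (simp add: n_def)
  have "g [e 1, e 1] > 0" using g frame_nonzero[OF e] by (auto simp: G2_induces_def inner_product_def)
  moreover have "g [e 1, e 1] * n = 1" using gn[of "e 1" "e 1"] frame_nonzero[OF e] by simp
  ultimately have n: "n > 0" using zero_less_mult_pos[of "g [e 1, e 1]" n] by simp
  have \<nu>: "\<nu> vs = n * vol e vs" if "length vs = 7" for vs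
  proof -
    have "g [e 1, e 1] * \<nu> vs = vol e vs" using eq[OF that, of "e 1" "e 1"] frame_nonzero[OF e] by simp
    then have "n * vol e vs = n * (g [e 1, e 1] * \<nu> vs)" by (simp only:)
    also have "\<dots> = (g [e 1, e 1] * n) * \<nu> vs" by (simp only: mult_ac)
    finally have "n * vol e vs = (g [e 1, e 1] * n) * \<nu> vs" .
    then show ?thesis by (simp only: \<open>g [e 1, e 1] * n = 1\<close> mult_1)
  qed
  have "orthonormal_frame g (map ((*\<^sub>R) (sqrt n)) E)"
  proof -
    have "g [sqrt n *\<^sub>R X, sqrt n *\<^sub>R Y] = X \<bullet> Y" for X Y
    proof -
      have "g [sqrt n *\<^sub>R X, sqrt n *\<^sub>R Y] * n = (sqrt n * sqrt n) * (X \<bullet> Y)"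
        using gn[of "sqrt n *\<^sub>R X" "sqrt n *\<^sub>R Y"] by simp
      then show ?thesis using n by (simp add: mult.commute)
    qed
    then show ?thesis
      using e by (simp add: orthonormal_frame_def frame_def E_def)
  qed
  then have "\<bar>\<nu> (map ((*\<^sub>R) (sqrt n)) E)\<bar> = 1"
    using g by (simp add: G2_induces_def volume_form_def)
  moreover have "\<nu> (map ((*\<^sub>R) (sqrt n)) E) = n * sqrt n ^ 7"
    using \<nu>[of "map ((*\<^sub>R) (sqrt n)) E"] E dform_scale_rows[of "sqrt n" E "map e [1..<8]"]
    by (simp add: dform_commute[of "map e [_..<_]"] del: upt_Suc)
  moreover have "n * sqrt n ^ 7 = sqrt n ^ 9"
  proof -
    have "sqrt n ^ 9 = (sqrt n)\<^sup>2 * sqrt n ^ 7" by (simp flip: power_add)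
    then show ?thesis using n by simp
  qed
  ultimately have "sqrt n ^ 9 = 1 ^ 9" using n by simp
  then have "sqrt n = 1" using n by (subst (asm) power_eq_iff_eq_base) auto
  then have "n = 1" by simp
  show "g = euclid"
  proof
    fix vs
    show "g vs = euclid vs"
    proof (cases "length vs = 2")
      case True
      then obtain X Y where "vs = [X, Y]" by (auto simp: numeral_2_eq_2 length_Suc_conv)
      then show ?thesis using gn[of X Y] \<open>n = 1\<close> by simp
    next
      case False
      then show ?thesis using g by (simp add: G2_induces_def inner_product_def multilinear_def euclid_def)
    qed
  qed
qed

lemma G2_volume_phi:
  assumes e: "frame e"
  shows "G2_volume (phi e) = vol e"
  unfolding G2_volume_def G2_metric_phi[OF e]
proof (rule the_equality)
  show "G2_induces (phi e) euclid (vol e)" using G2_induces_phi[OF e] .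
next
  fix \<nu> assume g: "G2_induces (phi e) euclid \<nu>"
  show "\<nu> = vol e"
  proof
    fix vs
    show "\<nu> vs = vol e vs"
    proof (cases "length vs = 7")
      case True
      then have "euclid [e 1, e 1] * \<nu> vs = euclid [e 1, e 1] * vol e vs"
        using G2_induces_eq[OF g G2_induces_phi[OF e]] by blast
      then show ?thesis using frame_nonzero[OF e] by simp
    next
      case False
      then have "\<nu> vs = 0"
        using g by (simp add: G2_induces_def volume_form_def alternating_def multilinear_def)
      then show ?thesis using False by (simp add: dform_length)
    qed
  qed
qed

text \<open>The star operator exchanges complementary minors of an orthogonal matrix.\<close>

lemma dform_complementary:
  assumes e: "frame e" and E: "orthonormal_frame euclid E" "vol e E = 1"
    and IJ: "length I = 3" "length J = 4" "set (I @ J) \<subseteq> {1..7}" "sort_sign (I @ J) \<noteq> 0"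
  shows "dform (map e J) (drop 3 E) = of_int (sort_sign (I @ J)) * dform (map e I) (take 3 E)"
proof -
  \<comment> \<open>The auxiliary determinant with rows \<open>T @ map e J\<close> links both sides.
    Evaluated on \<open>E\<close> it is block triangular and leaves the minor of \<open>J\<close>.
    Paired with the rows \<open>map e (I @ J)\<close> it is again block triangular and leaves the
    minor of \<open>I\<close>, with the sign that sorts \<open>I @ J\<close>.\<close>
  define T where "T = take 3 E"
  have len: "length E = 7" "length T = 3" using E by (auto simp: orthonormal_frame_def T_def)
  have on: "E ! i \<bullet> E ! j = (if i = j then 1 else 0)" if "i < 7" "j < 7" for i j
    using E that by (simp add: orthonormal_frame_euclid)
  have dist: "distinct (I @ J)" using IJ(4) by (rule sort_sign_distinct)
  have "dform (T @ map e J) (T @ drop 3 E) = dform T T * dform (map e J) (drop 3 E)"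
  proof (rule dform_append_block)
    fix a w assume "a \<in> set T" "w \<in> set (drop 3 E)"
    then obtain i j where "a = E ! i" "i < 3" "w = E ! (3 + j)" "j < 4"
      using len by (auto simp: T_def in_set_conv_nth)
    then show "a \<bullet> w = 0" using on[of i "3 + j"] by simp
  qed simp
  moreover have "dform T T = 1"
    using on len by (intro dform_orthonormal) (auto simp: T_def)
  moreover have "dform (T @ map e J) E = dform (T @ map e J) (map e [1..<8]) * vol e E"
    using e len IJ by (intro dform_frame_change) (auto simp: frame_def)
  ultimately have 1: "dform (map e J) (drop 3 E) = dform (T @ map e J) (map e [1..<8])"
    using E(2) by (simp add: T_def)
  have "dform (map e (I @ J)) (T @ map e J) = of_int (sort_sign (I @ J)) * vol e (T @ map e J)"
    using dform_sort[of e "I @ J" "T @ map e J"] sort_eq_frame_indices[of "I @ J"] IJ by simp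
  moreover have "dform (map e (I @ J)) (T @ map e J) = dform (map e I) T * dform (map e J) (map e J)"
    unfolding map_append
  proof (rule dform_append_block)
    show "a \<bullet> w = 0" if aw: "a \<in> set (map e I)" "w \<in> set (map e J)" for a w
    proof -
      obtain i j where ij: "a = e i" "w = e j" "i \<in> set I" "j \<in> set J" using aw by auto
      then have "i \<noteq> j" "i \<in> {1..7}" "j \<in> {1..7}" using dist IJ by auto
      then show ?thesis using frame_inner[OF e] ij by simp
    qed
  qed (simp add: len IJ)
  moreover have "dform (map e J) (map e J) = 1"
  proof (rule dform_orthonormal)
    fix i j assume ij: "i < length (map e J)" "j < length (map e J)"
    then have "J ! i \<in> set J" "J ! j \<in> set J" by simp_all
    then have "J ! i \<in> {1..7}" "J ! j \<in> {1..7}" using IJ(3) by auto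
    then show "map e J ! i \<bullet> map e J ! j = (if i = j then 1 else 0)"
      using frame_inner[OF e] ij dist by (simp add: nth_eq_iff_index_eq)
  qed
  ultimately have 2: "dform (map e I) T = of_int (sort_sign (I @ J)) * vol e (T @ map e J)" by simp
  have "sort_sign js \<in> {0, 1, -1}" for js by (induction js) auto
  then have "sort_sign (I @ J) = 1 \<or> sort_sign (I @ J) = - 1" using IJ by blast
  then have "of_int (sort_sign (I @ J)) * dform (map e I) T = vol e (T @ map e J)"
    unfolding 2 by auto
  then show ?thesis unfolding 1 by (simp add: T_def dform_commute[of "take 3 E @ map e J"] del: upt_Suc)
qed

text \<open>\<open>psi e\<close> qualifies by the rule for complementary minors. For uniqueness, an
  alternating form is determined by its values on distinct frame vectors, and any four of these are
  the last four vectors of some oriented orthonormal frame.\<close>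

lemma G2_star_phi:
  assumes e: "frame e"
  shows "G2_star (phi e) = psi e"
proof -
  have star: "psi e (drop 3 E) = phi e (take 3 E)" if E: "orthonormal_frame euclid E" "vol e E = 1" for E
  proof -
    note c = dform_complementary[OF e E]
    show ?thesis
      unfolding frame_form_def phi_list_def psi_list_def
      using c[of "[1,2,3]" "[4,5,6,7]"] c[of "[1,4,5]" "[2,3,6,7]"] c[of "[1,6,7]" "[2,3,4,5]"]
        c[of "[2,4,6]" "[1,3,5,7]"] c[of "[2,5,7]" "[1,3,4,6]"] c[of "[3,4,7]" "[1,2,5,6]"]
        c[of "[3,5,6]" "[1,2,4,7]"]
      by simp
  qed
  have "hodge_star euclid (vol e) 3 (phi e) = psi e"
    unfolding hodge_star_def
  proof (rule the_equality)
    show "alternating (7 - 3) (psi e) \<and>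
      (\<forall>E. orthonormal_frame euclid E \<and> vol e E = 1 \<longrightarrow> psi e (drop 3 E) = phi e (take 3 E))"
      using star alternating_frame_form[OF homogeneous_psi] by simp
  next
    fix \<eta> assume \<eta>: "alternating (7 - 3) \<eta> \<and>
      (\<forall>E. orthonormal_frame euclid E \<and> vol e E = 1 \<longrightarrow> \<eta> (drop 3 E) = phi e (take 3 E))"
    have a: "alternating 4 \<eta>" "alternating 4 (psi e)"
      using \<eta> alternating_frame_form[OF homogeneous_psi] by auto
    show "\<eta> = psi e"
    proof (rule multilinear_frame_ext[of "map e [1..<8]" 4])
      show "orthonormal_frame euclid (map e [1..<8])" using e by (simp add: frame_def)
      show "multilinear 4 \<eta>" "multilinear 4 (psi e)" using a by (auto simp: alternating_def)
      fix vs assume vs: "length vs = 4" "set vs \<subseteq> set (map e [1..<8])"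
      show "\<eta> vs = psi e vs"
      proof (cases "distinct vs")
        case False
        then obtain i j where "i < j" "j < 4" "vs ! i = vs ! j"
          using vs(1) by (metis distinct_conv_nth linorder_neqE_nat)
        then have "\<eta> vs = 0" "psi e vs = 0" using a vs(1) unfolding alternating_def by blast+
        then show ?thesis by simp
      next
        case True
        obtain J where J: "vs = map e J" "set J \<subseteq> {1..7}"
        proof -
          have "\<exists>J. vs = map e J \<and> set J \<subseteq> {1..7}"
            using vs(2)
          proof (induction vs)
            case (Cons v vs)
            then obtain J i where "vs = map e J" "set J \<subseteq> {1..7}" "v = e i" "i \<in> {1..7}" by fastforce
            then show ?case by (intro exI[of _ "i # J"]) simp
          qed simp
          then show ?thesis using that by blast
        qed
        have J': "distinct J" "length J = 4" using True vs(1) J(1) by (auto simp: distinct_map)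
        obtain I where I: "set I = {1..7} - set J" "distinct I"
          using finite_distinct_list[of "{1..7} - set J"] by auto
        have "length I = 3"
          using I J J' distinct_card[of I] distinct_card[of J] by (simp add: card_Diff_subset)
        have nth: "(I @ J) ! i \<in> {1..7}" if "i < 7" for i
          using nth_mem[of i "I @ J"] that I J \<open>length I = 3\<close> J' by auto
        have dist: "distinct (I @ J)" using I J' by auto
        have F: "orthonormal_frame euclid (map e (I @ J))"
          unfolding orthonormal_frame_euclid
        proof (intro conjI allI impI)
          show "length (map e (I @ J)) = 7" using \<open>length I = 3\<close> J' by simp
          fix i j :: nat assume "i < 7" "j < 7"
          then show "map e (I @ J) ! i \<bullet> map e (I @ J) ! j = (if i = j then 1 else 0)"
            using frame_inner[OF e nth nth] \<open>length I = 3\<close> J' nth_eq_iff_index_eq[OF dist, of i j]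
            by (simp del: map_append)
        qed
        obtain x where x: "x = 1 \<or> x = -1" "vol e (map e (I @ J)) = x"
          using vol_frame[OF e F] by (auto simp: abs_if split: if_splits)
        obtain v T where T: "map e I = v # T" "length T = 2"
          using \<open>length I = 3\<close> by (cases I) auto
        \<comment> \<open>Multiplying the first vector by the orientation sign \<open>x\<close>
          makes the frame positive and leaves the last four vectors \<open>vs\<close> alone.\<close>
        define E where "E = (x *\<^sub>R v) # T @ vs"
        have mE: "map e (I @ J) = v # T @ vs" using T J by simp
        have "orthonormal_frame euclid E"
          unfolding orthonormal_frame_euclid
        proof (intro conjI allI impI)
          show "length E = 7" using T vs by (simp add: E_def)
          have F': "(v # T @ vs) ! i \<bullet> (v # T @ vs) ! j = (if i = j then 1 else 0)" if "i < 7" "j < 7" for i j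
            using F that unfolding mE orthonormal_frame_euclid by blast
          fix i j :: nat assume ij: "i < 7" "j < 7"
          then show "E ! i \<bullet> E ! j = (if i = j then 1 else 0)"
            using F'[OF ij] x(1) by (cases i; cases j) (auto simp: E_def)
        qed
        moreover have "vol e E = 1"
        proof -
          have "vol e E = x * vol e (map e (I @ J))"
            using dform_row_linear[of "[]" x v 0 0 "T @ vs" "map e [1..<8]"]
            unfolding mE E_def by (simp add: dform_commute[of "map e [_..<_]"] del: upt_Suc)
          then show ?thesis using x by auto
        qed
        ultimately have "\<eta> (drop 3 E) = phi e (take 3 E)" "psi e (drop 3 E) = phi e (take 3 E)"
          using \<eta> star by auto
        then show ?thesis using T by (simp add: E_def)
      qed
    qed
  qed
  then show ?thesis by (simp add: G2_star_def G2_metric_phi[OF e] G2_volume_phi[OF e])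
qed

text \<open>This multiplies e^2 + i e^3 by exp (- i t), which is the source of the minus sign in the
  phase. Turning one plane suffices, since only the total phase of the three planes enters
  \<open>Omega\<close>.\<close>

definition turn :: "real \<Rightarrow> (nat \<Rightarrow> vec7) \<Rightarrow> nat \<Rightarrow> vec7" where
  "turn t e = e(2 := cos t *\<^sub>R e 2 + sin t *\<^sub>R e 3, 3 := cos t *\<^sub>R e 3 - sin t *\<^sub>R e 2)"

lemma frame_turn:
  assumes e: "frame e"
  shows "frame (turn t e)"
proof (rule frameI)
  have n: "e i \<bullet> e j = (if i = j then 1 else 0)" if "i \<in> {1..7}" "j \<in> {1..7}" for i j
    using frame_inner[OF e that] .
  fix i j :: nat assume "i \<in> {1..7}" "j \<in> {1..7}"
  then show "turn t e i \<bullet> turn t e j = (if i = j then 1 else 0)"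
    by (auto simp: turn_def n inner_add_left inner_add_right inner_diff_left inner_diff_right
        simp flip: power2_eq_square)
qed

text \<open>
  With \<open>\<Omega> = (e\<^sup>2 + i e\<^sup>3) \<and> (e\<^sup>4 + i e\<^sup>5) \<and> (e\<^sup>6 + i e\<^sup>7)\<close> and
  \<open>\<omega> = e\<^sup>2\<^sup>3 + e\<^sup>4\<^sup>5 + e\<^sup>6\<^sup>7\<close>, the standard forms are \<open>e\<^sup>1 \<and> \<omega> + Re \<Omega>\<close> and
  \<open>\<omega> \<and> \<omega> / 2 - e\<^sup>1 \<and> Im \<Omega>\<close>, and turning the frame multiplies \<open>\<Omega>\<close> by a phase.
\<close>

definition omega1_list :: "(int \<times> nat list) list" where
  "omega1_list = [(1, [1,2,3]), (1, [1,4,5]), (1, [1,6,7])]"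

definition re_list :: "(int \<times> nat list) list" where
  "re_list = [(1, [2,4,6]), (-1, [2,5,7]), (-1, [3,4,7]), (-1, [3,5,6])]"

definition im_list :: "(int \<times> nat list) list" where
  "im_list = [(1, [2,4,7]), (1, [2,5,6]), (1, [3,4,6]), (-1, [3,5,7])]"

definition omega2_list :: "(int \<times> nat list) list" where
  "omega2_list = [(1, [4,5,6,7]), (1, [2,3,6,7]), (1, [2,3,4,5])]"

definition e1_wedge :: "(int \<times> nat list) list \<Rightarrow> (int \<times> nat list) list" where
  "e1_wedge l = map (\<lambda>x. (fst x, 1 # snd x)) l"

lemma dform_turn:
  "dform ((x *\<^sub>R a + y *\<^sub>R b) # l) vs = x * dform (a # l) vs + y * dform (b # l) vs"
  "dform ((x *\<^sub>R a - y *\<^sub>R b) # l) vs = x * dform (a # l) vs - y * dform (b # l) vs"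
  "dform (p # (x *\<^sub>R a + y *\<^sub>R b) # l) vs = x * dform (p # a # l) vs + y * dform (p # b # l) vs"
  "dform (p # (x *\<^sub>R a - y *\<^sub>R b) # l) vs = x * dform (p # a # l) vs - y * dform (p # b # l) vs"
  using dform_row_linear[of "[]" x a y b l vs] dform_row_linear[of "[]" x a "- y" b l vs]
    dform_row_linear[of "[p]" x a y b l vs] dform_row_linear[of "[p]" x a "- y" b l vs]
  by simp_all

lemma dform_turn_pair:
  "dform ((cos t *\<^sub>R a + sin t *\<^sub>R b) # (cos t *\<^sub>R b - sin t *\<^sub>R a) # l) vs = dform (a # b # l) vs"
proof -
  have "dform ((cos t *\<^sub>R a + sin t *\<^sub>R b) # (cos t *\<^sub>R b - sin t *\<^sub>R a) # l) vs =
    cos t * (cos t * dform (a # b # l) vs) + sin t * (sin t * dform (a # b # l) vs)"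
    by (simp add: dform_turn dform_repeat dform_swap[of b a] algebra_simps)
  also have "\<dots> = ((cos t)\<^sup>2 + (sin t)\<^sup>2) * dform (a # b # l) vs"
    by (simp only: power2_eq_square ring_distribs mult.assoc)
  finally show ?thesis by simp
qed

lemma dform_turn_pair':
  "dform (p # (cos t *\<^sub>R a + sin t *\<^sub>R b) # (cos t *\<^sub>R b - sin t *\<^sub>R a) # l) vs = dform (p # a # b # l) vs"
  using dform_Cons_cong[of "(cos t *\<^sub>R a + sin t *\<^sub>R b) # (cos t *\<^sub>R b - sin t *\<^sub>R a) # l" 1 "a # b # l" p]
  by (simp add: dform_turn_pair)

text \<open>Monomials that contain both of the indices 2 and 3, or neither, do not change. The
  others make up Re (exp (- i t) Omega) = cos t Re Omega + sin t Im Omega.\<close>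

lemma phi_turn:
  "phi (turn t e) vs =
    frame_form e omega1_list vs + cos t * frame_form e re_list vs + sin t * frame_form e im_list vs"
  by (simp add: frame_form_def phi_list_def turn_def omega1_list_def re_list_def im_list_def
      dform_turn_pair' dform_turn(1,2) algebra_simps)

lemma psi_turn:
  "psi (turn t e) vs = frame_form e omega2_list vs
    - cos t * frame_form e (e1_wedge im_list) vs + sin t * frame_form e (e1_wedge re_list) vs"
  by (simp add: frame_form_def psi_list_def turn_def omega2_list_def re_list_def im_list_def e1_wedge_def
      dform_turn_pair dform_turn(3,4)[where p = "e (Suc 0)"] algebra_simps)

lemma im_turn:
  "frame_form (turn t e) im_list vs = cos t * frame_form e im_list vs - sin t * frame_form e re_list vs"
  by (simp add: frame_form_def turn_def re_list_def im_list_def dform_turn(1,2) algebra_simps)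

text \<open>Only the part - e^1 \<and> Im Omega of the dual form contains e^1. Since Im Omega is
  also what differentiating the phase of Re Omega produces, the torsion can be read off from this
  identity.\<close>

lemma interior_psi_e1:
  assumes e: "frame e"
  shows "psi e (e 1 # vs) = - frame_form e im_list vs"
proof -
  have "e i \<bullet> e 1 = (if i = 1 then 1 else 0)" if "i \<in> {1..7}" for i
    using frame_inner[OF e that, of 1] by auto
  then show ?thesis
    by (simp add: frame_form_def psi_list_def im_list_def dform4_Cons)
qed

lemma psi_scale: "psi e ((r *\<^sub>R v) # vs) = r * psi e (v # vs)"
  by (simp add: frame_form_def psi_list_def dform4_Cons algebra_simps)

lemma frame_expand:
  assumes "frame e"
  shows "x = (\<Sum>i\<in>{1..7}. (e i \<bullet> x) *\<^sub>R e i)"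
proof -
  have "x = (\<Sum>i<7. (map e [1..<8] ! i \<bullet> x) *\<^sub>R map e [1..<8] ! i)"
    by (rule orthonormal_frame_expand[symmetric]) (use assms in \<open>simp only: frame_def\<close>)
  also have "\<dots> = (\<Sum>i<7. (e (Suc i) \<bullet> x) *\<^sub>R e (Suc i))"
    by (intro sum.cong refl) (simp add: nth_upt del: upt_Suc)
  also have "\<dots> = (\<Sum>i\<in>{1..7}. (e i \<bullet> x) *\<^sub>R e i)"
    by (simp only: sum.atLeast1_atMost_eq One_nat_def)
  finally show ?thesis .
qed

lemma interior_psi_inject:
  assumes e: "frame e" and eq: "\<And>vs. length vs = 3 \<Longrightarrow> psi e (V # vs) = psi e (W # vs)"
  shows "V = W"
proof -
  have n: "e i \<bullet> e j = (if i = j then 1 else 0)" if "i \<in> {1..7}" "j \<in> {1..7}" for i j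
    using frame_inner[OF e that] .
  have d: "dform [e i, e j, e k] [e i', e j', e k'] = (if (i, j, k) = (i', j', k') then 1 else 0)"
    if "i < j" "j < k" "i' < j'" "j' < k'" "{i, j, k, i', j', k'} \<subseteq> {1..7}" for i j k i' j' k'
    using that by (auto simp: dform3_Cons dform_Cons eval_nat_numeral n)
  have "e i \<bullet> V = e i \<bullet> W" if "i \<in> {1..7}" for i
  proof -
    have "i \<in> {1, 2, 3, 4, 5, 6, 7}" using that by auto
    then show ?thesis
      \<comment> \<open>Two different lists in \<open>psi_list\<close> share exactly two indices, so
        a triple lies in at most one of them. The seven triples are completed by 1, ..., 7 in this
        order, and each isolates one coordinate.\<close>
      using eq[of "[e 3, e 5, e 7]"] eq[of "[e 3, e 6, e 7]"] eq[of "[e 2, e 6, e 7]"]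
        eq[of "[e 5, e 6, e 7]"] eq[of "[e 4, e 6, e 7]"] eq[of "[e 4, e 5, e 7]"] eq[of "[e 4, e 5, e 6]"]
      by (auto simp: frame_form_def psi_list_def dform4_Cons d)
  qed
  then have "(\<Sum>i\<in>{1..7}. (e i \<bullet> V) *\<^sub>R e i) = (\<Sum>i\<in>{1..7}. (e i \<bullet> W) *\<^sub>R e i)"
    by (intro sum.cong refl) simp
  then show ?thesis using frame_expand[OF e, of V] frame_expand[OF e, of W] by (simp only:)
qed

lemma covector_eq_dform: "covector (blinfun_inner_left v) = dform [v]"
proof
  fix vs
  show "covector (blinfun_inner_left v) vs = dform [v] vs"
  proof (cases "length vs = 1")
    case True
    then obtain w where "vs = [w]" by (auto simp: length_Suc_conv)
    then show ?thesis by (simp add: covector_def dform_Cons inner_commute)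
  qed (simp add: covector_def dform_def)
qed

lemma is_G2_form_phi:
  assumes e: "frame e"
  shows "is_G2_form (phi e)"
proof -
  have n: "e i \<bullet> e j = (if i = j then 1 else 0)" if "i \<in> {1..7}" "j \<in> {1..7}" for i j
    using frame_inner[OF e that] .
  define f where "f = (\<lambda>i. blinfun_inner_left (e i))"
  have f: "blinfun_apply (f i) x = e i \<bullet> x" for i x by (simp add: f_def inner_commute)
  have inj: "inj_on f {1..7}"
  proof (rule inj_onI)
    fix i j assume "i \<in> {1..7::nat}" "j \<in> {1..7}" "f i = f j"
    then have "e i \<bullet> e i = e j \<bullet> e i" using f by metis
    then show "i = j" using n \<open>i \<in> {1..7}\<close> \<open>j \<in> {1..7}\<close> by (auto split: if_splits)
  qed
  have "independent (f ` {1..7})"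
  proof (rule independent_if_scalars_zero)
    fix c x assume c: "(\<Sum>x\<in>f ` {1..7}. c x *\<^sub>R x) = 0" and "x \<in> f ` {1..7}"
    then obtain j where j: "j \<in> {1..7}" "x = f j" by auto
    have "(\<Sum>i\<in>{1..7}. c (f i) *\<^sub>R f i) = 0"
      using c sum.reindex[OF inj, of "\<lambda>x. c x *\<^sub>R x"] by (simp only: o_def)
    then have "0 = blinfun_apply (\<Sum>i\<in>{1..7}. c (f i) *\<^sub>R f i) (e j)"
      by (simp only: zero_blinfun.rep_eq)
    also have "\<dots> = (\<Sum>i\<in>{1..7}. c (f i) * (e i \<bullet> e j))"
      by (simp add: blinfun.sum_left scaleR_blinfun.rep_eq f)
    also have "\<dots> = (\<Sum>i\<in>{1..7}. if i = j then c (f i) else 0)"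
      by (intro sum.cong refl) (simp add: n[OF _ j(1)])
    finally show "c x = 0" using j by simp
  qed simp
  moreover have "span (f ` {1..7}) = UNIV"
  proof -
    have "a \<in> span (f ` {1..7})" for a
    proof -
      have "a = (\<Sum>i\<in>{1..7}. blinfun_apply a (e i) *\<^sub>R f i)"
      proof (rule blinfun_eqI)
        fix x
        have "blinfun_apply a x = blinfun_apply a (\<Sum>i\<in>{1..7}. (e i \<bullet> x) *\<^sub>R e i)"
          using frame_expand[OF e, of x] by (simp only:)
        then show "blinfun_apply a x = blinfun_apply (\<Sum>i\<in>{1..7}. blinfun_apply a (e i) *\<^sub>R f i) x"
          by (simp add: blinfun.sum_left blinfun.sum_right blinfun.scaleR_right scaleR_blinfun.rep_eq f mult.commute)
      qed
      also have "\<dots> \<in> span (f ` {1..7})" by (intro span_sum span_scale span_base imageI)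
      finally show ?thesis .
    qed
    then show ?thesis by blast
  qed
  moreover have "elementary3 f i j k = dform [e i, e j, e k]" for i j k
    by (simp add: elementary3_def f_def covector_eq_dform wedge_dform)
  then have "phi e = (\<lambda>vs. elementary3 f 1 2 3 vs + elementary3 f 1 4 5 vs + elementary3 f 1 6 7 vs
            + elementary3 f 2 4 6 vs - elementary3 f 2 5 7 vs
            - elementary3 f 3 4 7 vs - elementary3 f 3 5 6 vs)"
    by (intro ext) (simp add: frame_form_def phi_list_def)
  ultimately show ?thesis unfolding is_G2_form_def using inj by blast
qed

section \<open>Turning the frame along the group\<close>

lemma trig_has_derivative:
  "((\<lambda>x. A + cos (w \<bullet> x) * B + sin (w \<bullet> x) * C) has_derivative
    (\<lambda>h. (w \<bullet> h) * (cos (w \<bullet> x) * C - sin (w \<bullet> x) * B))) (at (x :: vec7))"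
  by (auto intro!: derivative_eq_intros simp: algebra_simps)

lemma trig_frechet_derivative:
  "frechet_derivative (\<lambda>x. A + cos (w \<bullet> x) * B + sin (w \<bullet> x) * C) (at (x :: vec7)) =
    (\<lambda>h. (w \<bullet> h) * (cos (w \<bullet> x) * C - sin (w \<bullet> x) * B))"
  by (rule frechet_derivative_at[OF trig_has_derivative, symmetric])

text \<open>Directional derivatives stay inside this family and only change the three constants, so
  the induction is over all constants at once.\<close>

lemma smooth_on_trig: "smooth_on S (\<lambda>x. A + cos (w \<bullet> x) * B + sin (w \<bullet> x) * (C::real))"
proof -
  have "ck_on n S (\<lambda>x. A + cos (w \<bullet> x) * B + sin (w \<bullet> x) * C)" for n A B C
  proof (induction n arbitrary: A B C)
    case 0
    show ?case by (auto intro!: continuous_intros)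
  next
    case (Suc n)
    have *: "(\<lambda>x. frechet_derivative (\<lambda>x. A + cos (w \<bullet> x) * B + sin (w \<bullet> x) * C) (at x) v) =
      (\<lambda>x. 0 + cos (w \<bullet> x) * ((w \<bullet> v) * C) + sin (w \<bullet> x) * (- ((w \<bullet> v) * B)))" for v
      by (simp only: trig_frechet_derivative) (simp add: algebra_simps)
    show ?case
      unfolding ck_on.simps differentiable_def
      by (intro conjI ballI allI exI, rule trig_has_derivative, simp only: * Suc.IH)
  qed
  then show ?thesis by (simp add: smooth_on_def)
qed

lemma levi_civita_euclid: "levi_civita (\<lambda>_. euclid) x = (\<lambda>_ _. 0)"
  unfolding levi_civita_def
proof (rule the_equality)
  show "bilinear (\<lambda>_ _. 0 :: vec7) \<and> (\<forall>X Y. (0 :: vec7) = 0) \<and>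
     (\<forall>X Y Z. frechet_derivative (\<lambda>y. euclid [Y, Z]) (at x) X = euclid [0, Z] + euclid [Y, 0])"
    by (simp add: bilinear_def linear_zero frechet_derivative_const)
next
  fix C :: "vec7 \<Rightarrow> vec7 \<Rightarrow> vec7"
  assume C: "bilinear C \<and> (\<forall>X Y. C X Y = C Y X) \<and>
     (\<forall>X Y Z. frechet_derivative (\<lambda>y. euclid [Y, Z]) (at x) X = euclid [C X Y, Z] + euclid [Y, C X Z])"
  then have sym: "C X Y = C Y X" and skew: "C X Y \<bullet> Z = - (Y \<bullet> C X Z)" for X Y Z
    by (auto simp: frechet_derivative_const eq_neg_iff_add_eq_0)
  \<comment> \<open>An expression symmetric in \<open>X\<close>, \<open>Y\<close> and skew in
    \<open>Y\<close>, \<open>Z\<close> vanishes: passing through the cyclic permutations returns it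
    with the opposite sign, as in the Koszul formula.\<close>
  have "C X Y \<bullet> Z = 0" for X Y Z
    using skew[of X Y Z] skew[of Z X Y] skew[of Y Z X] sym[of X Z] sym[of Y Z] sym[of X Y]
    by (simp add: inner_commute)
  then have "C X Y = 0" for X Y by (metis inner_eq_zero_iff)
  then show "C = (\<lambda>_ _. 0)" by blast
qed

text \<open>The left-invariant form: along the group the phase of \<open>\<Omega>\<close> is a linear function.\<close>

definition twisted :: "(nat \<Rightarrow> vec7) \<Rightarrow> real \<Rightarrow> vec7 \<Rightarrow> tensor" where
  "twisted e c x = phi (turn (c *\<^sub>R e 1 \<bullet> x) e)"

section \<open>Torsion, divergence and coclosedness of the twisted form\<close>

context
  fixes e :: "nat \<Rightarrow> vec7" and c :: real
  assumes e: "frame e"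
begin

lemma metric_twisted: "metric_field (twisted e c) = (\<lambda>_. euclid)"
  by (simp add: metric_field_def twisted_def G2_metric_phi frame_turn e)

lemma star_twisted: "G2_star (twisted e c x) = psi (turn (c *\<^sub>R e 1 \<bullet> x) e)"
  by (simp add: twisted_def G2_star_phi frame_turn e del: inner_scaleR_left)

lemma twisted_eq: "twisted e c x vs = frame_form e omega1_list vs
    + cos (c *\<^sub>R e 1 \<bullet> x) * frame_form e re_list vs + sin (c *\<^sub>R e 1 \<bullet> x) * frame_form e im_list vs"
  unfolding twisted_def by (rule phi_turn)

lemma multilinear_twisted: "multilinear 3 (twisted e c x)"
  unfolding twisted_def by (rule multilinear_frame_form) (rule homogeneous_phi)

text \<open>The connection terms insert the zero vector and drop out. What remains is the derivative
  of Re (exp (- i t) Omega) in t, which is Im (exp (- i t) Omega), that is, Im Omega in the turned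
  frame.\<close>

lemma cov_deriv_twisted:
  "cov_deriv (metric_field (twisted e c)) (twisted e c) x X vs =
    (c *\<^sub>R e 1 \<bullet> X) * frame_form (turn (c *\<^sub>R e 1 \<bullet> x) e) im_list vs"
proof -
  have "twisted e c x (vs[i := 0]) = 0" if "i < length vs" for i
  proof (cases "length vs = 3")
    case True
    then have "linear (\<lambda>X. twisted e c x (vs[i := X]))"
      using multilinear_twisted[of x] that by (simp add: multilinear_def)
    then show ?thesis by (rule linear_0)
  next
    case False
    then show ?thesis using multilinear_twisted[of x] by (simp add: multilinear_def)
  qed
  then have "cov_deriv (metric_field (twisted e c)) (twisted e c) x X vs =
      frechet_derivative (\<lambda>y. twisted e c y vs) (at x) X"
    by (simp add: cov_deriv_def metric_twisted levi_civita_euclid)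
  also have "\<dots> = (c *\<^sub>R e 1 \<bullet> X) * frame_form (turn (c *\<^sub>R e 1 \<bullet> x) e) im_list vs"
    unfolding twisted_eq trig_frechet_derivative im_turn by simp
  finally show ?thesis .
qed

lemma full_torsion_twisted: "full_torsion (twisted e c) x X = - (c *\<^sub>R e 1 \<bullet> X) *\<^sub>R e 1"
  unfolding full_torsion_def cov_deriv_twisted star_twisted interior_prod_def
proof (rule the_equality)
  let ?f = "turn (c *\<^sub>R e 1 \<bullet> x) e"
  have f: "frame ?f" by (rule frame_turn[OF e])
  have f1: "?f 1 = e 1" by (simp add: turn_def)
  have eq: "psi ?f ((- (c *\<^sub>R e 1 \<bullet> X) *\<^sub>R e 1) # vs) = (c *\<^sub>R e 1 \<bullet> X) * frame_form ?f im_list vs" for vs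
    using interior_psi_e1[OF f, of vs] unfolding f1 psi_scale by simp
  show "\<forall>vs. length vs = 3 \<longrightarrow> (c *\<^sub>R e 1 \<bullet> X) * frame_form ?f im_list vs =
      psi ?f ((- (c *\<^sub>R e 1 \<bullet> X) *\<^sub>R e 1) # vs)"
    by (simp only: eq simp_thms)
  fix W assume "\<forall>vs. length vs = 3 \<longrightarrow> (c *\<^sub>R e 1 \<bullet> X) * frame_form ?f im_list vs = psi ?f (W # vs)"
  then show "W = - (c *\<^sub>R e 1 \<bullet> X) *\<^sub>R e 1"
    by (intro interior_psi_inject[OF f]) (simp only: eq)
qed

lemma cov_deriv_torsion_twisted:
  "cov_deriv (metric_field (twisted e c)) (torsion_tensor (twisted e c)) x X [Y, Z] = 0"
proof -
  have t: "torsion_tensor (twisted e c) y [Y, Z] = - (c *\<^sub>R e 1 \<bullet> Y) * (e 1 \<bullet> Z)" for y Y Z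
    unfolding torsion_tensor_def by (simp add: metric_twisted full_torsion_twisted)
  show ?thesis
    by (simp add: cov_deriv_def metric_twisted levi_civita_euclid t eval_nat_numeral frechet_derivative_const)
qed

lemma div_torsion_twisted: "div_torsion (twisted e c) x = 0"
  unfolding div_torsion_def cov_deriv_torsion_twisted
proof (rule the_equality)
  show "\<forall>E. orthonormal_frame (metric_field (twisted e c) x) E \<longrightarrow>
    (\<forall>j<7. metric_field (twisted e c) x [0, E ! j] = (\<Sum>i<7::nat. 0))"
    by (simp add: metric_twisted)
  fix D assume D: "\<forall>E. orthonormal_frame (metric_field (twisted e c) x) E \<longrightarrow>
    (\<forall>j<7. metric_field (twisted e c) x [D, E ! j] = (\<Sum>i<7::nat. 0))"
  have E: "orthonormal_frame euclid (map e [1..<8])" using e by (simp only: frame_def)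
  have "D \<bullet> map e [1..<8] ! j = 0" if "j < 7" for j
    using D E that by (simp only: metric_twisted euclid_pair sum.neutral_const)
  then show "D = 0"
    using orthonormal_frame_inner[OF E, of D D] by simp
qed

text \<open>The alternating sum is the Laplace expansion of determinants whose first two rows both
  are \<open>e 1\<close>.\<close>

lemma ext_deriv_e1_wedge:
  assumes "homogeneous 3 l" "length vs = 5"
  shows "(\<Sum>i\<le>4. (- 1) ^ i * (e 1 \<bullet> vs ! i) * frame_form e (e1_wedge l) (take i vs @ drop (Suc i) vs)) = 0"
  using assms(1)
proof (induction l)
  case Nil
  show ?case by (simp add: e1_wedge_def frame_form_def)
next
  case (Cons p l)
  have "{..4} = {..<length vs}" using assms by auto
  then have "(\<Sum>i\<le>4. (- 1) ^ i * (e 1 \<bullet> vs ! i) * dform (e 1 # map e (snd p)) (take i vs @ drop (Suc i) vs)) =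
      dform (e 1 # e 1 # map e (snd p)) vs"
    using assms Cons.prems by (subst dform_Cons) (simp_all add: homogeneous_def)
  then have "(\<Sum>i\<le>4. (- 1) ^ i * (e 1 \<bullet> vs ! i) *
      (of_int (fst p) * dform (e 1 # map e (snd p)) (take i vs @ drop (Suc i) vs))) = 0"
    by (simp add: dform_repeat mult.left_commute[of _ "of_int (fst p)"] flip: sum_distrib_left)
  moreover have "homogeneous 3 l" using Cons.prems by (simp add: homogeneous_def)
  ultimately show ?case
    using Cons.IH by (simp add: e1_wedge_def frame_form_def ring_distribs sum.distrib del: sum.atMost_Suc)
qed

lemma ext_deriv_star_twisted: "ext_deriv 4 (\<lambda>y. G2_star (twisted e c y)) x vs = 0"
proof (cases "length vs = 5")
  case True
  have p: "psi (turn (c *\<^sub>R e 1 \<bullet> y) e) ws = frame_form e omega2_list ws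
    + cos (c *\<^sub>R e 1 \<bullet> y) * (- frame_form e (e1_wedge im_list) ws)
    + sin (c *\<^sub>R e 1 \<bullet> y) * frame_form e (e1_wedge re_list) ws" for y ws
    by (simp add: psi_turn)
  let ?ws = "\<lambda>i. take i vs @ drop (Suc i) vs"
  let ?C = "cos (c *\<^sub>R e 1 \<bullet> x)" and ?S = "sin (c *\<^sub>R e 1 \<bullet> x)"
  have "ext_deriv 4 (\<lambda>y. G2_star (twisted e c y)) x vs =
    (\<Sum>i\<le>4. (- 1) ^ i * ((c *\<^sub>R e 1 \<bullet> vs ! i) *
       (?C * frame_form e (e1_wedge re_list) (?ws i) - ?S * (- frame_form e (e1_wedge im_list) (?ws i)))))"
    unfolding ext_deriv_def star_twisted p trig_frechet_derivative using True by simp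
  also have "\<dots> = (\<Sum>i\<le>4. c * ?C * ((- 1) ^ i * (e 1 \<bullet> vs ! i) * frame_form e (e1_wedge re_list) (?ws i))
      + c * ?S * ((- 1) ^ i * (e 1 \<bullet> vs ! i) * frame_form e (e1_wedge im_list) (?ws i)))"
    by (intro sum.cong refl) (simp add: algebra_simps)
  also have "\<dots> = c * ?C * (\<Sum>i\<le>4. (- 1) ^ i * (e 1 \<bullet> vs ! i) * frame_form e (e1_wedge re_list) (?ws i))
      + c * ?S * (\<Sum>i\<le>4. (- 1) ^ i * (e 1 \<bullet> vs ! i) * frame_form e (e1_wedge im_list) (?ws i))"
    by (simp only: sum.distrib sum_distrib_left)
  also have "\<dots> = 0"
  proof -
    have "homogeneous 3 re_list" "homogeneous 3 im_list"
      by (auto simp: homogeneous_def re_list_def im_list_def)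
    then show ?thesis using True by (simp only: ext_deriv_e1_wedge)
  qed
  finally show ?thesis .
qed (simp add: ext_deriv_def)

end

section \<open>Commuting families of rotations\<close>

text \<open>The Rayleigh quotient of a symmetric operator attains its maximum at an eigenvector.\<close>

lemma symmetric_invariant_eigenvector:
  fixes T :: "'a::euclidean_space \<Rightarrow> 'a"
  assumes V: "subspace V" "V \<noteq> {0}"
    and T: "linear T" "\<And>x. x \<in> V \<Longrightarrow> T x \<in> V"
    and sym: "\<And>x y. x \<in> V \<Longrightarrow> y \<in> V \<Longrightarrow> T x \<bullet> y = x \<bullet> T y"
  obtains v l where "v \<in> V" "v \<noteq> 0" "T v = l *\<^sub>R v"
proof -
  let ?S = "V \<inter> sphere 0 1"
  have "0 \<in> V" by (simp add: V subspace_0)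
  then obtain w where w: "w \<in> V" "w \<noteq> 0" using V by blast
  have "w /\<^sub>R norm w \<in> ?S" using w V by (simp add: subspace_scale)
  moreover have "compact ?S"
    using closed_subspace[OF V(1)] by (simp add: closed_Int_compact)
  moreover have "continuous_on ?S (\<lambda>x. T x \<bullet> x)"
    using T by (intro continuous_intros linear_continuous_on linear_conv_bounded_linear[THEN iffD1])
  ultimately obtain v where v: "v \<in> ?S" "\<And>y. y \<in> ?S \<Longrightarrow> T y \<bullet> y \<le> T v \<bullet> v"
    using continuous_attains_sup[of ?S] by blast
  define l where "l = T v \<bullet> v"
  define B where "B = (\<lambda>x y. l * (x \<bullet> y) - T x \<bullet> y)"
  have vV: "v \<in> V" and nv: "v \<bullet> v = 1" using v by (auto simp: norm_eq_1)
  have pos: "B x x \<ge> 0" if "x \<in> V" for x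
  proof (cases "x = 0")
    case False
    have "T (x /\<^sub>R norm x) \<bullet> (x /\<^sub>R norm x) \<le> l"
      unfolding l_def using that V False by (intro v(2)) (simp add: subspace_scale)
    then have "T x \<bullet> x \<le> l * (norm x)\<^sup>2"
      using False by (simp add: linear_scale[OF T(1)] field_simps power2_eq_square)
    then show ?thesis by (simp add: B_def power2_norm_eq_inner)
  qed (simp add: B_def)
  have Bvv: "B v v = 0" by (simp add: B_def l_def nv)
  have "B v w = 0" if w: "w \<in> V" for w
  proof (rule ccontr)
    assume nz: "B v w \<noteq> 0"
    have q: "0 \<le> B w w + 2 * t * B v w" for t
    proof -
      have "B (w + t *\<^sub>R v) (w + t *\<^sub>R v) = B w w + 2 * t * B v w + t\<^sup>2 * B v v"
        using sym[OF w vV] by (simp add: B_def linear_add[OF T(1)] linear_scale[OF T(1)] inner_add_left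
            inner_add_right inner_commute algebra_simps power2_eq_square)
      moreover have "w + t *\<^sub>R v \<in> V" using w vV V by (simp add: subspace_add subspace_scale)
      ultimately show ?thesis using pos[of "w + t *\<^sub>R v"] Bvv by simp
    qed
    \<comment> \<open>\<open>B\<close> is positive semidefinite and vanishes at \<open>v\<close>, so
      its values along \<open>w + t v\<close> are affine in t and cannot have a nonzero slope. This
      t makes the value -1.\<close>
    show False using q[of "- (B w w + 1) / (2 * B v w)"] nz by (simp add: field_simps)
  qed
  then have "(l *\<^sub>R v - T v) \<bullet> w = 0" if "w \<in> V" for w
    using that by (simp add: B_def inner_diff_left)
  moreover have "l *\<^sub>R v - T v \<in> V" using vV T V by (simp add: subspace_diff subspace_scale)
  ultimately have "l *\<^sub>R v - T v = 0" by (metis inner_eq_zero_iff)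
  moreover have "v \<noteq> 0" using nv by auto
  ultimately show ?thesis using that[of v l] vV by simp
qed

text \<open>Halving makes every \<open>R s\<close> a square. This excludes lines on which the family
  acts by nontrivial signs, where no rotation plane could be found.\<close>

locale orthogonal_family =
  fixes R :: "'i::ab_group_add \<Rightarrow> 'a::euclidean_space \<Rightarrow> 'a" and S :: "'i set"
  assumes orth: "s \<in> S \<Longrightarrow> orthogonal_transformation (R s)"
    and zero: "0 \<in> S" "R 0 = id"
    and add: "s \<in> S \<Longrightarrow> t \<in> S \<Longrightarrow> s + t \<in> S" "s \<in> S \<Longrightarrow> t \<in> S \<Longrightarrow> R (s + t) x = R s (R t x)"
    and uminus: "s \<in> S \<Longrightarrow> - s \<in> S"
    and half: "s \<in> S \<Longrightarrow> \<exists>t\<in>S. t + t = s"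
begin

lemma linear_R: "s \<in> S \<Longrightarrow> linear (R s)"
  by (simp add: orth orthogonal_transformation_linear)

lemma commute_R: "s \<in> S \<Longrightarrow> t \<in> S \<Longrightarrow> R s (R t x) = R t (R s x)"
  by (metis add(2) add.commute)

lemma R_uminus: "s \<in> S \<Longrightarrow> R (- s) (R s x) = x" "s \<in> S \<Longrightarrow> R s (R (- s) x) = x"
  using add(2)[of "- s" s x] add(2)[of s "- s" x] zero uminus by simp_all

lemma inner_R: "s \<in> S \<Longrightarrow> R s x \<bullet> R s y = x \<bullet> y"
  using orth by (simp add: orthogonal_transformation_def)

lemma R_adjoint: "s \<in> S \<Longrightarrow> R s x \<bullet> y = x \<bullet> R (- s) y"
  using inner_R[of s x "R (- s) y"] by (simp add: R_uminus)

definition invariant :: "'a set \<Rightarrow> bool" where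
  "invariant V \<longleftrightarrow> subspace V \<and> (\<forall>s\<in>S. \<forall>x\<in>V. R s x \<in> V)"

definition irreducible :: "'a set \<Rightarrow> bool" where
  "irreducible V \<longleftrightarrow> invariant V \<and> V \<noteq> {0} \<and> (\<forall>U. invariant U \<and> U \<noteq> {0} \<and> U \<subseteq> V \<longrightarrow> U = V)"

lemma irreducible_exists:
  assumes "invariant W" "W \<noteq> {0}"
  obtains V where "irreducible V" "V \<subseteq> W"
proof -
  let ?P = "\<lambda>V. invariant V \<and> V \<noteq> {0} \<and> V \<subseteq> W"
  have "?P W" using assms by simp
  from ex_has_least_nat[of ?P, OF this, of dim]
  obtain V where V: "?P V" "\<And>U. ?P U \<Longrightarrow> dim V \<le> dim U" by metis
  have "U = V" if "invariant U" "U \<noteq> {0}" "U \<subseteq> V" for U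
  proof (rule subspace_dim_equal)
    show "subspace U" "subspace V" using that V by (auto simp: invariant_def)
    show "U \<subseteq> V" by fact
    have "U \<subseteq> W" using \<open>U \<subseteq> V\<close> V(1) by (meson subset_trans)
    with \<open>invariant U\<close> \<open>U \<noteq> {0}\<close> show "dim V \<le> dim U" by (intro V(2) conjI)
  qed
  then have "irreducible V" using V(1) by (simp add: irreducible_def)
  then show ?thesis using that V(1) by simp
qed

text \<open>An eigenspace of \<open>T\<close> in \<open>V\<close> is nonzero and invariant, because
  \<open>T\<close> commutes with the family; irreducibility makes it all of
  \<open>V\<close>.\<close>

lemma schur:
  assumes V: "irreducible V"
    and T: "linear T" "\<And>x. x \<in> V \<Longrightarrow> T x \<in> V" "\<And>x y. x \<in> V \<Longrightarrow> y \<in> V \<Longrightarrow> T x \<bullet> y = x \<bullet> T y"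
    and com: "\<And>s x. s \<in> S \<Longrightarrow> x \<in> V \<Longrightarrow> T (R s x) = R s (T x)"
  obtains l where "\<And>x. x \<in> V \<Longrightarrow> T x = l *\<^sub>R x"
proof -
  have sV: "subspace V" "V \<noteq> {0}" using V by (auto simp: irreducible_def invariant_def)
  obtain v l where v: "v \<in> V" "v \<noteq> 0" "T v = l *\<^sub>R v"
    using symmetric_invariant_eigenvector[OF sV T(1) T(2) T(3)] by blast
  let ?U = "{x\<in>V. T x = l *\<^sub>R x}"
  have "subspace ?U"
    using sV by (auto simp: subspace_def linear_0[OF T(1)] linear_add[OF T(1)] linear_scale[OF T(1)] algebra_simps)
  moreover have "R s x \<in> ?U" if "s \<in> S" "x \<in> ?U" for s x
    using V that com[of s x] linear_scale[OF linear_R[of s], of l x]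
    by (simp add: invariant_def irreducible_def)
  ultimately have "invariant ?U" by (simp add: invariant_def)
  moreover have "?U \<noteq> {0}" using v by blast
  ultimately have "?U = V" using V unfolding irreducible_def by blast
  then show ?thesis using that[of l] by blast
qed

lemma invariant_R: "irreducible V \<Longrightarrow> s \<in> S \<Longrightarrow> x \<in> V \<Longrightarrow> R s x \<in> V"
  by (simp add: irreducible_def invariant_def)

text \<open>
  On an irreducible \<open>V\<close> the symmetric operators \<open>R s + R (- s)\<close> are scalars; a nonzero skew
  operator \<open>R s - R (- s)\<close> has a scalar square and is therefore a multiple of a complex structure
  \<open>J\<close>, and the other skew operators are multiples of it.
\<close>

lemma rotation_plane:
  assumes V: "irreducible V" and nf: "\<exists>s\<in>S. \<exists>x\<in>V. R s x \<noteq> x"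
  obtains a b c d where "a \<in> V" "b \<in> V" "a \<bullet> a = 1" "b \<bullet> b = 1" "a \<bullet> b = 0"
    "\<And>s. s \<in> S \<Longrightarrow> R s a = c s *\<^sub>R a + d s *\<^sub>R b"
    "\<And>s. s \<in> S \<Longrightarrow> R s b = c s *\<^sub>R b - d s *\<^sub>R a"
proof -
  have sV: "subspace V" "V \<noteq> {0}" using V by (auto simp: irreducible_def invariant_def)
  note VR = invariant_R[OF V]
  have lin: "linear (R s)" if "s \<in> S" for s using linear_R that .
  have "\<exists>c. \<forall>x\<in>V. R s x + R (- s) x = (2 * c) *\<^sub>R x" if s: "s \<in> S" for s
  proof -
    obtain l where "\<And>x. x \<in> V \<Longrightarrow> R s x + R (- s) x = l *\<^sub>R x"
    proof (rule schur[OF V, of "\<lambda>x. R s x + R (- s) x"])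
      show "linear (\<lambda>x. R s x + R (- s) x)" by (intro linear_compose_add lin s uminus)
      show "R s x + R (- s) x \<in> V" if "x \<in> V" for x
        using that s uminus sV VR by (simp add: subspace_add)
      show "(R s x + R (- s) x) \<bullet> y = x \<bullet> (R s y + R (- s) y)" for x y
        using s uminus by (simp add: inner_add_left inner_add_right R_adjoint)
      show "R s (R t x) + R (- s) (R t x) = R t (R s x + R (- s) x)" if "t \<in> S" for t x
        using that s uminus by (simp add: linear_add[OF lin] commute_R[of s t] commute_R[of "- s" t])
    qed blast
    then show ?thesis by (intro exI[of _ "l / 2"]) simp
  qed
  then obtain c where c: "\<And>s x. s \<in> S \<Longrightarrow> x \<in> V \<Longrightarrow> R s x + R (- s) x = (2 * c s) *\<^sub>R x"
    by metis
  define N where "N = (\<lambda>s x. (1 / 2) *\<^sub>R (R s x - R (- s) x))"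
  have Nx: "N s x = (1 / 2) *\<^sub>R (R s x - R (- s) x)" for s x by (simp add: N_def)
  have Rcn: "R s x = c s *\<^sub>R x + N s x" if "s \<in> S" "x \<in> V" for s x
  proof -
    have "2 *\<^sub>R R s x = (R s x + R (- s) x) + (R s x - R (- s) x)" by (simp add: scaleR_2)
    also have "\<dots> = 2 *\<^sub>R (c s *\<^sub>R x + N s x)" using c[OF that] by (simp add: N_def scaleR_add_right)
    finally show ?thesis by simp
  qed
  have NV: "N s x \<in> V" if "s \<in> S" "x \<in> V" for s x
    unfolding N_def using that uminus sV VR by (intro subspace_scale subspace_diff) auto
  have linN: "linear (N s)" if "s \<in> S" for s
    unfolding N_def using that uminus by (intro linear_compose_scale_right linear_compose_sub lin)
  have skew: "N s x \<bullet> y = - (x \<bullet> N s y)" if "s \<in> S" for s x y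
    using that uminus unfolding N_def
    by (simp add: inner_diff_left inner_diff_right R_adjoint algebra_simps)
  have comN: "N s (R t x) = R t (N s x)" if "s \<in> S" "t \<in> S" for s t x
    using that uminus unfolding N_def by (simp add: linear_diff[OF lin] linear_scale[OF lin] commute_R[of s t] commute_R[of "- s" t])
  have comNN: "N s (N t x) = N t (N s x)" if "s \<in> S" "t \<in> S" for s t x
    using that uminus Nx[of t] comN[of s t x] comN[of s "- t" x]
    by (simp add: linear_diff[OF linN] linear_scale[OF linN])
  have NN: "N s (N s x) = ((c (s + s) - 1) / 2) *\<^sub>R x" if "s \<in> S" "x \<in> V" for s x
  proof -
    have "N s (N s x) = (1 / 4) *\<^sub>R ((R (s + s) x + R (- (s + s)) x) - 2 *\<^sub>R x)"
      using that uminus add(2)[of s s x] add(2)[of "- s" "- s" x] unfolding N_def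
      by (simp add: linear_diff[OF lin] linear_scale[OF lin] R_uminus scaleR_2 algebra_simps)
    also have "\<dots> = ((c (s + s) - 1) / 2) *\<^sub>R x"
      using c[of "s + s" x] that add by (simp add: algebra_simps diff_divide_distrib)
    finally show ?thesis .
  qed
  obtain s where s: "s \<in> S" and Nz: "\<exists>x\<in>V. N s x \<noteq> 0"
  proof -
    obtain s0 x0 where s0: "s0 \<in> S" "x0 \<in> V" "R s0 x0 \<noteq> x0" using nf by blast
    \<comment> \<open>\<open>s0\<close> moves a point, but its skew part may vanish, as for a half
      turn. The half \<open>s\<close> avoids this: with zero skew part \<open>R s\<close> would be a
      scalar of square 1 on \<open>V\<close>, and \<open>R s0\<close> would be the identity
      there.\<close>
    obtain s where s: "s \<in> S" "s + s = s0" using half s0 by blast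
    have "\<exists>x\<in>V. N s x \<noteq> 0"
    proof (rule ccontr)
      assume "\<not> (\<exists>x\<in>V. N s x \<noteq> 0)"
      then have R: "R s x = c s *\<^sub>R x" if "x \<in> V" for x using Rcn[of s x] s that by simp
      have "x0 \<bullet> x0 \<noteq> 0" using s0 linear_0[OF lin[OF s0(1)]] by auto
      moreover have "(c s * c s) * (x0 \<bullet> x0) = x0 \<bullet> x0"
        using inner_R[of s x0 x0] R[of x0] s s0 by simp
      ultimately have "c s * c s = 1" by simp
      then have "R s0 x0 = x0"
        using s s0 R add(2)[of s s x0] by (simp add: linear_scale[OF lin])
      then show False using s0 by simp
    qed
    then show ?thesis using that s by blast
  qed
  \<comment> \<open>With \<open>c\<close> as the cosine of the angle, this is (1 - cos 2\<theta>) /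
    2 = sin^2 \<theta>. Thus \<open>N s\<close> squares to \<open>- m\<close>, and dividing by
    \<open>sqrt m\<close> gives a complex structure.\<close>
  define m where "m = (1 - c (s + s)) / 2"
  have Nm: "N s x \<bullet> N s y = m * (x \<bullet> y)" if "x \<in> V" "y \<in> V" for x y
    using skew[OF s, of x "N s y"] NN[OF s that(2)] by (simp add: m_def field_simps)
  have "m > 0"
  proof -
    obtain x where x: "x \<in> V" "N s x \<noteq> 0" using Nz by blast
    then have "x \<noteq> 0" using linear_0[OF linN[OF s]] by auto
    then have "m * (x \<bullet> x) > 0" "x \<bullet> x > 0" using x Nm[of x x] by (auto simp flip: Nm)
    then show ?thesis by (simp add: zero_less_mult_iff)
  qed
  define J where "J = (\<lambda>x. (1 / sqrt m) *\<^sub>R N s x)"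
  have linJ: "linear J" unfolding J_def by (intro linear_compose_scale_right linN s)
  have JV: "J x \<in> V" if "x \<in> V" for x unfolding J_def using that NV s sV by (simp add: subspace_scale)
  have JJ: "J (J x) = - x" if "x \<in> V" for x
  proof -
    have "J (J x) = (1 / m) *\<^sub>R N s (N s x)"
      using \<open>m > 0\<close> by (simp add: J_def linear_scale[OF linN[OF s]] flip: real_sqrt_mult)
    also have "\<dots> = (1 / m) *\<^sub>R ((- m) *\<^sub>R x)"
    proof -
      have "(c (s + s) - 1) / 2 = - m" by (simp add: m_def field_simps)
      then show ?thesis using NN[OF s that] by simp
    qed
    finally show ?thesis using \<open>m > 0\<close> by simp
  qed
  have Jskew: "J x \<bullet> y = - (x \<bullet> J y)" for x y by (simp add: J_def skew[OF s, of x y])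
  have "\<exists>d. \<forall>x\<in>V. N t x = d *\<^sub>R J x" if t: "t \<in> S" for t
  proof -
    \<comment> \<open>The product of two commuting skew operators is symmetric, so Schur's lemma
      applies to \<open>N t \<circ> J\<close>.\<close>
    obtain l where l: "\<And>x. x \<in> V \<Longrightarrow> N t (J x) = l *\<^sub>R x"
    proof (rule schur[OF V, of "\<lambda>x. N t (J x)"])
      show "linear (\<lambda>x. N t (J x))" using linear_compose[OF linJ linN[OF t]] by (simp add: o_def)
      show "N t (J x) \<in> V" if "x \<in> V" for x using that t JV NV by simp
      have "J (N t y) = N t (J y)" for y by (simp add: J_def comNN[OF s t] linear_scale[OF linN[OF t]])
      then show "N t (J x) \<bullet> y = x \<bullet> N t (J y)" for x y
        using skew[OF t, of "J x" y] Jskew[of x "N t y"] by simp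
      show "N t (J (R u x)) = R u (N t (J x))" if "u \<in> S" for u x
        using that s t by (simp add: J_def comN linear_scale[OF lin] linear_scale[OF linN])
    qed blast
    have "N t x = (- l) *\<^sub>R J x" if "x \<in> V" for x
    proof -
      have "- N t x = l *\<^sub>R J x"
        using l[OF JV[OF that]] JJ[OF that] linear_neg[OF linN[OF t], of x] by simp
      then show ?thesis by (metis minus_equation_iff scaleR_minus_left)
    qed
    then show ?thesis by blast
  qed
  then obtain d where d: "\<And>t x. t \<in> S \<Longrightarrow> x \<in> V \<Longrightarrow> N t x = d t *\<^sub>R J x" by metis
  obtain v where v: "v \<in> V" "v \<noteq> 0" using sV subspace_0[OF sV(1)] by blast
  define a where "a = v /\<^sub>R norm v"
  have a: "a \<in> V" "a \<bullet> a = 1"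
    using v sV by (simp_all add: a_def subspace_scale dot_square_norm power2_eq_square)
  show ?thesis
  proof (rule that[of a "J a" c d])
    show "a \<in> V" "J a \<in> V" "a \<bullet> a = 1" using a JV by auto
    show "J a \<bullet> J a = 1" using Jskew[of a "J a"] JJ[OF a(1)] a by simp
    show "a \<bullet> J a = 0" using Jskew[of a a] by (simp add: inner_commute)
    show "R t a = c t *\<^sub>R a + d t *\<^sub>R J a" if "t \<in> S" for t
      using Rcn[OF that a(1)] d[OF that a(1)] by simp
    show "R t (J a) = c t *\<^sub>R J a - d t *\<^sub>R a" if "t \<in> S" for t
      using Rcn[OF that JV[OF a(1)]] d[OF that JV[OF a(1)]] JJ[OF a(1)] by simp
  qed
qed

end

section \<open>Orthonormal lists and their grouping into pairs\<close>

primrec orthonormal_list :: "'a::real_inner list \<Rightarrow> bool" where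
  "orthonormal_list [] \<longleftrightarrow> True"
| "orthonormal_list (a # L) \<longleftrightarrow> a \<bullet> a = 1 \<and> (\<forall>b\<in>set L. a \<bullet> b = 0) \<and> orthonormal_list L"

lemma orthonormal_list_append:
  "orthonormal_list (L @ M) \<longleftrightarrow>
    orthonormal_list L \<and> orthonormal_list M \<and> (\<forall>a\<in>set L. \<forall>b\<in>set M. a \<bullet> b = 0)"
  by (induction L) auto

lemma orthonormal_list_nth:
  "orthonormal_list L \<Longrightarrow> i < length L \<Longrightarrow> j < length L \<Longrightarrow> L ! i \<bullet> L ! j = (if i = j then 1 else 0)"
proof (induction L arbitrary: i j)
  case (Cons a L)
  then show ?case by (cases i; cases j) (auto simp: inner_commute)
qed simp

lemma orthonormal_list_independent:
  fixes L :: "'a::euclidean_space list"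
  assumes L: "orthonormal_list L"
  shows "distinct L" "independent (set L)"
proof -
  note nth = orthonormal_list_nth[OF L]
  show "distinct L"
    unfolding distinct_conv_nth using nth by (metis one_neq_zero)
  have "x \<bullet> y = 0" if "x \<in> set L" "y \<in> set L" "x \<noteq> y" for x y
    using that nth by (auto simp: in_set_conv_nth)
  then have "pairwise orthogonal (set L)"
    by (simp add: pairwise_def real_inner_class.orthogonal_def)
  moreover have "0 \<notin> set L"
    unfolding in_set_conv_nth using nth by (metis inner_zero_left one_neq_zero)
  ultimately show "independent (set L)" by (rule pairwise_orthogonal_independent)
qed

lemma orthonormal_list_length:
  fixes L :: "'a::euclidean_space list"
  assumes L: "orthonormal_list L"
  shows "length L = dim (span (set L))"
  using orthonormal_list_independent[OF L]
  by (simp add: dim_eq_card_independent distinct_card)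

lemma orthonormal_list_basis:
  fixes W :: "'a::euclidean_space set"
  assumes "subspace W"
  obtains L where "orthonormal_list L" "span (set L) = W"
proof -
  obtain B where B: "B \<subseteq> W" "pairwise orthogonal B" "\<And>x. x \<in> B \<Longrightarrow> norm x = 1"
    "independent B" "card B = dim W" "span B = W"
    using orthonormal_basis_subspace[OF assms] by metis
  obtain L where L: "set L = B" "distinct L"
    using finite_distinct_list[OF independent_imp_finite[OF B(4)]] by blast
  have "orthonormal_list M" if "distinct M" "set M \<subseteq> B" for M
    using that
  proof (induction M)
    case (Cons a M)
    have "a \<bullet> b = 0" if "b \<in> set M" for b
    proof -
      have "a \<noteq> b" "a \<in> B" "b \<in> B" using that Cons.prems by auto
      then show ?thesis using B(2) by (auto simp: pairwise_def real_inner_class.orthogonal_def)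
    qed
    moreover have "a \<bullet> a = 1" using B(3)[of a] Cons.prems by (simp add: norm_eq_1)
    ultimately show ?case using Cons by simp
  qed simp
  then show ?thesis using that[of L] L B by simp
qed

fun unpair :: "('a \<times> 'a) list \<Rightarrow> 'a list" where
  "unpair [] = []"
| "unpair ((a, b) # ps) = a # b # unpair ps"

lemma unpair_append: "unpair (ps @ qs) = unpair ps @ unpair qs"
  by (induction ps rule: unpair.induct) auto

lemma length_unpair: "length (unpair ps) = 2 * length ps"
  by (induction ps rule: unpair.induct) auto

lemma unpair_surj: "even (length L) \<Longrightarrow> \<exists>ps. unpair ps = L"
proof (induction L rule: induct_list012)
  case (3 a b L)
  then obtain ps where "unpair ps = L" by auto
  then show ?case by (intro exI[of _ "(a, b) # ps"]) simp
qed (auto intro: exI[of _ "[]"])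

lemma in_unpair: "(a, b) \<in> set ps \<Longrightarrow> a \<in> set (unpair ps) \<and> b \<in> set (unpair ps)"
  by (induction ps rule: unpair.induct) auto

section \<open>Simultaneous rotation planes and their characters\<close>

context orthogonal_family
begin

definition fixed :: "'a set" where
  "fixed = {x. \<forall>s\<in>S. R s x = x}"

lemma subspace_fixed: "subspace fixed"
  using linear_R by (auto simp: fixed_def subspace_def linear_0 linear_add linear_scale)

text \<open>Cosine and sine are recovered as inner products, so they need not be carried along as
  extra data.\<close>

definition rotated :: "'a \<Rightarrow> 'a \<Rightarrow> bool" where
  "rotated a b \<longleftrightarrow> (\<forall>s\<in>S. R s a = (R s a \<bullet> a) *\<^sub>R a + (R s a \<bullet> b) *\<^sub>R b \<and>
     R s b = (R s a \<bullet> a) *\<^sub>R b - (R s a \<bullet> b) *\<^sub>R a)"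

text \<open>The phase cos + i sin of the rotation of a plane. Phases multiply without any choice of
  branch; linear angles appear only for their product, through
  \<open>circle_character\<close>.\<close>

definition character :: "'a \<times> 'a \<Rightarrow> 'i \<Rightarrow> complex" where
  "character p s = Complex (R s (fst p) \<bullet> fst p) (R s (fst p) \<bullet> snd p)"

text \<open>Pairs of fixed vectors count as planes with trivial phase, so they can complete a frame
  without changing the total weight.\<close>

lemma rotated_fixed:
  assumes "a \<in> fixed" "b \<in> fixed" "a \<bullet> a = 1" "a \<bullet> b = 0"
  shows "rotated a b" "s \<in> S \<Longrightarrow> character (a, b) s = 1"
  using assms by (auto simp: rotated_def fixed_def character_def complex_eq_iff)

lemma character_add:
  assumes "rotated a b" "a \<bullet> a = 1" "b \<bullet> b = 1" "a \<bullet> b = 0" "s \<in> S" "t \<in> S"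
  shows "character (a, b) (s + t) = character (a, b) s * character (a, b) t"
proof -
  define c d where "c = (\<lambda>s. R s a \<bullet> a)" and "d = (\<lambda>s. R s a \<bullet> b)"
  have r: "R u a = c u *\<^sub>R a + d u *\<^sub>R b" "R u b = c u *\<^sub>R b - d u *\<^sub>R a" if "u \<in> S" for u
    using assms(1) that unfolding rotated_def c_def d_def by blast+
  have "R (s + t) a = R s (c t *\<^sub>R a + d t *\<^sub>R b)"
    using add(2)[of s t a] r(1)[of t] assms by simp
  also have "\<dots> = c t *\<^sub>R (c s *\<^sub>R a + d s *\<^sub>R b) + d t *\<^sub>R (c s *\<^sub>R b - d s *\<^sub>R a)"
    using assms r by (simp add: linear_add[OF linear_R] linear_scale[OF linear_R])
  finally have "R (s + t) a = \<dots>" .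
  then have "c (s + t) = c s * c t - d s * d t" "d (s + t) = c s * d t + d s * c t"
    using assms unfolding c_def[of] d_def by (simp_all add: inner_add_left inner_diff_left inner_commute[of b a])
  then show ?thesis by (simp add: character_def complex_eq_iff c_def d_def)
qed

lemma norm_character:
  assumes "rotated a b" "a \<bullet> a = 1" "b \<bullet> b = 1" "a \<bullet> b = 0" "s \<in> S"
  shows "norm (character (a, b) s) = 1"
proof -
  have "1 = R s a \<bullet> R s a" using assms by (simp add: inner_R)
  also have "R s a \<bullet> R s a = ((R s a \<bullet> a) *\<^sub>R a + (R s a \<bullet> b) *\<^sub>R b) \<bullet> R s a"
    using assms(1,5) unfolding rotated_def by metis
  also have "\<dots> = (R s a \<bullet> a)\<^sup>2 + (R s a \<bullet> b)\<^sup>2"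
    by (simp add: inner_add_right power2_eq_square inner_commute[of _ "R s a"])
  finally show ?thesis by (simp add: character_def cmod_def)
qed

text \<open>By induction on the dimension: an irreducible subspace is not fixed pointwise and
  therefore contains a rotation plane. Its orthogonal complement in \<open>W\<close> is again
  invariant, since the adjoint of \<open>R s\<close> is \<open>R (- s)\<close>.\<close>

lemma rotation_pairs:
  assumes "invariant W" "W \<inter> fixed \<subseteq> {0}"
  obtains ps where "orthonormal_list (unpair ps)" "span (set (unpair ps)) = W"
    "\<And>a b. (a, b) \<in> set ps \<Longrightarrow> rotated a b"
proof -
  have "\<exists>ps. orthonormal_list (unpair ps) \<and> span (set (unpair ps)) = W \<and> (\<forall>(a, b)\<in>set ps. rotated a b)"
    using assms
  proof (induction "dim W" arbitrary: W rule: less_induct)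
    case less
    note W = less.prems(1)
    have sW: "subspace W" using W by (simp add: invariant_def)
    show ?case
    proof (cases "W = {0}")
      case True
      then show ?thesis by (intro exI[of _ "[]"]) simp
    next
      case False
      obtain V where V: "irreducible V" "V \<subseteq> W" using irreducible_exists[OF W False] .
      obtain v where v: "v \<in> V" "v \<noteq> 0"
        using V(1) subspace_0[of V] by (auto simp: irreducible_def invariant_def)
      then have "\<exists>s\<in>S. \<exists>x\<in>V. R s x \<noteq> x" using less.prems(2) V(2) by (auto simp: fixed_def)
      from rotation_plane[OF V(1) this] obtain a b c d where ab: "a \<in> V" "b \<in> V"
        "a \<bullet> a = 1" "b \<bullet> b = 1" "a \<bullet> b = 0"
        and r: "\<And>s. s \<in> S \<Longrightarrow> R s a = c s *\<^sub>R a + d s *\<^sub>R b" "\<And>s. s \<in> S \<Longrightarrow> R s b = c s *\<^sub>R b - d s *\<^sub>R a"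
        by metis
      have abW: "a \<in> W" "b \<in> W" using ab V by auto
      have ba: "b \<bullet> a = 0" using ab by (simp add: inner_commute)
      have rot: "rotated a b"
        unfolding rotated_def
      proof (intro ballI)
        fix s assume "s \<in> S"
        then have "R s a \<bullet> a = c s" "R s a \<bullet> b = d s"
          using r ab ba by (simp_all add: inner_add_left)
        with r[OF \<open>s \<in> S\<close>] show "R s a = (R s a \<bullet> a) *\<^sub>R a + (R s a \<bullet> b) *\<^sub>R b \<and>
           R s b = (R s a \<bullet> a) *\<^sub>R b - (R s a \<bullet> b) *\<^sub>R a" by simp
      qed
      let ?W = "{x\<in>W. x \<bullet> a = 0 \<and> x \<bullet> b = 0}"
      have sW': "subspace ?W" using sW by (auto simp: subspace_def inner_add_left)
      moreover have "R s x \<in> ?W" if "s \<in> S" "x \<in> ?W" for s x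
        using that W uminus[of s] r[of "- s"]
        by (auto simp: R_adjoint inner_add_right inner_diff_right invariant_def)
      ultimately have invW': "invariant ?W" by (simp add: invariant_def)
      have "dim ?W \<noteq> dim W"
      proof
        assume "dim ?W = dim W"
        then have "?W = W" using sW sW' by (intro subspace_dim_equal) auto
        then have "a \<in> ?W" using abW by simp
        then show False using ab by simp
      qed
      moreover have "dim ?W \<le> dim W" by (intro dim_subset) auto
      ultimately have "dim ?W < dim W" by simp
      moreover have "?W \<inter> fixed \<subseteq> {0}" using less.prems(2) by auto
      ultimately obtain ps where ps: "orthonormal_list (unpair ps)" "span (set (unpair ps)) = ?W"
        "\<forall>(a, b)\<in>set ps. rotated a b"
        using less.hyps[of ?W] invW' by blast
      have sub: "set (unpair ps) \<subseteq> ?W" using span_superset[of "set (unpair ps)"] unfolding ps(2) .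
      show ?thesis
      proof (intro exI[of _ "(a, b) # ps"] conjI)
        show "orthonormal_list (unpair ((a, b) # ps))"
          using ps(1) ab sub by (auto simp: inner_commute)
        show "\<forall>(a, b)\<in>set ((a, b) # ps). rotated a b" using ps rot by auto
        show "span (set (unpair ((a, b) # ps))) = W"
        proof
          show "span (set (unpair ((a, b) # ps))) \<subseteq> W"
            using sub abW sW by (intro span_minimal) auto
          show "W \<subseteq> span (set (unpair ((a, b) # ps)))"
          proof
            fix x assume x: "x \<in> W"
            let ?B = "set (unpair ((a, b) # ps))"
            let ?y = "x - (x \<bullet> a) *\<^sub>R a - (x \<bullet> b) *\<^sub>R b"
            have "?y \<in> ?W" using x abW ab ba sW
              by (auto simp: subspace_diff subspace_scale inner_diff_left)
            then have "?y \<in> span (set (unpair ps))" using ps(2) by simp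
            moreover have "span (set (unpair ps)) \<subseteq> span ?B" by (intro span_mono) auto
            ultimately have "?y \<in> span ?B" by blast
            moreover have "a \<in> span ?B" "b \<in> span ?B" by (auto intro: span_base)
            ultimately have "?y + (x \<bullet> a) *\<^sub>R a + (x \<bullet> b) *\<^sub>R b \<in> span ?B"
              by (intro span_add span_scale)
            then show "x \<in> span ?B" by simp
          qed
        qed
      qed
    qed
  qed
  then show ?thesis using that by blast
qed

lemma invariant_orthogonal_complement_fixed: "invariant {x. \<forall>y\<in>fixed. x \<bullet> y = 0}"
proof -
  have "subspace {x. \<forall>y\<in>fixed. x \<bullet> y = 0}" by (auto simp: subspace_def inner_add_left)
  moreover have "R s x \<bullet> y = x \<bullet> y" if "s \<in> S" "y \<in> fixed" for s x y
    using that uminus by (simp add: R_adjoint fixed_def)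
  ultimately show ?thesis by (simp add: invariant_def)
qed

text \<open>
  The rotated pairs span the complement of the fixed space, whatever the fixed vector \<open>u\<close> is; only
  the remaining pairs, on which the group acts trivially, depend on \<open>u\<close>.
\<close>

lemma frame_of_rotation_pairs:
  obtains ps where "orthonormal_list (unpair ps)" "2 * length ps + dim fixed = DIM('a)"
    "\<And>a b. (a, b) \<in> set ps \<Longrightarrow> rotated a b"
    "\<And>u. u \<in> fixed \<Longrightarrow> u \<bullet> u = 1 \<Longrightarrow> odd DIM('a) \<Longrightarrow>
      \<exists>qs. orthonormal_list (u # unpair (ps @ qs)) \<and> length (ps @ qs) = (DIM('a) - 1) div 2 \<and>
        (\<forall>(a, b)\<in>set qs. a \<in> fixed \<and> b \<in> fixed)"
proof -
  define W where "W = {x. \<forall>y\<in>fixed. x \<bullet> y = 0}"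
  have "W \<inter> fixed \<subseteq> {0}"
  proof
    fix x assume "x \<in> W \<inter> fixed"
    then have "x \<bullet> x = 0" by (simp add: W_def)
    then show "x \<in> {0}" by simp
  qed
  from rotation_pairs[OF invariant_orthogonal_complement_fixed[folded W_def] this]
  obtain ps where ps: "orthonormal_list (unpair ps)" "span (set (unpair ps)) = W"
    and rot: "\<And>a b. (a, b) \<in> set ps \<Longrightarrow> rotated a b" by metis
  have sub: "set (unpair ps) \<subseteq> W" using span_superset[of "set (unpair ps)"] unfolding ps(2) .
  \<comment> \<open>Used twice: with a basis of the fixed space for the dimension count, and with a
    set that contains the prescribed vector \<open>u\<close> for the completion.\<close>
  have decomp: "span (set (unpair ps) \<union> T) = UNIV" if T: "fixed \<subseteq> span T" for T
  proof -
    have "x \<in> span (set (unpair ps) \<union> T)" for x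
    proof -
      obtain y z where yz: "y \<in> span fixed" "\<And>w. w \<in> span fixed \<Longrightarrow> orthogonal z w" "x = y + z"
        using orthogonal_subspace_decomp_exists[of fixed x] by metis
      have "y \<in> fixed" using yz(1) subspace_fixed by (simp add: span_eq_iff[THEN iffD2])
      then have "y \<in> span (set (unpair ps) \<union> T)"
        using T span_mono[of T "set (unpair ps) \<union> T"] by blast
      moreover have "z \<in> W" using yz(2) by (simp add: W_def real_inner_class.orthogonal_def span_base)
      then have "z \<in> span (set (unpair ps) \<union> T)"
        using ps(2) span_mono[of "set (unpair ps)" "set (unpair ps) \<union> T"] by blast
      ultimately show ?thesis unfolding yz(3) by (rule span_add)
    qed
    then show ?thesis by blast
  qed
  obtain L where L: "orthonormal_list L" "span (set L) = fixed"
    using orthonormal_list_basis[OF subspace_fixed] .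
  have L': "set L \<subseteq> fixed" using span_superset[of "set L"] unfolding L(2) .
  have "length (unpair ps @ L) = DIM('a)"
  proof -
    have "orthonormal_list (unpair ps @ L)"
      using L(1) L' ps(1) sub by (auto simp: orthonormal_list_append W_def)
    then show ?thesis
      using orthonormal_list_length decomp[of "set L"] L(2) by fastforce
  qed
  moreover have "length L = dim fixed"
    using orthonormal_list_length[OF L(1)] by (simp add: L(2))
  ultimately have "2 * length ps + dim fixed = DIM('a)" by (simp add: length_unpair)
  moreover have "\<exists>qs. orthonormal_list (u # unpair (ps @ qs)) \<and> length (ps @ qs) = (DIM('a) - 1) div 2 \<and>
        (\<forall>(a, b)\<in>set qs. a \<in> fixed \<and> b \<in> fixed)"
    if u: "u \<in> fixed" "u \<bullet> u = 1" "odd DIM('a)" for u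
  proof -
    let ?U = "{x\<in>fixed. x \<bullet> u = 0}"
    have "subspace ?U" using subspace_fixed by (auto simp: subspace_def inner_add_left)
    then obtain M where M: "orthonormal_list M" "span (set M) = ?U"
      by (rule orthonormal_list_basis)
    have M': "set M \<subseteq> ?U" using span_superset[of "set M"] unfolding M(2) .
    have "fixed \<subseteq> span (insert u (set M))"
    proof
      fix x assume x: "x \<in> fixed"
      have "x - (x \<bullet> u) *\<^sub>R u \<in> span (set M)"
        unfolding M(2) using x u subspace_fixed
        by (simp add: subspace_diff subspace_scale inner_diff_left)
      then show "x \<in> span (insert u (set M))" by (auto simp: span_insert)
    qed
    then have sp: "span (set (u # unpair ps @ M)) = UNIV"
      using decomp[of "insert u (set M)"] by simp
    have on: "orthonormal_list (u # unpair ps @ M)"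
      using u M(1) M' ps(1) sub by (auto simp: orthonormal_list_append inner_commute W_def)
    have len: "1 + 2 * length ps + length M = DIM('a)"
      using orthonormal_list_length[OF on] unfolding sp by (simp add: length_unpair)
    \<comment> \<open>Only here does odd dimension enter the completion: without \<open>u\<close>
      and the rotated pairs, an even number of fixed vectors is left to be paired.\<close>
    then have "even (length M)" using u(3) by presburger
    then obtain qs where qs: "unpair qs = M" using unpair_surj by blast
    have "length M = 2 * length qs" using length_unpair[of qs] by (simp add: qs)
    then have "length (ps @ qs) = (DIM('a) - 1) div 2" using len by simp
    moreover have "\<forall>(a, b)\<in>set qs. a \<in> fixed \<and> b \<in> fixed" using in_unpair M' qs by fastforce
    ultimately show ?thesis using on qs by (intro exI[of _ qs]) (simp add: unpair_append)
  qed
  ultimately show ?thesis using that ps(1) rot by blast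
qed

end

section \<open>The adapted frame and the invariance of the form\<close>

lemma dform_map_adjoint:
  assumes "\<And>x y. x \<bullet> T y = T' x \<bullet> y"
  shows "dform as (map T vs) = dform (map T' as) vs"
proof (cases "length vs = length as")
  case True
  have "Matrix.mat (length as) (length as) (\<lambda>(i, j). as ! i \<bullet> map T vs ! j) =
    Matrix.mat (length as) (length as) (\<lambda>(i, j). map T' as ! i \<bullet> vs ! j)"
    using True assms by (intro eq_matI) auto
  then show ?thesis using True by (simp add: dform_def)
qed (simp add: dform_def)

lemma dform_third_row:
  "dform [p, q, x *\<^sub>R a + y *\<^sub>R b] vs = x * dform [p, q, a] vs + y * dform [p, q, b] vs"
  "dform [p, q, x *\<^sub>R a - y *\<^sub>R b] vs = x * dform [p, q, a] vs - y * dform [p, q, b] vs"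
  using dform_row_linear[of "[p, q]" x a y b "[]" vs] dform_row_linear[of "[p, q]" x a "- y" b "[]" vs]
  by simp_all

lemma dform_rotate_plane:
  assumes "x\<^sup>2 + y\<^sup>2 = 1"
  shows "dform [p, x *\<^sub>R a - y *\<^sub>R b, x *\<^sub>R b + y *\<^sub>R a] vs = dform [p, a, b] vs"
proof -
  have "dform [p, a, a] vs = 0" "dform [p, b, b] vs = 0" "dform [p, b, a] vs = - dform [p, a, b] vs"
    using dform_Cons_cong[of "[a, a]" 0 "[a, a]" p vs] dform_Cons_cong[of "[b, b]" 0 "[b, b]" p vs]
      dform_Cons_cong[of "[b, a]" "-1" "[a, b]" p vs] dform_swap[of b a "[]"]
    by (simp_all add: dform_repeat)
  then have "dform [p, x *\<^sub>R a - y *\<^sub>R b, x *\<^sub>R b + y *\<^sub>R a] vs =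
      x * (x * dform [p, a, b] vs) + y * (y * dform [p, a, b] vs)"
    by (simp add: dform_turn(3,4) dform_third_row algebra_simps)
  also have "\<dots> = (x\<^sup>2 + y\<^sup>2) * dform [p, a, b] vs"
    by (simp only: power2_eq_square ring_distribs mult.assoc)
  finally show ?thesis using assms by simp
qed

text \<open>On a line, additivity turns differentiability at 0 into the equation g' = (D x) g, so U
  (t x) = exp (t D x), as the quotient by this exponential has derivative 0. Modulus 1 makes
  \<open>D x\<close> imaginary, and \<open>adjoint (Im \<circ> D) 1\<close> is the vector that
  represents the functional \<open>Im \<circ> D\<close>.\<close>

lemma circle_character:
  fixes U :: "'a::euclidean_space \<Rightarrow> complex"
  assumes add: "\<And>x y. U (x + y) = U x * U y" and norm: "\<And>x. norm (U x) = 1"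
    and diff: "U differentiable (at 0)"
  obtains w where "\<And>x. U x = cis (w \<bullet> x)"
proof -
  obtain D where D: "(U has_derivative D) (at 0)" using diff by (auto simp: differentiable_def)
  have linD: "linear D" using D by (rule has_derivative_linear)
  have U0: "U 0 = 1" using add[of 0 0] norm[of 0] by auto
  have exp: "U (t *\<^sub>R x) = exp (t *\<^sub>R D x)" for x t
  proof -
    define g where "g = (\<lambda>t. U (t *\<^sub>R x))"
    have g0: "(g has_vector_derivative D x) (at 0)"
    proof -
      have "((\<lambda>t. t *\<^sub>R x) has_derivative (\<lambda>t. t *\<^sub>R x)) (at (0::real))"
        by (auto intro!: derivative_eq_intros)
      moreover have "(U has_derivative D) (at (0 *\<^sub>R x))" using D by simp
      ultimately have "(g has_derivative (\<lambda>t. D (t *\<^sub>R x))) (at 0)"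
        unfolding g_def by (rule has_derivative_compose)
      then show ?thesis by (simp add: has_vector_derivative_def linear_scale[OF linD])
    qed
    have gd: "(g has_vector_derivative D x * g s) (at s)" for s
    proof -
      have "g t = g (t - s) * g s" for t by (simp add: g_def add[symmetric] algebra_simps)
      then have "g = (\<lambda>t. g (t - s) * g s)" by blast
      moreover have "((\<lambda>t. g (t - s)) has_vector_derivative D x) (at s)"
      proof -
        have "((\<lambda>t. t - s) has_vector_derivative 1) (at s)"
          by (auto intro!: derivative_eq_intros)
        moreover have "(g has_vector_derivative D x) (at (s - s))" using g0 by simp
        ultimately have "(g \<circ> (\<lambda>t. t - s) has_vector_derivative 1 *\<^sub>R D x) (at s)"
          by (rule vector_diff_chain_at)
        then show ?thesis by (simp add: o_def)
      qed
      then have "((\<lambda>t. g (t - s) * g s) has_vector_derivative D x * g s) (at s)"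
        by (auto intro!: derivative_eq_intros)
      ultimately show ?thesis by simp
    qed
    define h where "h = (\<lambda>t. g t * exp (t *\<^sub>R (- D x)))"
    have "(h has_vector_derivative 0) (at s)" for s
    proof -
      have "((\<lambda>t. exp (t *\<^sub>R (- D x))) has_vector_derivative exp (s *\<^sub>R (- D x)) * (- D x)) (at s)"
        by (rule exp_scaleR_has_vector_derivative_right)
      then have "(h has_vector_derivative g s * (exp (s *\<^sub>R (- D x)) * (- D x)) + D x * g s * exp (s *\<^sub>R (- D x))) (at s)"
        unfolding h_def by (rule has_vector_derivative_mult[OF gd])
      then show ?thesis by (simp add: algebra_simps)
    qed
    then have "h t = h 0"
      using has_derivative_zero_unique[of UNIV h 0 t]
      by (auto simp: has_vector_derivative_def)
    then have "g t * exp (- (t *\<^sub>R D x)) = 1" by (simp add: h_def g_def U0)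
    then show ?thesis by (simp add: g_def exp_minus field_simps)
  qed
  have "Re (D x) = 0" for x
    using norm[of x] exp[of 1 x] by (simp add: norm_exp_eq_Re)
  then have U: "U x = cis (Im (D x))" for x
    using exp[of 1 x] by (simp add: cis_conv_exp) (metis complex_eq_0 complex_eq mult.commute add_0 of_real_0)
  have "linear (Im \<circ> D)"
    by (intro linear_compose linD bounded_linear.linear bounded_linear_Im)
  then have "(Im \<circ> D) x = adjoint (Im \<circ> D) 1 \<bullet> x" for x
    by (metis adjoint_works inner_commute inner_real_def mult.right_neutral)
  then have "U x = cis (adjoint (Im \<circ> D) 1 \<bullet> x)" for x using U by (metis o_apply)
  then show ?thesis using that by blast
qed

section \<open>The coordinate splitting of the group\<close>

lemma coord_proj_in [simp]: "coord_proj K x \<in> coord_space K"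
  by (simp add: coord_proj_def coord_space_def)

lemma coord_proj_id: "x \<in> coord_space K \<Longrightarrow> coord_proj K x = x"
  by (auto simp: coord_proj_def coord_space_def Finite_Cartesian_Product.vec_eq_iff)

lemma coord_proj_add: "coord_proj K (x + y) = coord_proj K x + coord_proj K y"
  by (simp add: coord_proj_def Finite_Cartesian_Product.vec_eq_iff)

lemma coord_proj_inner: "coord_proj K x \<bullet> y = x \<bullet> coord_proj K y"
  by (simp add: coord_proj_def inner_vec_def) (intro sum.cong, auto)

lemma subspace_coord_space: "subspace (coord_space K)"
  by (simp add: subspace_def coord_space_def)

lemma orthogonal_family_action:
  assumes action: "orthogonal_action K \<rho>"
  shows "orthogonal_family \<rho> (coord_space K)"
proof
  note sub = subspace_coord_space[of K]
  fix s t :: vec7 and x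
  assume s: "s \<in> coord_space K"
  show "orthogonal_transformation (\<rho> s)" using action s by (simp add: orthogonal_action_def)
  show "- s \<in> coord_space K" using sub s by (simp add: subspace_neg)
  show "\<exists>t\<in>coord_space K. t + t = s"
    using s sub by (intro bexI[of _ "(1 / 2) *\<^sub>R s"]) (simp_all add: subspace_scale flip: scaleR_add_left)
  assume t: "t \<in> coord_space K"
  show "s + t \<in> coord_space K" using sub s t by (simp add: subspace_add)
  show "\<rho> (s + t) x = \<rho> s (\<rho> t x)" using action s t by (simp add: orthogonal_action_def)
next
  show "0 \<in> coord_space K" by (simp add: coord_space_def)
  show "\<rho> 0 = id" using action by (simp add: orthogonal_action_def)
qed

lemma differentiable_prod_list:
  fixes f :: "'b \<Rightarrow> 'c::real_normed_vector \<Rightarrow> complex"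
  assumes "\<And>p. f p differentiable (at x)"
  shows "(\<lambda>x. \<Prod>p\<leftarrow>ps. f p x) differentiable (at x)"
  by (induction ps) (auto intro: differentiable_mult assms)

context
  fixes K :: "7 set" and \<rho> :: "vec7 \<Rightarrow> vec7 \<Rightarrow> vec7"
  assumes action: "orthogonal_action K \<rho>"
begin

interpretation R: orthogonal_family \<rho> "coord_space K"
  by (rule orthogonal_family_action[OF action])

lemma coord_space_fixed: "coord_space K \<subseteq> R.fixed"
  using action by (auto simp: orthogonal_action_def R.fixed_def)

lemma differentiable_character: "(\<lambda>x. R.character p (coord_proj K x)) differentiable (at x)"
proof -
  have "smooth_on UNIV (\<lambda>x. \<rho> (coord_proj K x) (fst p))"
    using action by (simp add: orthogonal_action_def)
  then have "ck_on (Suc 0) UNIV (\<lambda>x. \<rho> (coord_proj K x) (fst p))" unfolding smooth_on_def by blast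
  then obtain D where "((\<lambda>x. \<rho> (coord_proj K x) (fst p)) has_derivative D) (at x)"
    by (auto simp: differentiable_def)
  then have *: "((\<lambda>x. \<rho> (coord_proj K x) (fst p) \<bullet> v) has_derivative (\<lambda>h. D h \<bullet> v)) (at x)" for v
    by (rule has_derivative_inner_left)
  have "((\<lambda>x. complex_of_real (\<rho> (coord_proj K x) (fst p) \<bullet> fst p) + \<i> * complex_of_real (\<rho> (coord_proj K x) (fst p) \<bullet> snd p))
    has_derivative (\<lambda>h. complex_of_real (D h \<bullet> fst p) + \<i> * complex_of_real (D h \<bullet> snd p))) (at x)"
    by (intro has_derivative_add has_derivative_mult_right has_derivative_of_real *)
  then show ?thesis by (auto simp: differentiable_def R.character_def Complex_eq)
qed

text \<open>
  The covector \<open>w\<close> is the total weight of the rotations. It lies in the fixed coordinate space,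
  so it can be made proportional to the first vector of the frame.
\<close>

lemma adapted_frame:
  obtains e c where
    "orthonormal_list (map e [1..<8 :: nat])"
    "\<And>s. s \<in> coord_space K \<Longrightarrow> \<rho> s (e 1) = e 1"
    "c *\<^sub>R e 1 \<in> coord_space K"
    "R.rotated (e 2) (e 3)" "R.rotated (e 4) (e 5)" "R.rotated (e 6) (e 7)"
    "\<And>x. R.character (e 2, e 3) (coord_proj K x) * R.character (e 4, e 5) (coord_proj K x) *
       R.character (e 6, e 7) (coord_proj K x) = cis (c * (e 1 \<bullet> x))"
proof -
  obtain ps where ps: "orthonormal_list (unpair ps)" "2 * length ps + dim R.fixed = DIM(vec7)"
    "\<And>a b. (a, b) \<in> set ps \<Longrightarrow> R.rotated a b"
    and ext: "\<And>u. u \<in> R.fixed \<Longrightarrow> u \<bullet> u = 1 \<Longrightarrow> odd DIM(vec7) \<Longrightarrow>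
      \<exists>qs. orthonormal_list (u # unpair (ps @ qs)) \<and> length (ps @ qs) = (DIM(vec7) - 1) div 2 \<and>
        (\<forall>(a, b)\<in>set qs. a \<in> R.fixed \<and> b \<in> R.fixed)"
    using R.frame_of_rotation_pairs by blast
  have on: "a \<bullet> a = 1 \<and> b \<bullet> b = 1 \<and> a \<bullet> b = 0" if "orthonormal_list (unpair qs)" "(a, b) \<in> set qs" for a b qs
    using that by (induction qs rule: unpair.induct) auto
  \<comment> \<open>The total phase. Composing with the projection defines it on the whole vector
    space, as \<open>circle_character\<close> requires.\<close>
  define U where "U = (\<lambda>x. \<Prod>p\<leftarrow>ps. R.character p (coord_proj K x))"
  have "U (x + y) = U x * U y" for x y
  proof -
    have "(\<Prod>p\<leftarrow>qs. R.character p (coord_proj K (x + y))) =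
      (\<Prod>p\<leftarrow>qs. R.character p (coord_proj K x)) * (\<Prod>p\<leftarrow>qs. R.character p (coord_proj K y))"
      if "set qs \<subseteq> set ps" for qs
      using that
    proof (induction qs)
      case (Cons p qs)
      obtain a b where "p = (a, b)" "(a, b) \<in> set ps" using Cons.prems by (cases p) auto
      then show ?case
        using Cons R.character_add[of a b] ps(3) on[OF ps(1)] by (simp add: coord_proj_add)
    qed simp
    then show ?thesis by (simp add: U_def)
  qed
  moreover have "norm (U x) = 1" for x
  proof -
    have "norm (\<Prod>p\<leftarrow>qs. R.character p (coord_proj K x)) = 1" if "set qs \<subseteq> set ps" for qs
      using that
    proof (induction qs)
      case (Cons p qs)
      obtain a b where "p = (a, b)" "(a, b) \<in> set ps" using Cons.prems by (cases p) auto
      then show ?case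
        using Cons R.norm_character[of a b] ps(3) on[OF ps(1)] by (simp add: norm_mult)
    qed simp
    then show ?thesis by (simp add: U_def)
  qed
  moreover have "U differentiable (at 0)"
    unfolding U_def by (rule differentiable_prod_list) (rule differentiable_character)
  ultimately obtain w where w: "\<And>x. U x = cis (w \<bullet> x)"
    using circle_character by blast
  define w' where "w' = coord_proj K w"
  have w': "U x = cis (w' \<bullet> x)" for x
    using w[of "coord_proj K x"] by (simp add: U_def w'_def coord_proj_inner coord_proj_id)
  obtain u c where u: "u \<in> R.fixed" "u \<bullet> u = 1" "w' = c *\<^sub>R u"
  proof (cases "w' = 0")
    case True
    \<comment> \<open>For zero total weight any fixed unit vector will do, with
      \<open>c = 0\<close>. There is one because 7 is not twice the number of pairs.\<close>
    have "dim R.fixed \<noteq> 0" using ps(2) by (intro notI) (simp, presburger)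
    then obtain v where v: "v \<in> R.fixed" "v \<noteq> 0" by (metis dim_eq_0 subsetI singleton_iff)
    show ?thesis
    proof (rule that[of "v /\<^sub>R norm v" 0])
      show "v /\<^sub>R norm v \<in> R.fixed" using v R.subspace_fixed by (simp add: subspace_scale)
      show "(v /\<^sub>R norm v) \<bullet> (v /\<^sub>R norm v) = 1" using v by (simp add: dot_square_norm power2_eq_square)
    qed (simp add: True)
  next
    case False
    show ?thesis
    proof (rule that[of "w' /\<^sub>R norm w'" "norm w'"])
      have "w' \<in> R.fixed" using coord_space_fixed by (auto simp: w'_def)
      then show "w' /\<^sub>R norm w' \<in> R.fixed" using R.subspace_fixed by (simp add: subspace_scale)
      show "(w' /\<^sub>R norm w') \<bullet> (w' /\<^sub>R norm w') = 1" using False by (simp add: dot_square_norm power2_eq_square)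
    qed (simp add: False)
  qed
  obtain qs where qs: "orthonormal_list (u # unpair (ps @ qs))" "length (ps @ qs) = 3"
    "\<And>a b. (a, b) \<in> set qs \<Longrightarrow> a \<in> R.fixed \<and> b \<in> R.fixed"
  proof -
    have "odd DIM(vec7)" by simp
    from ext[OF u(1,2) this] obtain qs where "orthonormal_list (u # unpair (ps @ qs))"
      "length (ps @ qs) = (DIM(vec7) - 1) div 2" "\<forall>(a, b)\<in>set qs. a \<in> R.fixed \<and> b \<in> R.fixed"
      by blast
    then show ?thesis using that[of qs] by auto
  qed
  obtain a1 b1 a2 b2 a3 b3 where l: "ps @ qs = [(a1, b1), (a2, b2), (a3, b3)]"
  proof -
    have "\<exists>a1 b1 a2 b2 a3 b3. zs = [(a1, b1), (a2, b2), (a3, b3)]" if "length zs = 3"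
      for zs :: "(vec7 \<times> vec7) list"
      using that by (auto simp: numeral_3_eq_3 length_Suc_conv)
    then show ?thesis using qs(2) that by blast
  qed
  have rot: "R.rotated a b" if "(a, b) \<in> set (ps @ qs)" for a b
    using that ps(3) qs(3)[of a b] on[of "ps @ qs" a b] qs(1) R.rotated_fixed(1)[of a b] by auto
  have "R.character p s = 1" if pq: "p \<in> set qs" and s: "s \<in> coord_space K" for p s
  proof -
    obtain a b where ab: "p = (a, b)" by (cases p)
    then have p: "p = (a, b)" "(a, b) \<in> set qs" using pq by simp_all
    then have "a \<bullet> a = 1" "a \<bullet> b = 0" using on[of "ps @ qs" a b] qs(1) by auto
    then show ?thesis using R.rotated_fixed(2)[of a b s] qs(3)[OF p(2)] s p(1) by simp
  qed
  then have "(\<Prod>p\<leftarrow>qs. R.character p (coord_proj K x)) = 1" for x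
  proof -
    have "(\<Prod>p\<leftarrow>zs. f p) = 1" if "\<forall>p\<in>set zs. f p = 1" for zs :: "(vec7 \<times> vec7) list" and f :: "_ \<Rightarrow> complex"
      using that by (induction zs) auto
    then show ?thesis using \<open>\<And>s p. p \<in> set qs \<Longrightarrow> s \<in> coord_space K \<Longrightarrow> R.character p s = 1\<close> by simp
  qed
  then have prod: "(\<Prod>p\<leftarrow>ps @ qs. R.character p (coord_proj K x)) = cis (c * (u \<bullet> x))" for x
    using w'[of x] u(3) by (simp add: U_def)
  \<comment> \<open>The leading 0 is a filler that shifts the indices to 1, ..., 7.\<close>
  define e where "e = (!) [0, u, a1, b1, a2, b2, a3, b3]"
  have me: "map e [1..<8] = [u, a1, b1, a2, b2, a3, b3]"
    by (simp add: e_def eval_nat_numeral upt_rec)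
  have ev: "e 1 = u" "e 2 = a1" "e 3 = b1" "e 4 = a2" "e 5 = b2" "e 6 = a3" "e 7 = b3"
    by (simp_all add: e_def eval_nat_numeral)
  show ?thesis
  proof (rule that[of e c])
    show "orthonormal_list (map e [1..<8])" unfolding me using qs(1) l by simp
    show "\<rho> s (e 1) = e 1" if "s \<in> coord_space K" for s
      using u(1) that unfolding ev by (auto simp: R.fixed_def)
    show "c *\<^sub>R e 1 \<in> coord_space K" unfolding ev u(3)[symmetric] w'_def by simp
    show "R.rotated (e 2) (e 3)" "R.rotated (e 4) (e 5)" "R.rotated (e 6) (e 7)"
      unfolding ev using rot l by auto
    show "R.character (e 2, e 3) (coord_proj K x) * R.character (e 4, e 5) (coord_proj K x) *
       R.character (e 6, e 7) (coord_proj K x) = cis (c * (e 1 \<bullet> x))" for x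
      unfolding ev using prod[of x] unfolding l by (simp add: mult.assoc)
  qed
qed

text \<open>Pulling a form back by \<open>\<rho> s\<close> applies the adjoint
  \<open>\<rho> (- s)\<close> to its covectors, so the inverse rotation is the one needed in
  coordinates.\<close>

lemma rotated_uminus:
  assumes "R.rotated a b" "a \<bullet> a = 1" "b \<bullet> b = 1" "a \<bullet> b = 0" "s \<in> coord_space K"
  defines "x \<equiv> Re (R.character (a, b) s)" and "y \<equiv> Im (R.character (a, b) s)"
  shows "\<rho> (- s) a = x *\<^sub>R a - y *\<^sub>R b" "\<rho> (- s) b = x *\<^sub>R b + y *\<^sub>R a" "x\<^sup>2 + y\<^sup>2 = 1"
proof -
  have r: "\<rho> u a = (\<rho> u a \<bullet> a) *\<^sub>R a + (\<rho> u a \<bullet> b) *\<^sub>R b" "\<rho> u b = (\<rho> u a \<bullet> a) *\<^sub>R b - (\<rho> u a \<bullet> b) *\<^sub>R a"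
    if "u \<in> coord_space K" for u
    using assms(1) that unfolding R.rotated_def by blast+
  have ba: "b \<bullet> a = 0" using assms(4) by (simp add: inner_commute)
  have "\<rho> (- s) a \<bullet> a = a \<bullet> \<rho> s a" "\<rho> (- s) a \<bullet> b = a \<bullet> \<rho> s b"
    using R.R_adjoint[of "- s" a] R.uminus assms(5) by simp_all
  moreover have "a \<bullet> \<rho> s a = x" by (simp add: x_def R.character_def inner_commute)
  moreover have "a \<bullet> \<rho> s b = - y"
    by (subst r(2)[OF assms(5)]) (simp add: y_def R.character_def inner_diff_right assms(2,4))
  ultimately show "\<rho> (- s) a = x *\<^sub>R a - y *\<^sub>R b" "\<rho> (- s) b = x *\<^sub>R b + y *\<^sub>R a"
    using r[OF R.uminus[OF assms(5)]] by simp_all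
  show "x\<^sup>2 + y\<^sup>2 = 1"
    using R.norm_character[OF assms(1-5)] by (simp add: cmod_def x_def y_def)
qed

text \<open>Let u = exp (i c (e_1 . \<gamma>)) be the product of the three phases. Pulling back by
  the rotation replaces Omega by u Omega, while moving the base point multiplies the phase exp (- i
  c x_1) by the conjugate of u. The two effects cancel, and e^1 \<and> \<omega> is preserved by the
  rotation.\<close>

lemma twisted_invariant:
  assumes e: "frame e" and e1_fixed: "\<And>s. s \<in> coord_space K \<Longrightarrow> \<rho> s (e 1) = e 1"
    and rot: "R.rotated (e 2) (e 3)" "R.rotated (e 4) (e 5)" "R.rotated (e 6) (e 7)"
    and char: "\<And>x. R.character (e 2, e 3) (coord_proj K x) * R.character (e 4, e 5) (coord_proj K x) *
       R.character (e 6, e 7) (coord_proj K x) = cis (c * (e 1 \<bullet> x))"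
  shows "twisted e c (\<gamma> + \<rho> (coord_proj K \<gamma>) x) (map (\<rho> (coord_proj K \<gamma>)) vs) = twisted e c x vs"
proof -
  define s where "s = coord_proj K \<gamma>"
  have s: "s \<in> coord_space K" "- s \<in> coord_space K" using R.uminus by (simp_all add: s_def)
  have n: "e i \<bullet> e j = (if i = j then 1 else 0)" if "i \<in> {1..7}" "j \<in> {1..7}" for i j
    using frame_inner[OF e that] .
  define u1 u2 u3 where "u1 = R.character (e 2, e 3) s" and "u2 = R.character (e 4, e 5) s"
    and "u3 = R.character (e 6, e 7) s"
  note R1 = rotated_uminus[OF rot(1) _ _ _ s(1), folded u1_def]
  note R2 = rotated_uminus[OF rot(2) _ _ _ s(1), folded u2_def]
  note R3 = rotated_uminus[OF rot(3) _ _ _ s(1), folded u3_def]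
  have e1: "\<rho> (- s) (e 1) = e 1" using e1_fixed s by simp
  have rows: "\<rho> (- s) (e 2) = Re u1 *\<^sub>R e 2 - Im u1 *\<^sub>R e 3" "\<rho> (- s) (e 3) = Re u1 *\<^sub>R e 3 + Im u1 *\<^sub>R e 2"
    "\<rho> (- s) (e 4) = Re u2 *\<^sub>R e 4 - Im u2 *\<^sub>R e 5" "\<rho> (- s) (e 5) = Re u2 *\<^sub>R e 5 + Im u2 *\<^sub>R e 4"
    "\<rho> (- s) (e 6) = Re u3 *\<^sub>R e 6 - Im u3 *\<^sub>R e 7" "\<rho> (- s) (e 7) = Re u3 *\<^sub>R e 7 + Im u3 *\<^sub>R e 6"
    "(Re u1)\<^sup>2 + (Im u1)\<^sup>2 = 1" "(Re u2)\<^sup>2 + (Im u2)\<^sup>2 = 1" "(Re u3)\<^sup>2 + (Im u3)\<^sup>2 = 1"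
    by (rule R1 R2 R3; simp add: n)+
  have adj: "dform as (map (\<rho> s) vs) = dform (map (\<rho> (- s)) as) vs" for as
    by (rule dform_map_adjoint) (use R.R_adjoint[of "- s"] s in simp)
  have om: "frame_form e omega1_list (map (\<rho> s) vs) = frame_form e omega1_list vs"
    by (simp add: frame_form_def omega1_list_def adj rows(1-6) e1[simplified] dform_rotate_plane rows(7-9))
  define C S where "C = cos (c * (e 1 \<bullet> \<gamma>))" and "S = sin (c * (e 1 \<bullet> \<gamma>))"
  have u: "u1 * u2 * u3 = Complex C S"
    using char[of \<gamma>] by (simp add: u1_def u2_def u3_def s_def cis.ctr C_def S_def)
  have C: "C = Re u1 * Re u2 * Re u3 - Im u1 * Im u2 * Re u3 - Re u1 * Im u2 * Im u3 - Im u1 * Re u2 * Im u3"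
    using arg_cong[OF u, of Re] by (simp add: algebra_simps)
  have S: "S = Re u1 * Re u2 * Im u3 - Im u1 * Im u2 * Im u3 + Re u1 * Im u2 * Re u3 + Im u1 * Re u2 * Re u3"
    using arg_cong[OF u, of Im] by (simp add: algebra_simps)
  have re: "frame_form e re_list (map (\<rho> s) vs) = C * frame_form e re_list vs - S * frame_form e im_list vs"
    unfolding C S
    by (simp add: frame_form_def re_list_def im_list_def adj rows(1-6) dform_turn dform_third_row algebra_simps)
  have im: "frame_form e im_list (map (\<rho> s) vs) = C * frame_form e im_list vs + S * frame_form e re_list vs"
    unfolding C S
    by (simp add: frame_form_def re_list_def im_list_def adj rows(1-6) dform_turn dform_third_row algebra_simps)
  have "e 1 \<bullet> \<rho> s x = e 1 \<bullet> x"
    using R.inner_R[OF s(1), of "e 1" x] e1_fixed[OF s(1)] by simp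
  then have "c *\<^sub>R e 1 \<bullet> (\<gamma> + \<rho> s x) = c * (e 1 \<bullet> \<gamma>) + c *\<^sub>R e 1 \<bullet> x"
    by (simp add: inner_add_right algebra_simps)
  then have cs: "cos (c *\<^sub>R e 1 \<bullet> (\<gamma> + \<rho> s x)) = C * cos (c *\<^sub>R e 1 \<bullet> x) - S * sin (c *\<^sub>R e 1 \<bullet> x)"
    "sin (c *\<^sub>R e 1 \<bullet> (\<gamma> + \<rho> s x)) = S * cos (c *\<^sub>R e 1 \<bullet> x) + C * sin (c *\<^sub>R e 1 \<bullet> x)"
    by (simp_all only: cos_add sin_add C_def S_def)
  have CS: "C\<^sup>2 + S\<^sup>2 = 1" by (simp add: C_def S_def)
  define p q A B where "p = cos (c *\<^sub>R e 1 \<bullet> x)" and "q = sin (c *\<^sub>R e 1 \<bullet> x)"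
    and "A = frame_form e re_list vs" and "B = frame_form e im_list vs"
  \<comment> \<open>The real form of the cancellation: conjugate u times u is
    \<open>C\<^sup>2 + S\<^sup>2\<close>.\<close>
  have "(C * p - S * q) * (C * A - S * B) + (S * p + C * q) * (C * B + S * A) = (C\<^sup>2 + S\<^sup>2) * (p * A + q * B)"
    by (simp add: algebra_simps power2_eq_square)
  then show ?thesis
    unfolding s_def[symmetric] twisted_eq[OF e] om re im cs using CS
    by (simp add: p_def q_def A_def B_def)
qed

section \<open>The quotient\<close>

text \<open>The coordinates in \<open>K\<close> are inner products with axis vectors, which the
  orthogonal map \<open>\<rho> s\<close> fixes.\<close>

lemma coord_proj_action: "s \<in> coord_space K \<Longrightarrow> coord_proj K (\<rho> s y) = coord_proj K y"
proof -
  assume s: "s \<in> coord_space K"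
  have "\<rho> s y $ i = y $ i" if i: "i \<in> K" for i
  proof -
    have "axis i 1 \<in> coord_space K" using i by (auto simp: coord_space_def axis_def)
    then have "\<rho> s (axis i 1) = axis i 1" using action s by (simp add: orthogonal_action_def)
    then show ?thesis using R.inner_R[OF s, of y "axis i 1"] by (simp add: inner_axis)
  qed
  then show ?thesis by (simp add: coord_proj_def Finite_Cartesian_Product.vec_eq_iff)
qed

lemma semidirect_mult: "x \<otimes>\<^bsub>semidirect K \<rho>\<^esub> y = x + \<rho> (coord_proj K x) y"
  and semidirect_carrier: "carrier (semidirect K \<rho>) = UNIV"
  and semidirect_one: "\<one>\<^bsub>semidirect K \<rho>\<^esub> = 0"
  by (simp_all add: semidirect_def)

lemma group_semidirect: "group (semidirect K \<rho>)"
proof (rule groupI)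
  fix x y z
  have lin: "linear (\<rho> (coord_proj K v))" for v by (rule R.linear_R) simp
  show "x \<otimes>\<^bsub>semidirect K \<rho>\<^esub> y \<otimes>\<^bsub>semidirect K \<rho>\<^esub> z = x \<otimes>\<^bsub>semidirect K \<rho>\<^esub> (y \<otimes>\<^bsub>semidirect K \<rho>\<^esub> z)"
    by (simp add: semidirect_mult coord_proj_add coord_proj_action R.add linear_add[OF lin])
  have p0: "coord_proj K 0 = 0" by (simp add: coord_proj_def Finite_Cartesian_Product.vec_eq_iff)
  show "\<one>\<^bsub>semidirect K \<rho>\<^esub> \<otimes>\<^bsub>semidirect K \<rho>\<^esub> x = x"
    by (simp add: semidirect_mult semidirect_one p0 R.zero)
  have m: "coord_proj K (- v) = - coord_proj K v" for v
    by (simp add: coord_proj_def Finite_Cartesian_Product.vec_eq_iff)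
  let ?y = "\<rho> (- coord_proj K x) (- x)"
  have "coord_proj K ?y = - coord_proj K x" by (simp add: coord_proj_action R.uminus m)
  then have "?y \<otimes>\<^bsub>semidirect K \<rho>\<^esub> x = \<one>\<^bsub>semidirect K \<rho>\<^esub>"
    using linear_neg[OF R.linear_R[of "- coord_proj K x"], of x] by (simp add: semidirect_mult semidirect_one R.uminus)
  then show "\<exists>y\<in>carrier (semidirect K \<rho>). y \<otimes>\<^bsub>semidirect K \<rho>\<^esub> x = \<one>\<^bsub>semidirect K \<rho>\<^esub>"
    by (auto simp: semidirect_carrier)
qed (simp_all add: semidirect_carrier)

lemma coset_eqE:
  assumes \<Gamma>: "subgroup \<Gamma> (semidirect K \<rho>)"
    and eq: "\<Gamma> #>\<^bsub>semidirect K \<rho>\<^esub> x = \<Gamma> #>\<^bsub>semidirect K \<rho>\<^esub> y"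
  obtains \<gamma> where "\<gamma> \<in> \<Gamma>" "y = \<gamma> + \<rho> (coord_proj K \<gamma>) x"
proof -
  have "y \<in> \<Gamma> #>\<^bsub>semidirect K \<rho>\<^esub> y"
    using group.rcos_self[OF group_semidirect _ \<Gamma>, of y] by (simp add: semidirect_carrier)
  then have "y \<in> \<Gamma> #>\<^bsub>semidirect K \<rho>\<^esub> x" by (simp only: eq)
  then show ?thesis using that unfolding r_coset_def semidirect_mult by auto
qed

lemma coset_translate:
  assumes \<Gamma>: "subgroup \<Gamma> (semidirect K \<rho>)" "\<gamma> \<in> \<Gamma>"
  shows "\<Gamma> #>\<^bsub>semidirect K \<rho>\<^esub> (\<gamma> + \<rho> (coord_proj K \<gamma>) x) = \<Gamma> #>\<^bsub>semidirect K \<rho>\<^esub> x"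
  using group.coset_mult_assoc[OF group_semidirect, of \<Gamma> \<gamma> x] group.coset_join2[OF group_semidirect _ \<Gamma>(1), of \<gamma>] \<Gamma>(2)
  by (simp add: semidirect_carrier semidirect_mult)

text \<open>
  Changes of coordinates are locally left translations, because injectivity of the projection on
  the second chart leaves no other choice.
\<close>

lemma transition_derivative:
  assumes \<Gamma>: "subgroup \<Gamma> (semidirect K \<rho>)"
    and V: "open V" "inj_on (\<lambda>x. \<Gamma> #>\<^bsub>semidirect K \<rho>\<^esub> x) V"
    and V': "open V'" "inj_on (\<lambda>x. \<Gamma> #>\<^bsub>semidirect K \<rho>\<^esub> x) V'"
    and \<gamma>: "\<gamma> \<in> \<Gamma>" and x: "x \<in> V" "\<gamma> + \<rho> (coord_proj K \<gamma>) x \<in> V'"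
  defines "\<pi> \<equiv> \<lambda>x. \<Gamma> #>\<^bsub>semidirect K \<rho>\<^esub> x"
  shows "frechet_derivative (inv_into V' \<pi> \<circ> inv_into (\<pi> ` V) (inv_into V \<pi>)) (at x) = \<rho> (coord_proj K \<gamma>)"
proof -
  let ?f = "\<lambda>x. \<gamma> + \<rho> (coord_proj K \<gamma>) x"
  \<comment> \<open>On this neighbourhood of \<open>x\<close> the translate stays in
    \<open>V'\<close>, so the chart inverse followed by the second chart is the affine map
    \<open>?f\<close>, whose derivative is its linear part.\<close>
  let ?W = "V \<inter> ?f -` V'"
  have lin: "bounded_linear (\<rho> (coord_proj K \<gamma>))"
    using R.linear_R[of "coord_proj K \<gamma>"] by (simp add: linear_conv_bounded_linear)
  have d: "(?f has_derivative \<rho> (coord_proj K \<gamma>)) (at x)"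
    using has_derivative_add[OF has_derivative_const bounded_linear_imp_has_derivative[OF lin], of \<gamma> "at x"] by simp
  have "continuous_on UNIV ?f" by (intro continuous_intros linear_continuous_on lin)
  then have "open (?f -` V')" using V'(1) by (rule open_vimage[rotated])
  then have "open ?W" using V(1) by (intro open_Int)
  moreover have "x \<in> ?W" using x by simp
  moreover have "?f y = (inv_into V' \<pi> \<circ> inv_into (\<pi> ` V) (inv_into V \<pi>)) y" if "y \<in> ?W" for y
  proof -
    have "inv_into V \<pi> (\<pi> y) = y" using that V(2) by (simp add: \<pi>_def inv_into_f_f)
    moreover have "inj_on (inv_into V \<pi>) (\<pi> ` V)" by (rule inj_on_inv_into) simp
    ultimately have "inv_into (\<pi> ` V) (inv_into V \<pi>) y = \<pi> y"
      using that inv_into_f_f[of "inv_into V \<pi>" "\<pi> ` V" "\<pi> y"] by auto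
    moreover have "\<pi> y = \<pi> (?f y)" unfolding \<pi>_def using coset_translate[OF \<Gamma> \<gamma>, of y] by simp
    moreover have "inv_into V' \<pi> (\<pi> (?f y)) = ?f y" using that V'(2) by (simp add: \<pi>_def inv_into_f_f)
    ultimately show ?thesis by simp
  qed
  ultimately have "((inv_into V' \<pi> \<circ> inv_into (\<pi> ` V) (inv_into V \<pi>)) has_derivative \<rho> (coord_proj K \<gamma>)) (at x)"
    by (rule has_derivative_transform_within_open[OF d])
  then show ?thesis by (rule frechet_derivative_at[symmetric])
qed

text \<open>The charts are local sections of the projection and differ by translations by elements
  of \<Gamma>. One expression can therefore serve in every chart, and the transformation rule
  becomes invariance under \<Gamma>.\<close>

lemma is_tensor_field_of_invariant:
  assumes \<Gamma>: "subgroup \<Gamma> (semidirect K \<rho>)"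
    and \<Phi>: "\<And>x. multilinear p (\<Phi> x)" "\<And>S vs. smooth_on S (\<lambda>x. \<Phi> x vs)"
    and inv: "\<And>\<gamma> x vs. \<gamma> \<in> \<Gamma> \<Longrightarrow> \<Phi> (\<gamma> + \<rho> (coord_proj K \<gamma>) x) (map (\<rho> (coord_proj K \<gamma>)) vs) = \<Phi> x vs"
  shows "is_tensor_field (quotient_atlas (semidirect K \<rho>) \<Gamma>) p (\<lambda>_. \<Phi>)"
proof -
  define \<pi> where "\<pi> = (\<lambda>x. \<Gamma> #>\<^bsub>semidirect K \<rho>\<^esub> x)"
  have "\<Phi> (\<kappa> q) vs = \<Phi> (\<kappa>' q) (map (frechet_derivative (\<kappa>' \<circ> inv_into U \<kappa>) (at (\<kappa> q))) vs)"
    if UU: "(U, \<kappa>) \<in> quotient_atlas (semidirect K \<rho>) \<Gamma>" "(U', \<kappa>') \<in> quotient_atlas (semidirect K \<rho>) \<Gamma>"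
      "q \<in> U" "q \<in> U'" for U \<kappa> U' \<kappa>' q vs
  proof -
    obtain V where V: "open V" "inj_on \<pi> V" "U = \<pi> ` V" "\<kappa> = inv_into V \<pi>"
      using UU(1) by (auto simp: quotient_atlas_def \<pi>_def)
    obtain V' where V': "open V'" "inj_on \<pi> V'" "U' = \<pi> ` V'" "\<kappa>' = inv_into V' \<pi>"
      using UU(2) by (auto simp: quotient_atlas_def \<pi>_def)
    have k: "\<kappa> q \<in> V" "\<pi> (\<kappa> q) = q" "\<kappa>' q \<in> V'" "\<pi> (\<kappa>' q) = q"
      using UU V V' by (auto simp: inv_into_into f_inv_into_f)
    then obtain \<gamma> where \<gamma>: "\<gamma> \<in> \<Gamma>" "\<kappa>' q = \<gamma> + \<rho> (coord_proj K \<gamma>) (\<kappa> q)"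
      using coset_eqE[OF \<Gamma>, of "\<kappa> q" "\<kappa>' q"] by (auto simp: \<pi>_def)
    have "frechet_derivative (\<kappa>' \<circ> inv_into U \<kappa>) (at (\<kappa> q)) = \<rho> (coord_proj K \<gamma>)"
      unfolding V V' \<pi>_def using V V' k \<gamma> by (intro transition_derivative \<Gamma>) (auto simp: \<pi>_def)
    then show ?thesis using inv[OF \<gamma>(1)] \<gamma>(2) by simp
  qed
  then show ?thesis unfolding is_tensor_field_def using \<Phi> by fast
qed

end

theorem mainTheorem4:
  fixes K :: "7 set" and \<rho> :: "vec7 \<Rightarrow> vec7 \<Rightarrow> vec7" and \<Gamma> :: "vec7 set"
  assumes "flat_lie_group K \<rho>"
    and "splittable_lattice \<Gamma> K \<rho>"
  defines "M \<equiv> quotient_atlas (semidirect K \<rho>) \<Gamma>"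
  shows "(\<exists>\<phi>. G2_structure M \<phi> \<and> coclosed M \<phi>) \<and>
    (\<exists>\<phi>. G2_structure M \<phi> \<and> divergence_free M \<phi>)"
proof -
  have action: "orthogonal_action K \<rho>" using assms(1) by (simp add: flat_lie_group_def)
  have \<Gamma>: "subgroup \<Gamma> (semidirect K \<rho>)"
    using assms(2) by (simp add: splittable_lattice_def is_lattice_def)
  obtain e c where on: "orthonormal_list (map e [1..<8 :: nat])"
    and ec: "\<And>s. s \<in> coord_space K \<Longrightarrow> \<rho> s (e 1) = e 1"
    "orthogonal_family.rotated \<rho> (coord_space K) (e 2) (e 3)"
    "orthogonal_family.rotated \<rho> (coord_space K) (e 4) (e 5)"
    "orthogonal_family.rotated \<rho> (coord_space K) (e 6) (e 7)"
    "\<And>x. orthogonal_family.character \<rho> (e 2, e 3) (coord_proj K x) *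
       orthogonal_family.character \<rho> (e 4, e 5) (coord_proj K x) *
       orthogonal_family.character \<rho> (e 6, e 7) (coord_proj K x) = cis (c * (e 1 \<bullet> x))"
    using adapted_frame[OF action] by metis
  have e: "frame e"
    unfolding frame_def orthonormal_frame_euclid using orthonormal_list_nth[OF on] by simp
  define \<phi> where "\<phi> = (\<lambda>_ :: vec7 set chart. twisted e c)"
  have smooth: "smooth_on S (\<lambda>x. twisted e c x vs)" for S vs
    unfolding twisted_eq[OF e] by (rule smooth_on_trig)
  have "is_tensor_field M 3 \<phi>"
    unfolding M_def \<phi>_def
    by (intro is_tensor_field_of_invariant[OF action \<Gamma>] multilinear_twisted[OF e] smooth
        twisted_invariant[OF action e ec])
  moreover have "alternating 3 (twisted e c x)" "is_G2_form (twisted e c x)" for x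
    unfolding twisted_def
    by (intro alternating_frame_form homogeneous_phi is_G2_form_phi frame_turn e)+
  ultimately have "G2_structure M \<phi>"
    by (auto simp: G2_structure_def is_differential_form_def \<phi>_def)
  moreover have "coclosed M \<phi>"
    by (auto simp: coclosed_def \<phi>_def ext_deriv_star_twisted[OF e])
  moreover have "divergence_free M \<phi>"
    by (auto simp: divergence_free_def \<phi>_def div_torsion_twisted[OF e])
  ultimately show ?thesis by blast
qed

end
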